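(* Let $f$ be a concave-convex flux, $\alpha>0$, $p\ge0$. Let $\varphi^\flat_{\alpha,p}$ be the kinetic function associated with traveling waves of $$u_t+f(u)_x=\alpha\big(|u_x|^p\,u_x\big)_x+u_{xxx},$$ and, for $0\le p\le1/3$, let $A^\natural_p$ be the associated threshold function (definitions in the context). Then the derivative $(\varphi^\flat_{\alpha,p})'(0)$ exists and: (a) if $p=0$: $(\varphi^\flat_{\alpha,0})'(0)=(\varphi^\natural)'(0)=-1/2$, and the one-sided derivatives $(A^\natural_0)'(0\pm)$ exist and are nonzero; (b) if $0<p\le1/3$: $(\varphi^\flat_{\alpha,p})'(0)=-1/2$ and $\lim_{u\to0\pm}A^\natural_p(u)/|u|=+\infty$; (c) if $1/3<p<1/2$: $(\varphi^\flat_{\alpha,p})'(0)=-1/2$; (d) if $p=1/2$: $(\varphi^\flat_{\alpha,1/2})'(0)\in(-1,-1/2)$, with $\lim_{\alpha\to0+}(\varphi^\flat_{\alpha,1/2})'(0)=-1$ and $\lim_{\alpha\to+\infty}(\varphi^\flat_{\alpha,1/2})'(0)=-1/2$; (e) if $p>1/2$: $(\varphi^\flat_{\alpha,p})'(0)=-1$.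
   Context: A flux $f\in C^3(\mathbb{R})$ is concave-convex if $u\,f''(u)>0$ for $u\neq0$, $f'''(0)\neq0$, and $f'(u)\to+\infty$ as $u\to\pm\infty$. The tangent function $\varphi^\natural$: $\varphi^\natural(0)=0$ and for $u\neq0$, $\varphi^\natural(u)\ne u$ with $f'(\varphi^\natural(u))=\frac{f(u)-f(\varphi^\natural(u))}{u-\varphi^\natural(u)}$. A traveling wave connecting $u_-$ to $u_+\neq u_-$ is a $C^2$ function $w$ with $w(\pm\infty)=u_\pm$, $w'(\pm\infty)=0$, solving $$-\lambda(w-u_-)+f(w)-f(u_-)=\alpha|w'|^pw'+w''$$ with $\lambda=\frac{f(u_+)-f(u_-)}{u_+-u_-}$. The kinetic function $\varphi^\flat_{\alpha,p}:\mathbb{R}\to\mathbb{R}$ is the (unique) function such that, for $u\neq0$, $\varphi^\flat_{\alpha,p}(u)$ is the unique endpoint $u_+$ on the opposite side of $0$ from $u$, beyond or at $\varphi^\natural(u)$, reachable from $u$ by a traveling wave; $\varphi^\flat_{\alpha,p}(0)=0$. For $0\le p\le 1/3$, $A^\natural_p:\mathbb{R}\to[0,\infty)$ is the continuous function with $A^\natural_p(0)=0$ such that for $u\ne0$, $\varphi^\flat_{\alpha,p}(u)=\varphi^\natural(u)$ if and only if $\alpha\ge A^\natural_p(u)$. *)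

theory Defs
  imports "HOL-Analysis.Analysis"
begin

definition C3 :: "(real \<Rightarrow> real) \<Rightarrow> bool" where
  "C3 f \<longleftrightarrow> (\<exists>f1 f2 f3.
      (\<forall>u. (f has_real_derivative f1 u) (at u)) \<and>
      (\<forall>u. (f1 has_real_derivative f2 u) (at u)) \<and>
      (\<forall>u. (f2 has_real_derivative f3 u) (at u)) \<and>
      continuous_on UNIV f3)"

definition concave_convex :: "(real \<Rightarrow> real) \<Rightarrow> bool" where
  "concave_convex f \<longleftrightarrow> C3 f \<and>
     (\<forall>u. u \<noteq> 0 \<longrightarrow> u * deriv (deriv f) u > 0) \<and>
     deriv (deriv (deriv f)) 0 \<noteq> 0 \<and>
     filterlim (deriv f) at_top at_top \<and>
     filterlim (deriv f) at_top at_bot"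

definition tangent_fun :: "(real \<Rightarrow> real) \<Rightarrow> real \<Rightarrow> real" where
  "tangent_fun f u = (if u = 0 then 0 else
     (THE v. v \<noteq> u \<and> deriv f v = (f u - f v) / (u - v)))"

text \<open>C^2 traveling wave connecting um to up for
  u_t + f(u)_x = alpha (|u_x|^p u_x)_x + u_xxx.\<close>
definition traveling_wave ::
  "(real \<Rightarrow> real) \<Rightarrow> real \<Rightarrow> real \<Rightarrow> real \<Rightarrow> real \<Rightarrow> (real \<Rightarrow> real) \<Rightarrow> bool" where
  "traveling_wave f \<alpha> p um up w \<longleftrightarrow> up \<noteq> um \<and>
     (\<exists>w1 w2. (\<forall>x. (w has_real_derivative w1 x) (at x)) \<and>
              (\<forall>x. (w1 has_real_derivative w2 x) (at x)) \<and>
              continuous_on UNIV w2 \<and>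
              (w \<longlongrightarrow> um) at_bot \<and> (w \<longlongrightarrow> up) at_top \<and>
              (w1 \<longlongrightarrow> 0) at_bot \<and> (w1 \<longlongrightarrow> 0) at_top \<and>
              (\<forall>x. - ((f up - f um) / (up - um)) * (w x - um) + f (w x) - f um
                     = \<alpha> * (\<bar>w1 x\<bar> powr p) * w1 x + w2 x))"

definition kinetic_fun :: "(real \<Rightarrow> real) \<Rightarrow> real \<Rightarrow> real \<Rightarrow> real \<Rightarrow> real" where
  "kinetic_fun f \<alpha> p u = (if u = 0 then 0 else
     (THE up. up * u < 0 \<and> \<bar>up\<bar> \<ge> \<bar>tangent_fun f u\<bar> \<and>
              (\<exists>w. traveling_wave f \<alpha> p u up w)))"

text \<open>Threshold function A-natural_p (meaningful for 0 \<le> p \<le> 1/3).\<close>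
definition threshold_fun :: "(real \<Rightarrow> real) \<Rightarrow> real \<Rightarrow> real \<Rightarrow> real" where
  "threshold_fun f p = (THE A. continuous_on UNIV A \<and> (\<forall>u. A u \<ge> 0) \<and> A 0 = 0 \<and>
     (\<forall>u \<alpha>. u \<noteq> 0 \<longrightarrow> \<alpha> > 0 \<longrightarrow>
        (kinetic_fun f \<alpha> p u = tangent_fun f u \<longleftrightarrow> \<alpha> \<ge> A u)))"

end

theory Submission
  imports Defs
begin

text \<open>
  Replacing \<open>f\<close> by \<open>s \<mapsto> f (u s) / u^3\<close> turns waves with left state \<open>u\<close> and viscosity \<open>\<alpha>\<close> into waves with
  left state \<open>1\<close> and viscosity \<open>\<beta> = \<alpha> \<bar>u\<bar> powr (2 p - 1)\<close>, and modulo affine functions the rescaled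
  fluxes tend to a cubic as \<open>u\<close> tends to \<open>0\<close>. Hence the derivative at \<open>0\<close> of the kinetic function is the
  limit of the kinetic values at \<open>1\<close> of the rescaled problems, and \<open>\<beta>\<close> tends to infinity, is constant, or
  tends to \<open>0\<close> according to whether \<open>p\<close> is less than, equal to, or greater than \<open>1/2\<close>.

  For the left state \<open>1\<close> a wave is monotone, and \<open>y = w'^2\<close>, as a function of \<open>s = w\<close>, solves
  \<open>y' = 2 g(s) + 2 \<beta> y powr ((p + 1) / 2)\<close> with \<open>y(1) = 0\<close>, where \<open>g\<close> is the difference between the flux and
  its chord. The right-hand side is nondecreasing in \<open>y\<close>, so that solving towards smaller \<open>s\<close> is
  unique, stable, and monotone in \<open>g\<close> and \<open>\<beta>\<close>; a state \<open>v\<close> is reached by a wave iff \<open>y(v) = 0\<close>, and the sign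
  of \<open>y(v)\<close> tells on which side of \<open>v\<close> the kinetic value lies.
\<close>

section \<open>Backward comparison and initial value problems with monotone right-hand side\<close>

text \<open>For p < 1 the exponent q = (p + 1) / 2 is below 1, so the phase-plane equation is not
  Lipschitz at y = 0, which is exactly where it starts and where a wave has to end. Uniqueness
  towards larger s may fail there; hence every comparison runs towards smaller s and uses only
  monotonicity in y, and existence comes from monotone Lipschitz approximations. The critical
  exponents come from the tangent point, where g has a double zero: with x = s - tau the source is
  of order x^2. A barrier x^3 has slope of order x^2, and y powr q is then of order x powr (3 q),
  which controls the source for large viscosity when 3 q is at most 2, that is, p is at most 1/3.
  For q = 3/4 (p = 1/2) a solution vanishing at the tangent point is at most of order x^4, its power
  term of order x^3, and the source wins for every viscosity. Strict signs of y are stable under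
  perturbation, which gives the limits of the kinetic values. At the tangent point, however, y is
  never negative, so having reached the threshold means y = 0, which is not a stable condition. This
  is why continuity of the threshold needs an explicit supersolution.\<close>

lemma has_real_derivative_continuous_on:
  assumes "\<And>s. s \<in> A \<Longrightarrow> (f has_real_derivative f' s) (at s within A)"
  shows "continuous_on A f"
  unfolding continuous_on_eq_continuous_within
proof
  fix s assume "s \<in> A"
  from DERIV_continuous[OF assms[OF this]] show "continuous (at s within A) f" .
qed

lemma mvt_within_Icc:
  fixes f f' :: "real \<Rightarrow> real"
  assumes "a < b" "\<And>s. s \<in> {a..b} \<Longrightarrow> (f has_real_derivative f' s) (at s within {a..b})"
  shows "\<exists>x\<in>{a<..<b}. f b - f a = f' x * (b - a)"
proof -
  have "\<And>x. a \<le> x \<Longrightarrow> x \<le> b \<Longrightarrow> (f has_derivative (\<lambda>h. f' x * h)) (at x within {a..b})"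
    using assms(2) by (auto simp: has_field_derivative_def)
  from mvt_simple[OF assms(1) this] show ?thesis by auto
qed

text \<open>If \<open>d s > 0\<close>, let \<open>t\<close> be the first point after
  \<open>s\<close> with \<open>d t \<le> 0\<close>. Up to \<open>t\<close> the function is positive,
  hence nondecreasing, so it cannot have come down. A sign condition restricted to
  \<open>d > 0\<close> is just what a right-hand side nondecreasing in the unknown provides.\<close>

lemma backward_comparison:
  fixes d d' :: "real \<Rightarrow> real"
  assumes der: "\<And>s. s \<in> {a..b} \<Longrightarrow> (d has_real_derivative d' s) (at s within {a..b})"
    and db: "d b \<le> 0" and sg: "\<And>s. s \<in> {a..b} \<Longrightarrow> d s > 0 \<Longrightarrow> d' s \<ge> 0"
    and s: "s \<in> {a..b}"
  shows "d s \<le> 0"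
proof (rule ccontr)
  assume neg: "\<not> d s \<le> 0"
  define A where "A = {t \<in> {s..b}. d t \<le> 0}"
  have contab: "continuous_on {a..b} d"
    using der has_real_derivative_continuous_on by blast
  hence cont: "continuous_on {s..b} d"
    using s by (auto intro: continuous_on_subset)
  have clA: "closed A"
    unfolding A_def by (rule continuous_on_closed_Collect_le[OF cont continuous_on_const]) simp
  have bA: "b \<in> A" using db s by (auto simp: A_def)
  have bdd: "bdd_below A" unfolding A_def bdd_below_def by (intro exI[of _ s]) auto
  have tA: "Inf A \<in> A" by (rule closed_contains_Inf[OF _ bdd clA]) (use bA in blast)
  define t where "t = Inf A"
  have t: "t \<in> {s..b}" "d t \<le> 0" using tA by (auto simp: A_def t_def)
  hence st: "s < t" using neg by (cases "s = t") auto
  have pos: "d x > 0" if "x \<in> {s<..<t}" for x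
  proof (rule ccontr)
    assume "\<not> d x > 0"
    hence "x \<in> A" using that t by (auto simp: A_def)
    hence "t \<le> x" unfolding t_def by (rule cInf_lower[OF _ bdd])
    thus False using that by auto
  qed
  have "\<And>x. x \<in> {s..t} \<Longrightarrow> (d has_real_derivative d' x) (at x within {s..t})"
    by (rule has_field_derivative_subset[OF der]) (use s t in auto)
  from mvt_within_Icc[OF st this] obtain x where x: "x \<in> {s<..<t}" "d t - d s = d' x * (t - s)"
    by auto
  have "d' x \<ge> 0" using sg[of x] pos[OF x(1)] x(1) s t by auto
  hence "d' x * (t - s) \<ge> 0" using st by auto
  thus False using x t neg by auto
qed

text \<open>The comparison is applied to \<open>d s - e * (b - s)\<close>, whose derivative
  \<open>d' s + e\<close> is nonnegative wherever \<open>d\<close> is positive.\<close>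

lemma backward_comparison_eps:
  fixes d d' :: "real \<Rightarrow> real"
  assumes der: "\<And>s. s \<in> {a..b} \<Longrightarrow> (d has_real_derivative d' s) (at s within {a..b})"
    and db: "d b \<le> 0" and sg: "\<And>s. s \<in> {a..b} \<Longrightarrow> d s > 0 \<Longrightarrow> d' s \<ge> - e"
    and e: "e \<ge> 0" and s: "s \<in> {a..b}"
  shows "d s \<le> e * (b - s)"
proof -
  have "d s - e * (b - s) \<le> 0"
  proof (rule backward_comparison[where d' = "\<lambda>s. d' s + e" and d="\<lambda>s. d s - e * (b - s)", OF _ _ _ s])
    show "((\<lambda>s. d s - e * (b - s)) has_real_derivative d' s + e) (at s within {a..b})" if "s \<in> {a..b}" for s
      using der[OF that] by (auto intro!: derivative_eq_intros)
    show "d' s + e \<ge> 0" if "s \<in> {a..b}" "d s - e * (b - s) > 0" for s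
    proof -
      have "0 \<le> e * (b - s)" using e that by auto
      hence "d s > 0" using that by linarith
      thus ?thesis using sg[OF that(1)] by auto
    qed
  qed (use db in auto)
  thus ?thesis by auto
qed

text \<open>Slopes lie in \<open>[0, K]\<close>. The lower bound 0 matters: the slopes of
  \<open>K * y - \<phi> y\<close> then also lie in \<open>[0, K]\<close>, whereas a bare Lipschitz
  bound would only give \<open>2 * K\<close> and no contraction on long intervals.\<close>

definition mono_lipschitz :: "real \<Rightarrow> (real \<Rightarrow> real) \<Rightarrow> bool" where
  "mono_lipschitz K \<phi> \<longleftrightarrow> (\<forall>x y. x \<le> y \<longrightarrow> \<phi> x \<le> \<phi> y \<and> \<phi> y - \<phi> x \<le> K * (y - x))"

lemma mono_lipschitz_bound:
  assumes "mono_lipschitz K \<phi>"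
  shows "\<bar>(\<phi> x - K * x) - (\<phi> y - K * y)\<bar> \<le> K * \<bar>x - y\<bar>"
proof -
  consider "x \<le> y" | "y \<le> x" by linarith
  thus ?thesis
  proof cases
    case 1
    hence "\<phi> x \<le> \<phi> y \<and> \<phi> y - \<phi> x \<le> K * (y - x)" using assms by (auto simp: mono_lipschitz_def)
    moreover have "K * \<bar>x - y\<bar> = K * (y - x)" using 1 by (simp add: abs_if)
    ultimately show ?thesis by (simp add: algebra_simps)
  next
    case 2
    hence "\<phi> y \<le> \<phi> x \<and> \<phi> x - \<phi> y \<le> K * (x - y)" using assms by (auto simp: mono_lipschitz_def)
    moreover have "K * \<bar>x - y\<bar> = K * (x - y)" using 2 by (simp add: abs_if)
    ultimately show ?thesis by (simp add: algebra_simps)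
  qed
qed

lemma mono_lipschitz_continuous:
  assumes "mono_lipschitz K \<phi>" "K > 0" shows "continuous_on A \<phi>"
proof -
  have "K-lipschitz_on UNIV \<phi>"
  proof (rule lipschitz_onI)
    show "dist (\<phi> x) (\<phi> y) \<le> K * dist x y" for x y
    proof (cases "x \<le> y")
      case True
      hence "\<phi> x \<le> \<phi> y \<and> \<phi> y - \<phi> x \<le> K * (y - x)" using assms by (auto simp: mono_lipschitz_def)
      moreover have "dist x y = y - x" using True by (simp add: dist_real_def)
      ultimately show ?thesis by (simp add: dist_real_def abs_if)
    next
      case False
      hence "\<phi> y \<le> \<phi> x \<and> \<phi> x - \<phi> y \<le> K * (x - y)" using assms by (auto simp: mono_lipschitz_def)
      moreover have "dist x y = x - y" using False by (simp add: dist_real_def)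
      ultimately show ?thesis by (simp add: dist_real_def abs_if)
    qed
  qed (use assms in auto)
  thus ?thesis using lipschitz_on_continuous_on continuous_on_subset by blast
qed

text \<open>The integrating factor \<^term>\<open>exp (- K * r)\<close> turns the equation into a fixed point problem that is
  a contraction on the whole interval, with constant \<^term>\<open>1 - exp (- K * (b - a))\<close>, because
  \<^term>\<open>\<lambda>y. K * y - \<phi> y\<close> is \<^term>\<open>K\<close>-Lipschitz.\<close>
lemma backward_ivp_lipschitz:
  fixes H \<phi> :: "real \<Rightarrow> real"
  assumes ab: "a \<le> b" and K: "K > 0" and L: "mono_lipschitz K \<phi>" and H: "continuous_on {a..b} H"
  shows "\<exists>y. y b = 0 \<and> (\<forall>s\<in>{a..b}. (y has_real_derivative H s + \<phi> (y s)) (at s within {a..b}))"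
proof -
  define k where "k Y r = exp (- K * r) * (H r + (\<phi> (Y r) - K * Y r))" for Y :: "real \<Rightarrow> real" and r
  define R where "R Y s = exp (K * s) * (integral {a..s} (k Y) - integral {a..b} (k Y))" for Y s
  have kc: "continuous_on {a..b} (k Y)" if "continuous_on {a..b} Y" for Y
  proof -
    have "continuous_on {a..b} (\<lambda>r. \<phi> (Y r))"
      by (rule continuous_on_compose2[OF mono_lipschitz_continuous[OF L K, of UNIV] that]) auto
    thus ?thesis unfolding k_def by (intro continuous_intros H that)
  qed
  have ki: "k Y integrable_on {c..d}" if "continuous_on {a..b} Y" "a \<le> c" "d \<le> b" for Y c d
    using continuous_on_subset[OF kc[OF that(1)], of "{c..d}"] that
    by (intro integrable_continuous_real) auto
  have Rc: "continuous_on {a..b} (R Y)" if "continuous_on {a..b} Y" for Y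
    unfolding R_def
    by (intro continuous_intros indefinite_integral_continuous_1 ki that) auto
  have Rdiff: "\<bar>R Y s - R Z s\<bar> \<le> (1 - exp (- K * (b - a))) * d"
    if Y: "continuous_on {a..b} Y" and Z: "continuous_on {a..b} Z" and s: "s \<in> {a..b}"
      and d: "\<And>r. r \<in> {a..b} \<Longrightarrow> \<bar>Y r - Z r\<bar> \<le> d" for Y Z s d
  proof -
    have d0: "d \<ge> 0" using d[of a] ab by auto
    have c: "integral {a..b} (k X) = integral {a..s} (k X) + integral {s..b} (k X)"
      if "continuous_on {a..b} X" for X
      using Henstock_Kurzweil_Integration.integral_combine[of a s b "k X"] s ki[OF that] by auto
    have "((\<lambda>r. K * exp (- K * r) * d) has_integral (- exp (- K * b) * d - (- exp (- K * s) * d))) {s..b}"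
      using s by (intro fundamental_theorem_of_calculus)
        (auto intro!: derivative_eq_intros simp: has_real_derivative_iff_has_vector_derivative[symmetric])
    note hi = this
    have bd: "\<bar>k Y r - k Z r\<bar> \<le> K * exp (- K * r) * d" if "r \<in> {s..b}" for r
    proof -
      have "k Y r - k Z r = exp (- K * r) * ((\<phi> (Y r) - K * Y r) - (\<phi> (Z r) - K * Z r))"
        by (simp add: k_def algebra_simps)
      hence "\<bar>k Y r - k Z r\<bar> \<le> exp (- K * r) * (K * \<bar>Y r - Z r\<bar>)"
        using mono_lipschitz_bound[OF L, of "Y r" "Z r"] by (simp add: abs_mult)
      also have "\<dots> \<le> exp (- K * r) * (K * d)" using d[of r] that s K by auto
      finally show ?thesis by (simp add: algebra_simps)
    qed
    have "\<bar>integral {s..b} (\<lambda>r. k Y r - k Z r)\<bar> \<le> integral {s..b} (\<lambda>r. K * exp (- K * r) * d)"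
      using integral_norm_bound_integral[of "\<lambda>r. k Y r - k Z r" "{s..b}" "\<lambda>r. K * exp (- K * r) * d"]
        bd hi s ki[OF Y, of s b] ki[OF Z, of s b]
      by (auto intro: Henstock_Kurzweil_Integration.integrable_diff has_integral_integrable)
    also have "\<dots> = d * (exp (- K * s) - exp (- K * b))"
      by (subst integral_unique[OF hi]) (simp add: algebra_simps)
    finally have I: "\<bar>integral {s..b} (\<lambda>r. k Y r - k Z r)\<bar> \<le> d * (exp (- K * s) - exp (- K * b))" .
    have "R Y s - R Z s = - exp (K * s) * integral {s..b} (\<lambda>r. k Y r - k Z r)"
      using s ki[OF Y, of s b] ki[OF Z, of s b]
      by (simp add: R_def c[OF Y] c[OF Z] Henstock_Kurzweil_Integration.integral_diff algebra_simps)
    hence "\<bar>R Y s - R Z s\<bar> \<le> exp (K * s) * (d * (exp (- K * s) - exp (- K * b)))"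
      using I by (simp add: abs_mult)
    also have "\<dots> = d * (exp (K * s) * exp (- K * s) - exp (K * s) * exp (- K * b))"
      by (simp only: right_diff_distrib mult.left_commute)
    also have "\<dots> = d * (1 - exp (- K * (b - s)))"
      by (simp add: mult_exp_exp right_diff_distrib)
    also have "\<dots> \<le> d * (1 - exp (- K * (b - a)))"
      using d0 s K by (intro mult_left_mono) auto
    finally show ?thesis by (simp add: algebra_simps)
  qed
  \<comment> \<open>The complete space at hand consists of bounded continuous functions on the whole
    line, so functions on \<open>{a..b}\<close> are extended by clamping the argument.\<close>
  define cl where "cl s = max a (min b s)" for s :: real
  have cl: "cl s \<in> {a..b}" "s \<in> {a..b} \<Longrightarrow> cl s = s" for s using ab by (auto simp: cl_def)
  have clc: "continuous_on UNIV cl" unfolding cl_def by (intro continuous_intros)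
  define T where "T Y = Bcontfun (\<lambda>s. R (apply_bcontfun Y) (cl s))" for Y
  have Yc: "continuous_on {a..b} (apply_bcontfun Y)" for Y :: "real \<Rightarrow>\<^sub>C real"
    using continuous_on_apply_bcontfun continuous_on_subset by blast
  have TR: "apply_bcontfun (T Y) s = R (apply_bcontfun Y) (cl s)" for Y s
  proof -
    have c: "continuous_on UNIV (\<lambda>s. R (apply_bcontfun Y) (cl s))"
      by (rule continuous_on_compose2[OF Rc[OF Yc] clc]) (use cl in auto)
    have "bounded ((R (apply_bcontfun Y)) ` {a..b})"
      by (intro compact_imp_bounded compact_continuous_image Rc Yc) auto
    hence "bounded (range (\<lambda>s. R (apply_bcontfun Y) (cl s)))"
      by (rule bounded_subset) (use cl in auto)
    thus ?thesis unfolding T_def using c by (subst Bcontfun_inverse) (auto simp: bcontfun_def)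
  qed
  have "\<exists>!Y. T Y = Y"
  proof (rule banach_fix_type[where c="1 - exp (- K * (b - a))"])
    show "0 \<le> 1 - exp (- K * (b - a))" using K ab by auto
    show "1 - exp (- K * (b - a)) < 1" by auto
    show "\<forall>Y Z. dist (T Y) (T Z) \<le> (1 - exp (- K * (b - a))) * dist Y Z"
    proof (intro allI dist_bound)
      fix Y Z :: "real \<Rightarrow>\<^sub>C real" and x
      show "dist (apply_bcontfun (T Y) x) (apply_bcontfun (T Z) x) \<le> (1 - exp (- K * (b - a))) * dist Y Z"
        unfolding TR dist_real_def
        by (rule Rdiff[OF Yc Yc cl(1)]) (metis dist_bounded dist_real_def)
    qed
  qed
  then obtain Y where "T Y = Y" by auto
  define y where "y = R (apply_bcontfun Y)"
  have Yy: "apply_bcontfun Y s = y s" if "s \<in> {a..b}" for s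
    using TR[of Y s] that cl by (simp add: \<open>T Y = Y\<close> y_def)
  have "(y has_real_derivative H s + \<phi> (y s)) (at s within {a..b})" if s: "s \<in> {a..b}" for s
  proof -
    have "((\<lambda>s. integral {a..s} (k Y)) has_real_derivative k Y s) (at s within {a..b})"
      by (rule integral_has_real_derivative[OF kc[OF Yc] s])
    hence "(y has_real_derivative exp (K * s) * k Y s + K * exp (K * s) * (integral {a..s} (k Y) - integral {a..b} (k Y)))
      (at s within {a..b})"
      unfolding y_def R_def by (auto intro!: derivative_eq_intros)
    moreover have "exp (K * s) * k Y s + K * exp (K * s) * (integral {a..s} (k Y) - integral {a..b} (k Y))
       = exp (K * s) * k Y s + K * y s" by (simp add: y_def R_def)
    moreover have "exp (K * s) * k Y s = H s + (\<phi> (y s) - K * y s)"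
      using Yy[OF s] by (simp add: k_def exp_minus)
    ultimately have "(y has_real_derivative (H s + (\<phi> (y s) - K * y s)) + K * y s) (at s within {a..b})"
      by (simp only:)
    thus ?thesis by simp
  qed
  moreover have "y b = 0" by (simp add: y_def R_def)
  ultimately show ?thesis by blast
qed

text \<open>Meant for powers with exponent below 1, whose slope at 0 is infinite. Monotonicity makes
  two approximate solutions differ by at most the sum of their errors times \<open>b - a\<close>,
  independently of the constants \<open>K\<close>, which may blow up. So the solutions, and with
  them their derivatives, converge uniformly.\<close>

lemma backward_ivp_uniform_limit:
  fixes H \<phi> :: "real \<Rightarrow> real"
  assumes ab: "a \<le> b" and H: "continuous_on {a..b} H" and uc: "uniformly_continuous_on UNIV \<phi>"
    and approx: "\<And>e. e > 0 \<Longrightarrow> \<exists>K \<psi>. K > 0 \<and> mono_lipschitz K \<psi> \<and> (\<forall>y. \<bar>\<psi> y - \<phi> y\<bar> \<le> e)"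
  shows "\<exists>y. y b = 0 \<and> (\<forall>s\<in>{a..b}. (y has_real_derivative H s + \<phi> (y s)) (at s within {a..b}))"
proof -
  have "\<forall>n. \<exists>K \<psi>. K > 0 \<and> mono_lipschitz K \<psi> \<and> (\<forall>y. \<bar>\<psi> y - \<phi> y\<bar> \<le> inverse (real (Suc n)))"
    using approx by simp
  then obtain K \<psi> where K: "\<And>n. K n > 0" and L: "\<And>n. mono_lipschitz (K n) (\<psi> n)"
    and A: "\<And>n y. \<bar>\<psi> n y - \<phi> y\<bar> \<le> inverse (real (Suc n))" by metis
  have "\<forall>n. \<exists>y. y b = 0 \<and> (\<forall>s\<in>{a..b}. (y has_real_derivative H s + \<psi> n (y s)) (at s within {a..b}))"
    using backward_ivp_lipschitz[OF ab K L H] by blast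
  then obtain y where yb: "\<And>n. y n b = 0"
    and yd: "\<And>n s. s \<in> {a..b} \<Longrightarrow> (y n has_real_derivative H s + \<psi> n (y n s)) (at s within {a..b})" by metis
  have mono: "\<psi> n x \<le> \<psi> n z" if "x \<le> z" for n x z using L[of n] that by (auto simp: mono_lipschitz_def)
  have cmp: "y n s - y m s \<le> (inverse (real (Suc n)) + inverse (real (Suc m))) * (b - a)" if s: "s \<in> {a..b}" for n m s
  proof -
    have "y n s - y m s \<le> (inverse (real (Suc n)) + inverse (real (Suc m))) * (b - s)"
    proof (rule backward_comparison_eps[where d'="\<lambda>s. (H s + \<psi> n (y n s)) - (H s + \<psi> m (y m s))", OF _ _ _ _ s])
      show "((\<lambda>s. y n s - y m s) has_real_derivative (H s + \<psi> n (y n s)) - (H s + \<psi> m (y m s))) (at s within {a..b})"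
        if "s \<in> {a..b}" for s using yd[OF that] by (intro DERIV_diff) auto
      show "- (inverse (real (Suc n)) + inverse (real (Suc m))) \<le> (H s + \<psi> n (y n s)) - (H s + \<psi> m (y m s))"
        if "y n s - y m s > 0" for s
        using A[of n "y m s"] A[of m "y m s"] mono[of "y m s" "y n s" n] that by linarith
    qed (use yb in auto)
    also have "\<dots> \<le> (inverse (real (Suc n)) + inverse (real (Suc m))) * (b - a)"
      using s by (intro mult_left_mono) auto
    finally show ?thesis .
  qed
  have inv0: "(\<lambda>n. inverse (real (Suc n))) \<longlonglongrightarrow> 0" by (rule LIMSEQ_inverse_real_of_nat)
  have conv: "uniformly_convergent_on {a..b} y"
  proof (rule Cauchy_uniformly_convergent, unfold uniformly_Cauchy_on_def, intro allI impI)
    fix e :: real assume e: "e > 0"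
    have "(\<lambda>n. 2 * inverse (real (Suc n)) * (b - a)) \<longlonglongrightarrow> 2 * 0 * (b - a)"
      by (intro tendsto_intros inv0)
    hence "\<forall>\<^sub>F n in sequentially. 2 * inverse (real (Suc n)) * (b - a) < e"
      using e by (auto dest: order_tendstoD)
    then obtain M where M: "\<And>n. n \<ge> M \<Longrightarrow> 2 * inverse (real (Suc n)) * (b - a) < e"
      by (auto simp: eventually_sequentially)
    have "dist (y m s) (y n s) < e" if s: "s \<in> {a..b}" and mn: "m \<ge> M" "n \<ge> M" for s m n
    proof -
      have "(inverse (real (Suc n)) + inverse (real (Suc m))) * (b - a)
        = (2 * inverse (real (Suc n)) * (b - a) + 2 * inverse (real (Suc m)) * (b - a)) / 2"
        by argo
      also have "\<dots> < (e + e) / 2"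
        using M[OF mn(1)] M[OF mn(2)] by (intro divide_strict_right_mono add_strict_mono) auto
      finally have "(inverse (real (Suc n)) + inverse (real (Suc m))) * (b - a) < e" by simp
      thus ?thesis using cmp[OF s, of n m] cmp[OF s, of m n] unfolding dist_real_def by argo
    qed
    thus "\<exists>M. \<forall>x\<in>{a..b}. \<forall>m\<ge>M. \<forall>n\<ge>M. dist (y m x) (y n x) < e" by blast
  qed
  then obtain z where z: "uniform_limit {a..b} y z sequentially" by (auto simp: uniformly_convergent_on_def)
  have ylim: "(\<lambda>n. y n b) \<longlonglongrightarrow> 0" by (simp add: yb)
  have bmem: "b \<in> {a..b}" using ab by simp
  have "\<exists>g. \<forall>x\<in>{a..b}. (\<lambda>n. y n x) \<longlonglongrightarrow> g x \<and> (g has_derivative (\<lambda>h. (H x + \<phi> (z x)) * h)) (at x within {a..b})"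
  proof (rule has_derivative_sequence[where f=y and f'="\<lambda>n s h. (H s + \<psi> n (y n s)) * h", OF convex_real_interval(5) _ _ bmem ylim])
    show "\<And>n x. x \<in> {a..b} \<Longrightarrow> (y n has_derivative (*) (H x + \<psi> n (y n x))) (at x within {a..b})"
      using yd by (auto simp: has_field_derivative_def)
    fix e :: real assume e: "e > 0"
    then obtain d where d: "d > 0" "\<And>x x'. dist x' x < d \<Longrightarrow> dist (\<phi> x') (\<phi> x) < e/2"
      using uc half_gt_zero[OF e] unfolding uniformly_continuous_on_def by (metis UNIV_I)
    have "\<forall>\<^sub>F n in sequentially. \<forall>x\<in>{a..b}. dist (y n x) (z x) < d" by (rule uniform_limitD[OF z d(1)])
    moreover have "\<forall>\<^sub>F n in sequentially. inverse (real (Suc n)) < e/2" by (rule order_tendstoD(2)[OF inv0 half_gt_zero[OF e]])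
    ultimately show "\<forall>\<^sub>F n in sequentially. \<forall>x\<in>{a..b}. \<forall>h. norm ((H x + \<psi> n (y n x)) * h - (H x + \<phi> (z x)) * h) \<le> e * norm h"
    proof eventually_elim
      case (elim n)
      have "\<bar>\<psi> n (y n x) - \<phi> (z x)\<bar> \<le> e" if "x \<in> {a..b}" for x
        using A[of n "y n x"] d(2)[of "y n x" "z x"] bspec[OF elim(1) that] elim(2) unfolding dist_real_def by linarith
      moreover have "(H x + \<psi> n (y n x)) * h - (H x + \<phi> (z x)) * h = (\<psi> n (y n x) - \<phi> (z x)) * h" for x h
        by (simp add: algebra_simps)
      ultimately show ?case by (simp add: abs_mult mult_right_mono)
    qed
  qed
  then obtain g where g: "\<And>x. x \<in> {a..b} \<Longrightarrow> (\<lambda>n. y n x) \<longlonglongrightarrow> g x"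
    "\<And>x. x \<in> {a..b} \<Longrightarrow> (g has_real_derivative (H x + \<phi> (z x))) (at x within {a..b})"
    unfolding has_field_derivative_def by blast
  have gz: "g x = z x" if "x \<in> {a..b}" for x
    using LIMSEQ_unique[OF g(1)[OF that] tendsto_uniform_limitI[OF z that]] .
  have "g b = 0" using LIMSEQ_unique[OF g(1)[of b]] ab by (simp add: yb LIMSEQ_const_iff)
  thus ?thesis using g(2) gz by (intro exI[of _ g]) auto
qed

section \<open>The phase-plane equation\<close>

definition ppow :: "real \<Rightarrow> real \<Rightarrow> real" where "ppow q y = max 0 y powr q"

lemma ppow_nonneg [simp]: "ppow q y \<ge> 0" by (simp add: ppow_def)
lemma ppow_nonpos [simp]: "y \<le> 0 \<Longrightarrow> ppow q y = 0" by (simp add: ppow_def max_def)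
lemma ppow_pos_eq: "y \<ge> 0 \<Longrightarrow> ppow q y = y powr q" by (simp add: ppow_def max_def)
lemma ppow_mono: "q > 0 \<Longrightarrow> x \<le> y \<Longrightarrow> ppow q x \<le> ppow q y"
  unfolding ppow_def by (rule powr_mono2) auto
lemma continuous_on_ppow [continuous_intros]:
  "q > 0 \<Longrightarrow> continuous_on A f \<Longrightarrow> continuous_on A (\<lambda>x. ppow q (f x))"
  unfolding ppow_def by (intro continuous_on_powr' continuous_intros) auto

text \<open>The truncation in \<^const>\<open>ppow\<close> extends the phase-plane equation past the zeros of \<^term>\<open>y\<close>, with a
  right-hand side that is still nondecreasing in \<^term>\<open>y\<close>.\<close>
definition shoots :: "(real \<Rightarrow> real) \<Rightarrow> real \<Rightarrow> real \<Rightarrow> real \<Rightarrow> (real \<Rightarrow> real) \<Rightarrow> bool" where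
  "shoots g \<beta> q a y \<longleftrightarrow> y 1 = 0 \<and>
     (\<forall>s\<in>{a..1}. (y has_real_derivative 2 * g s + 2 * \<beta> * ppow q (y s)) (at s within {a..1}))"

lemma shoots_deriv:
  "shoots g \<beta> q a y \<Longrightarrow> s \<in> {a..1} \<Longrightarrow>
    (y has_real_derivative 2 * g s + 2 * \<beta> * ppow q (y s)) (at s within {a..1})"
  by (auto simp: shoots_def)

lemma shoots_end: "shoots g \<beta> q a y \<Longrightarrow> y 1 = 0"
  by (auto simp: shoots_def)

lemma shoots_continuous: "shoots g \<beta> q a y \<Longrightarrow> continuous_on {a..1} y"
  by (rule has_real_derivative_continuous_on, rule shoots_deriv)

lemma shoots_restrict:
  assumes "shoots g \<beta> q a y" "a \<le> b" shows "shoots g \<beta> q b y"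
proof -
  have "(y has_real_derivative 2 * g s + 2 * \<beta> * ppow q (y s)) (at s within {b..1})" if "s \<in> {b..1}" for s
    by (rule has_field_derivative_subset[OF shoots_deriv[OF assms(1)]]) (use that assms in auto)
  thus ?thesis using assms by (simp add: shoots_def)
qed

lemma shoots_deriv_within:
  assumes "shoots g \<beta> q a y" "a \<le> b" "c \<le> 1" "s \<in> {b..c}"
  shows "(y has_real_derivative 2 * g s + 2 * \<beta> * ppow q (y s)) (at s within {b..c})"
  by (rule has_field_derivative_subset[OF shoots_deriv[OF assms(1)]]) (use assms in auto)

lemma shoots_deriv_at:
  assumes "shoots g \<beta> q a y" "a < s" "s < 1"
  shows "(y has_real_derivative 2 * g s + 2 * \<beta> * ppow q (y s)) (at s)"
  using shoots_deriv[OF assms(1), of s] assms at_within_Icc_at[of a s 1] by auto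

text \<open>Where \<open>y > z\<close>, monotonicity of \<open>ppow\<close> makes
  \<open>y - z\<close> nondecreasing, so no excess can appear to the left of \<open>b\<close>.
  Constants, cubes and shifted multiples of other solutions serve as barriers
  \<open>z\<close>.\<close>

lemma shoots_le_supersolution:
  assumes y: "shoots g \<beta> q a y" and \<beta>: "\<beta> \<ge> 0" and q: "q > 0" and b: "b \<le> 1"
    and z: "\<And>s. s \<in> {a..b} \<Longrightarrow> (z has_real_derivative z' s) (at s within {a..b})"
    and super: "\<And>s. s \<in> {a..b} \<Longrightarrow> z s < y s \<Longrightarrow> z' s \<le> 2 * g s + 2 * \<beta> * ppow q (z s)"
    and yb: "y b \<le> z b" and s: "s \<in> {a..b}"
  shows "y s \<le> z s"
proof -
  have "y s - z s \<le> 0"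
  proof (rule backward_comparison[where d'="\<lambda>s. (2 * g s + 2 * \<beta> * ppow q (y s)) - z' s", OF _ _ _ s])
    show "((\<lambda>s. y s - z s) has_real_derivative (2 * g s + 2 * \<beta> * ppow q (y s)) - z' s) (at s within {a..b})"
      if "s \<in> {a..b}" for s
      using shoots_deriv_within[OF y order.refl b that] z[OF that] by (intro DERIV_diff)
    show "0 \<le> (2 * g s + 2 * \<beta> * ppow q (y s)) - z' s" if "s \<in> {a..b}" "y s - z s > 0" for s
    proof -
      have "\<beta> * ppow q (z s) \<le> \<beta> * ppow q (y s)"
        using that \<beta> q by (intro mult_left_mono ppow_mono) auto
      thus ?thesis using super[OF that(1)] that(2) by auto
    qed
  qed (use yb in auto)
  thus ?thesis by auto
qed

text \<open>Both right-hand sides are compared along \<open>y2\<close> only: \<open>h\<close> says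
  that \<open>y2\<close> is, up to \<open>e\<close>, a supersolution of the problem for
  \<open>y1\<close>. With \<open>e = 0\<close> this yields uniqueness and monotonicity in
  \<open>g\<close> and \<open>\<beta>\<close>; with small \<open>e\<close>, stability.\<close>

lemma shoots_perturb:
  assumes y1: "shoots g1 \<beta>1 q a y1" and y2: "shoots g2 \<beta>2 q a y2"
    and \<beta>: "\<beta>1 \<ge> 0" and q: "q > 0" and e: "e \<ge> 0"
    and h: "\<And>s. s \<in> {a..1} \<Longrightarrow> g2 s + \<beta>2 * ppow q (y2 s) - e \<le> g1 s + \<beta>1 * ppow q (y2 s)"
    and s: "s \<in> {a..1}"
  shows "y1 s \<le> y2 s + 2 * e * (1 - s)"
proof -
  have "y1 s - y2 s \<le> (2 * e) * (1 - s)"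
  proof (rule backward_comparison_eps[OF _ _ _ _ s,
        where d'="\<lambda>s. (2 * g1 s + 2 * \<beta>1 * ppow q (y1 s)) - (2 * g2 s + 2 * \<beta>2 * ppow q (y2 s))"])
    show "((\<lambda>s. y1 s - y2 s) has_real_derivative (2 * g1 s + 2 * \<beta>1 * ppow q (y1 s)) - (2 * g2 s + 2 * \<beta>2 * ppow q (y2 s)))
      (at s within {a..1})" if "s \<in> {a..1}" for s
      using shoots_deriv[OF y1 that] shoots_deriv[OF y2 that] by (intro DERIV_diff)
    show "- (2 * e) \<le> (2 * g1 s + 2 * \<beta>1 * ppow q (y1 s)) - (2 * g2 s + 2 * \<beta>2 * ppow q (y2 s))"
      if "s \<in> {a..1}" "y1 s - y2 s > 0" for s
    proof -
      have "\<beta>1 * ppow q (y2 s) \<le> \<beta>1 * ppow q (y1 s)"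
        using that \<beta> q by (intro mult_left_mono ppow_mono) auto
      thus ?thesis using h[OF that(1)] by (simp add: algebra_simps)
    qed
  qed (use e shoots_end[OF y1] shoots_end[OF y2] in auto)
  thus ?thesis by auto
qed

lemma shoots_unique:
  assumes "shoots g \<beta> q a y1" "shoots g \<beta> q a y2" "\<beta> \<ge> 0" "q > 0" "s \<in> {a..1}"
  shows "y1 s = y2 s"
  using shoots_perturb[OF assms(1,2) assms(3,4) order.refl _ assms(5)]
    shoots_perturb[OF assms(2,1) assms(3,4) order.refl _ assms(5)] by auto

lemma shoots_upper:
  assumes y: "shoots g \<beta> q a y" and \<beta>: "\<beta> \<ge> 0" and k: "k \<ge> 0"
    and g: "\<And>s. s \<in> {a..1} \<Longrightarrow> g s \<ge> - k" and s: "s \<in> {a..1}"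
  shows "y s \<le> 2 * k * (1 - s)"
proof (rule backward_comparison_eps[OF shoots_deriv[OF y] _ _ _ s])
  show "- (2 * k) \<le> 2 * g s + 2 * \<beta> * ppow q (y s)" if "s \<in> {a..1}" for s
    using g[OF that] mult_nonneg_nonneg[OF \<beta> ppow_nonneg[of q "y s"]] by linarith
qed (use k shoots_end[OF y] in auto)

lemma shoots_exists:
  assumes a: "a \<le> 1" and g: "continuous_on {a..1} g" and \<beta>: "\<beta> \<ge> 0" and q: "q > 0"
  shows "\<exists>y. shoots g \<beta> q a y"
proof -
  have "bounded (g ` {a..1})" by (intro compact_imp_bounded compact_continuous_image g) auto
  then obtain k where k: "k > 0" "\<And>s. s \<in> {a..1} \<Longrightarrow> \<bar>g s\<bar> \<le> k"
    by (auto simp: bounded_pos)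
  define M where "M = 2 * k * (1 - a) + 1"
  have M: "M \<ge> 1" using a k by (auto simp: M_def)
  \<comment> \<open>The a priori bound \<open>2 * k * (1 - a)\<close> on \<open>y\<close> lies below
    \<open>M\<close>, so cutting the argument of the power at \<open>M\<close> will not affect the
    solution; negative arguments are cut at 0 as in \<open>ppow\<close>.\<close>
  define c where "c y = min (max 0 y) M" for y :: real
  have c: "c y \<in> {0..M}" "x \<le> y \<Longrightarrow> c x \<le> c y \<and> c y - c x \<le> y - x" for x y using M by (auto simp: c_def)
  have c1: "c y \<in> {0..M+1}" for y using c(1)[of y] by auto
  define \<phi> where "\<phi> y = 2 * \<beta> * c y powr q" for y
  have ucq: "uniformly_continuous_on {0..M+1} (\<lambda>x. 2 * \<beta> * x powr q)"
    using q by (intro compact_uniformly_continuous continuous_intros continuous_on_powr') auto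
  have cdist: "dist (c x) (c y) \<le> dist x y" for x y by (auto simp: c_def dist_real_def)
  have uc: "uniformly_continuous_on UNIV \<phi>"
    unfolding uniformly_continuous_on_def
  proof (intro allI impI)
    fix e :: real assume "e > 0"
    then obtain d where "d > 0" "\<And>x x'. x \<in> {0..M+1} \<Longrightarrow> x' \<in> {0..M+1} \<Longrightarrow> dist x' x < d \<Longrightarrow> dist (2 * \<beta> * x' powr q) (2 * \<beta> * x powr q) < e"
      using ucq unfolding uniformly_continuous_on_def by metis
    thus "\<exists>d>0. \<forall>x\<in>UNIV. \<forall>x'\<in>UNIV. dist x' x < d \<longrightarrow> dist (\<phi> x') (\<phi> x) < e"
      using c1 le_less_trans[OF cdist] unfolding \<phi>_def by (intro exI[of _ d]) blast
  qed
  have approx: "\<exists>K \<psi>. K > 0 \<and> mono_lipschitz K \<psi> \<and> (\<forall>y. \<bar>\<psi> y - \<phi> y\<bar> \<le> e)" if e: "e > 0" for e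
  proof -
    obtain d where d: "d > 0" "\<And>x x'. x \<in> {0..M+1} \<Longrightarrow> x' \<in> {0..M+1} \<Longrightarrow> dist x' x < d \<Longrightarrow> dist (2 * \<beta> * x' powr q) (2 * \<beta> * x powr q) < e"
      using ucq e unfolding uniformly_continuous_on_def by metis
    define h where "h = min (d/2) 1"
    have h: "0 < h" "h < d" "h \<le> 1" using d(1) by (auto simp: h_def)
    \<comment> \<open>Derivative bound for the power on \<open>[h, M + h]\<close>:
      \<open>x powr (q - 1)\<close> is decreasing for \<open>q < 1\<close> and nondecreasing
      otherwise, so the sum of its two end values dominates in both cases. The shift by
      \<open>h\<close> is what makes the slope finite.\<close>
    define K0 where "K0 = q * (h powr (q-1) + (M+h) powr (q-1))"
    have K0: "K0 \<ge> 0" using q by (auto simp: K0_def)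
    have lip: "(y+h) powr q - (x+h) powr q \<le> K0 * (y - x)" if "0 \<le> x" "x \<le> y" "y \<le> M" for x y
    proof (cases "x = y")
      case False
      hence xy: "x < y" using that by auto
      have "\<exists>z. x < z \<and> z < y \<and> (y+h) powr q - (x+h) powr q = (y - x) * (q * (z+h) powr (q-1))"
        using that h by (intro MVT2[OF xy]) (auto intro!: derivative_eq_intros simp: powr_diff field_simps)
      then obtain z where z: "x < z" "z < y" "(y+h) powr q - (x+h) powr q = (y - x) * (q * (z+h) powr (q-1))" by auto
      have "(z+h) powr (q-1) \<le> h powr (q-1) + (M+h) powr (q-1)"
      proof (cases "q \<ge> 1")
        case True
        hence "(z+h) powr (q-1) \<le> (M+h) powr (q-1)" using z that h by (intro powr_mono2) auto
        thus ?thesis by (smt (verit) powr_ge_zero)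
      next
        case False
        hence "(z+h) powr (q-1) \<le> h powr (q-1)" using z that h by (intro powr_mono2') auto
        thus ?thesis by (smt (verit) powr_ge_zero)
      qed
      hence "q * (z+h) powr (q-1) \<le> K0" using q unfolding K0_def by (intro mult_left_mono) auto
      thus ?thesis unfolding z(3) using xy by (subst mult.commute) (intro mult_right_mono, auto)
    qed auto
    define \<psi> where "\<psi> y = 2 * \<beta> * (c y + h) powr q" for y
    have "mono_lipschitz (2 * \<beta> * K0 + 1) \<psi>"
      unfolding mono_lipschitz_def
    proof (intro allI impI conjI)
      fix x y :: real assume xy: "x \<le> y"
      show "\<psi> x \<le> \<psi> y" unfolding \<psi>_def using \<beta> q h c(2)[OF xy] c(1)[of x]
        by (intro mult_left_mono powr_mono2) auto
      have "(c y + h) powr q - (c x + h) powr q \<le> K0 * (c y - c x)"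
        using c(1)[of x] c(1)[of y] c(2)[OF xy] by (intro lip) auto
      also have "\<dots> \<le> K0 * (y - x)" using K0 c(2)[OF xy] by (intro mult_left_mono) auto
      finally have "2 * \<beta> * ((c y + h) powr q - (c x + h) powr q) \<le> 2 * \<beta> * (K0 * (y - x))"
        using \<beta> by (intro mult_left_mono) auto
      thus "\<psi> y - \<psi> x \<le> (2 * \<beta> * K0 + 1) * (y - x)" using xy by (simp add: \<psi>_def algebra_simps)
    qed
    moreover have "\<bar>\<psi> y - \<phi> y\<bar> \<le> e" for y
      using d(2)[of "c y" "c y + h"] c(1)[of y] h by (auto simp: \<psi>_def \<phi>_def dist_real_def)
    moreover have "2 * \<beta> * K0 + 1 > 0" using \<beta> K0 by (smt (verit) mult_nonneg_nonneg)
    ultimately show ?thesis by blast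
  qed
  have "continuous_on {a..1} (\<lambda>s. 2 * g s)" by (intro continuous_intros g)
  from backward_ivp_uniform_limit[OF a this uc approx]
  obtain y where y: "y 1 = 0" "\<And>s. s \<in> {a..1} \<Longrightarrow> (y has_real_derivative 2 * g s + \<phi> (y s)) (at s within {a..1})"
    by auto
  have "y s \<le> M" if s: "s \<in> {a..1}" for s
  proof -
    have "y s \<le> (2 * k) * (1 - s)"
    proof (rule backward_comparison_eps[OF y(2) _ _ _ s])
      show "- (2 * k) \<le> 2 * g s + \<phi> (y s)" if "s \<in> {a..1}" for s
        using k(2)[OF that] mult_nonneg_nonneg[OF \<beta> powr_ge_zero[of "c (y s)" q]] unfolding \<phi>_def by linarith
    qed (use k y in auto)
    also have "\<dots> \<le> (2 * k) * (1 - a)" using s k by (intro mult_left_mono) auto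
    finally show ?thesis by (auto simp: M_def)
  qed
  hence "\<phi> (y s) = 2 * \<beta> * ppow q (y s)" if "s \<in> {a..1}" for s
    using that M by (fastforce simp: \<phi>_def c_def ppow_def)
  hence "shoots g \<beta> q a y" using y by (auto simp: shoots_def)
  thus ?thesis by blast
qed

text \<open>The choice is harmless, since for \<open>\<beta> \<ge> 0\<close> and
  \<open>q > 0\<close> the solution on \<open>{a..1}\<close> is unique. As solutions restrict to
  shorter intervals, \<open>endval g \<beta> q\<close> as a function of \<open>a\<close> is the
  solution itself.\<close>

definition endval :: "(real \<Rightarrow> real) \<Rightarrow> real \<Rightarrow> real \<Rightarrow> real \<Rightarrow> real" where
  "endval g \<beta> q a = (SOME y. shoots g \<beta> q a y) a"

lemma endval_eq:
  assumes "shoots g \<beta> q b y" "b \<le> a" "a \<le> 1" "\<beta> \<ge> 0" "q > 0"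
  shows "endval g \<beta> q a = y a"
proof -
  have s: "shoots g \<beta> q a y" using assms by (auto intro: shoots_restrict)
  hence "shoots g \<beta> q a (SOME y. shoots g \<beta> q a y)" by (rule someI[where P="shoots g \<beta> q a"])
  from shoots_unique[OF this s] show ?thesis using assms unfolding endval_def by auto
qed

text \<open>The constant \<open>C\<close> is a supersolution once the power term outweighs the
  source. For large \<open>\<beta>\<close> it can be taken small.\<close>

lemma shoots_le_const:
  assumes y: "shoots g \<beta> q a y" and \<beta>: "\<beta> \<ge> 0" and q: "q > 0" and C: "C \<ge> 0"
    and g: "\<And>s. s \<in> {a..1} \<Longrightarrow> g s \<ge> - k" and k: "k \<le> \<beta> * C powr q" and s: "s \<in> {a..1}"
  shows "y s \<le> C"
proof (rule shoots_le_supersolution[OF y \<beta> q order.refl _ _ _ s, where z'="\<lambda>_. 0"])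
  show "0 \<le> 2 * g s + 2 * \<beta> * ppow q C" if "s \<in> {a..1}" for s
    using g[OF that] k C by (simp add: ppow_pos_eq)
qed (use C shoots_end[OF y] in auto)

text \<open>At a minimum point left of 1 with \<open>y \<le> 0\<close> the power term vanishes and
  the slope is \<open>2 * g < 0\<close>, so \<open>y\<close> would drop further to the
  right.\<close>

lemma shoots_pos:
  assumes y: "shoots g \<beta> q a y" and am: "a \<le> m"
    and neg: "\<And>s. s \<in> {m<..<1} \<Longrightarrow> g s < 0" and s: "s \<in> {m<..<1}"
  shows "y s > 0"
proof (rule ccontr)
  assume "\<not> y s > 0"
  have "continuous_on {s..1} y" using shoots_continuous[OF y] am s by (auto intro: continuous_on_subset)
  then obtain t where t: "t \<in> {s..1}" "\<And>r. r \<in> {s..1} \<Longrightarrow> y t \<le> y r"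
    using continuous_attains_inf[of "{s..1}" y] s by auto
  \<comment> \<open>If the minimum is attained at 1 it equals 0, and then \<open>s\<close>, where
    \<open>y s \<le> 0\<close>, is a minimum point too. So one strictly left of 1 always
    exists.\<close>
  obtain t' where t': "t' \<in> {s..<1}" "\<And>r. r \<in> {s..1} \<Longrightarrow> y t' \<le> y r"
  proof (cases "t = 1")
    case True
    hence "y s = y t" using t(2)[of s] s shoots_end[OF y] \<open>\<not> y s > 0\<close> by auto
    thus ?thesis using that[of s] s t(2) by auto
  next
    case False
    thus ?thesis using that[of t] t by auto
  qed
  have "y t' \<le> 0" using t'(2)[of s] s \<open>\<not> y s > 0\<close> by auto
  hence "2 * g t' + 2 * \<beta> * ppow q (y t') < 0" using neg[of t'] t' s by auto
  moreover have "(y has_real_derivative 2 * g t' + 2 * \<beta> * ppow q (y t')) (at t')"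
    using shoots_deriv_at[OF y] t' am s by auto
  ultimately obtain d where d: "d > 0" "\<And>h. h > 0 \<Longrightarrow> h < d \<Longrightarrow> y t' > y (t' + h)"
    using DERIV_neg_dec_right by blast
  define h where "h = min (d/2) (1 - t')"
  have "y t' > y (t' + h)" by (rule d(2)) (use d(1) t' in \<open>auto simp: h_def\<close>)
  moreover have "y t' \<le> y (t' + h)" by (rule t'(2)) (use d(1) t' in \<open>auto simp: h_def\<close>)
  ultimately show False by auto
qed

lemma shoots_strict_increase:
  assumes y: "shoots g \<beta> q a y" and \<beta>: "\<beta> \<ge> 0" and b: "a \<le> b" "b < c" "c \<le> 1"
    and pos: "\<And>s. s \<in> {b<..<c} \<Longrightarrow> g s > 0"
  shows "y b < y c"
proof -
  obtain x where x: "x \<in> {b<..<c}" "y c - y b = (2 * g x + 2 * \<beta> * ppow q (y x)) * (c - b)"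
    using mvt_within_Icc[OF b(2) shoots_deriv_within[OF y b(1) b(3)]] by auto
  have "2 * g x + 2 * \<beta> * ppow q (y x) > 0" using pos[OF x(1)] mult_nonneg_nonneg[OF \<beta> ppow_nonneg[of q "y x"]] by linarith
  thus ?thesis using x(2) b by (smt (verit) zero_less_mult_iff)
qed

lemma shoots_neg:
  assumes y: "shoots g \<beta> q a y" and \<beta>: "\<beta> \<ge> 0" and m: "a \<le> m" "m \<le> 1"
    and pos: "\<And>s. s \<in> {a<..<m} \<Longrightarrow> g s > 0" and neg: "\<And>s. s \<in> {m<..<1} \<Longrightarrow> g s < 0"
    and t: "a < t" "t \<le> 1" "t < 1 \<or> m = 1" "y t \<le> 0"
  shows "y a < 0"
proof -
  have "t \<le> m" using shoots_pos[OF y m(1) neg, of t] t by force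
  have "y a < y t" by (rule shoots_strict_increase[OF y \<beta> order.refl t(1,2)]) (use pos \<open>t \<le> m\<close> in auto)
  thus ?thesis using t by auto
qed

section \<open>Concave-convex fluxes normalized at the left state one\<close>

definition chord :: "(real \<Rightarrow> real) \<Rightarrow> real \<Rightarrow> real" where
  "chord F v = (F v - F 1) / (v - 1)"

definition gap :: "(real \<Rightarrow> real) \<Rightarrow> real \<Rightarrow> real \<Rightarrow> real" where
  "gap F v s = F s - F 1 - chord F v * (s - 1)"

lemma gap_endpoints [simp]: "gap F v 1 = 0" "v \<noteq> 1 \<Longrightarrow> gap F v v = 0"
  by (simp_all add: gap_def chord_def)

lemma gap_diff_le:
  assumes "\<bar>F s - G s\<bar> \<le> e" "\<bar>F 1 - G 1\<bar> \<le> e" "\<bar>chord F v - chord G w\<bar> \<le> d" "a \<le> s" "s \<le> 1"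
  shows "\<bar>gap F v s - gap G w s\<bar> \<le> 2 * e + d * (1 - a)"
proof -
  have "\<bar>(chord F v - chord G w) * (1 - s)\<bar> \<le> d * (1 - a)"
    using assms by (auto simp: abs_mult intro!: mult_mono)
  moreover have "gap F v s - gap G w s = (F s - G s) - (F 1 - G 1) + (chord F v - chord G w) * (1 - s)"
    by (simp add: gap_def algebra_simps)
  ultimately show ?thesis using assms(1,2) by linarith
qed

locale flux =
  fixes F F1 F2 :: "real \<Rightarrow> real"
  assumes dF: "(F has_real_derivative F1 s) (at s)"
    and dF1: "(F1 has_real_derivative F2 s) (at s)"
    and contF2: "continuous_on UNIV F2"
    and sF2: "s \<noteq> 0 \<Longrightarrow> s * F2 s > 0"
    and F1_top: "filterlim F1 at_top at_top"
    and F1_bot: "filterlim F1 at_top at_bot"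
begin

lemma contF: "continuous_on A F"
  by (rule continuous_at_imp_continuous_on) (use dF DERIV_isCont in fast)

lemma contF1: "continuous_on A F1"
  by (rule continuous_at_imp_continuous_on) (use dF1 DERIV_isCont in fast)

lemma F2_neg: "s < 0 \<Longrightarrow> F2 s < 0" and F2_pos: "s > 0 \<Longrightarrow> F2 s > 0"
  using sF2[of s] by (auto simp: zero_less_mult_iff)

lemma F1_dec: assumes "x < y" "y \<le> 0" shows "F1 y < F1 x"
proof (rule DERIV_neg_imp_decreasing_open[OF assms(1) _ contF1])
  fix s assume "x < s" "s < y"
  thus "\<exists>l. (F1 has_real_derivative l) (at s) \<and> l < 0" using dF1[of s] F2_neg[of s] assms by (intro exI[of _ "F2 s"]) auto
qed

lemma F1_inc: assumes "0 \<le> x" "x < y" shows "F1 x < F1 y"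
proof (rule DERIV_pos_imp_increasing_open[OF assms(2) _ contF1])
  fix s assume "x < s" "s < y"
  thus "\<exists>l. (F1 has_real_derivative l) (at s) \<and> l > 0" using dF1[of s] F2_pos[of s] assms by (intro exI[of _ "F2 s"]) auto
qed

lemma F_mvt: assumes "x < y" shows "\<exists>z>x. z < y \<and> F y - F x = (y - x) * F1 z"
  using MVT2[OF assms, of F F1] dF by blast

lemma F1_ge_far: "\<exists>A. \<forall>s\<le>A. F1 s \<ge> M" "\<exists>A. \<forall>s\<ge>A. F1 s \<ge> M"
  using F1_bot F1_top by (auto simp: filterlim_at_top eventually_at_bot_linorder eventually_at_top_linorder)

text \<open>\<open>F1\<close> decreases on the negative axis, increases on the positive one and is
  coercive, so a level above its minimum is crossed exactly once on each side.\<close>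

lemma F1_level:
  assumes "l > F1 0"
  obtains r1 r2 where "r1 < 0" "r2 > 0" "\<And>s. s < r1 \<Longrightarrow> F1 s > l" "\<And>s. s > r2 \<Longrightarrow> F1 s > l"
    "\<And>s. r1 < s \<Longrightarrow> s < r2 \<Longrightarrow> F1 s < l" "F1 r1 = l" "F1 r2 = l"
proof -
  obtain A where A: "\<And>s. s \<le> A \<Longrightarrow> F1 s \<ge> l" using F1_ge_far(1)[of l] by auto
  define A' where "A' = min A 0"
  have A': "A' \<le> 0" "F1 A' \<ge> l" using A[of A'] by (auto simp: A'_def)
  obtain r1 where r1: "A' \<le> r1" "r1 \<le> 0" "F1 r1 = l"
    using IVT2'[of F1 0 l A'] A' assms contF1 by auto
  obtain B where B: "\<And>s. s \<ge> B \<Longrightarrow> F1 s \<ge> l" using F1_ge_far(2)[of l] by auto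
  define B' where "B' = max B 0"
  have B': "B' \<ge> 0" "F1 B' \<ge> l" using B[of B'] by (auto simp: B'_def)
  obtain r2 where r2: "0 \<le> r2" "r2 \<le> B'" "F1 r2 = l"
    using IVT'[of F1 0 l B'] B' assms contF1 by auto
  have r: "r1 < 0" "r2 > 0" using r1 r2 assms by (auto simp: less_le)
  have mid: "F1 s < l" if "r1 < s" "s < r2" for s
    using F1_dec[of r1 s] F1_inc[of s r2] r1 r2 that by (cases "s \<le> 0") auto
  have lo: "F1 s > l" if "s < r1" for s using F1_dec[of s r1] r1 that by auto
  have hi: "F1 s > l" if "s > r2" for s using F1_inc[of r2 s] r2 that by auto
  show ?thesis by (rule that[of r1 r2]) (use r mid lo hi r1 r2 in auto)
qed

section \<open>The tangent point of the left state 1\<close>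

definition tgt :: "real \<Rightarrow> real" where "tgt v = F1 v * (1 - v) - (F 1 - F v)"

lemma tgt_deriv: "(tgt has_real_derivative F2 v * (1 - v)) (at v)"
  unfolding tgt_def by (auto intro!: derivative_eq_intros dF dF1)

lemma cont_tgt: "continuous_on A tgt"
  by (rule continuous_at_imp_continuous_on) (use tgt_deriv DERIV_isCont in fast)

lemma tgt_1 [simp]: "tgt 1 = 0" by (simp add: tgt_def)

lemma tgt_dec: assumes "x < y" "y \<le> 0 \<or> 1 \<le> x" shows "tgt y < tgt x"
proof (rule DERIV_neg_imp_decreasing_open[OF assms(1) _ cont_tgt])
  fix s assume s: "x < s" "s < y"
  hence "F2 s * (1 - s) < 0" using F2_neg[of s] F2_pos[of s] assms by (auto simp: mult_less_0_iff)
  thus "\<exists>l. (tgt has_real_derivative l) (at s) \<and> l < 0" using tgt_deriv[of s] by (intro exI[of _ "F2 s * (1 - s)"]) auto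
qed

lemma tgt_inc: assumes "0 \<le> x" "x < y" "y \<le> 1" shows "tgt x < tgt y"
proof (rule DERIV_pos_imp_increasing_open[OF assms(2) _ cont_tgt])
  fix s assume s: "x < s" "s < y"
  hence "F2 s * (1 - s) > 0" using F2_pos[of s] assms by auto
  thus "\<exists>l. (tgt has_real_derivative l) (at s) \<and> l > 0" using tgt_deriv[of s] by (intro exI[of _ "F2 s * (1 - s)"]) auto
qed

definition tau :: real where "tau = (THE v. v \<noteq> 1 \<and> F1 v = (F 1 - F v) / (1 - v))"

lemma tgt_zero_iff: "v \<noteq> 1 \<Longrightarrow> F1 v = (F 1 - F v) / (1 - v) \<longleftrightarrow> tgt v = 0"
  by (simp add: tgt_def field_simps)

text \<open>\<open>tgt\<close> is the tangency defect with the denominator cleared. It decreases on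
  the negative axis, increases on \<open>[0, 1]\<close> up to \<open>tgt 1 = 0\<close> and decreases
  afterwards. So its zeros are 1 and exactly one negative point, given that it is positive far to
  the left.\<close>

lemma tau_ex1: "\<exists>!v. v \<noteq> 1 \<and> F1 v = (F 1 - F v) / (1 - v)" (is "\<exists>!v. ?P v")
  and tau_aux: "\<exists>v<0. tgt v = 0"
proof -
  obtain A where A: "\<And>s. s \<le> A \<Longrightarrow> F1 s \<ge> F1 1" using F1_ge_far(1)[of "F1 1"] by auto
  define a where "a = min A (-1)"
  have a: "a < 0" "F1 a \<ge> F1 1" using A[of a] by (auto simp: a_def)
  \<comment> \<open>The slope of the chord from \<open>a\<close> to 1 is \<open>F1 z\<close>. As
    \<open>F1 a\<close> is at least \<open>F1 1\<close> and \<open>F1\<close> first falls and then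
    rises, \<open>F1 a\<close> exceeds \<open>F1\<close> everywhere in between, hence
    \<open>tgt a > 0\<close>.\<close>
  obtain z where z: "a < z" "z < 1" "F 1 - F a = (1 - a) * F1 z" using F_mvt[of a 1] a by auto
  have "F1 z < F1 a" using F1_dec[of a z] F1_inc[of z 1] a z by (cases "z \<le> 0") auto
  hence "(1 - a) * F1 z < (1 - a) * F1 a" using a by (intro mult_strict_left_mono) auto
  hence ta: "tgt a > 0" using z by (simp add: tgt_def algebra_simps)
  have t0: "tgt v < 0" if "0 \<le> v" "v < 1" for v using tgt_inc[of v 1] that by auto
  obtain v where v: "a \<le> v" "v \<le> 0" "tgt v = 0" using IVT2'[of tgt 0 0 a] ta t0[of 0] a cont_tgt by auto
  hence v0: "v < 0" using t0[of 0] by (cases "v = 0") auto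
  thus "\<exists>v<0. tgt v = 0" using v by auto
  show "\<exists>!v. ?P v"
  proof (rule ex1I[of _ v])
    show "?P v" using v v0 tgt_zero_iff by auto
    fix w assume "?P w"
    hence w: "w \<noteq> 1" "tgt w = 0" using tgt_zero_iff by auto
    have "w \<le> 0" using t0[of w] tgt_dec[of 1 w] w by force
    thus "w = v" using tgt_dec[of v w] tgt_dec[of w v] w v by (cases v w rule: linorder_cases) auto
  qed
qed

lemma tau_props: "tau < 0" "tgt tau = 0"
proof -
  obtain v where v: "v < 0" "tgt v = 0" using tau_aux by auto
  hence "tau = v" unfolding tau_def using tau_ex1 tgt_zero_iff[of v] by (intro the1_equality) auto
  thus "tau < 0" "tgt tau = 0" using v by auto
qed

lemma tau_eqI: "v \<noteq> 1 \<Longrightarrow> F1 v * (1 - v) = F 1 - F v \<Longrightarrow> tau = v"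
  unfolding tau_def using tau_ex1 tgt_zero_iff[of v] by (intro the1_equality) (auto simp: tgt_def)

lemma tgt_pos_iff: "v < 1 \<Longrightarrow> tgt v > 0 \<longleftrightarrow> v < tau"
  and tgt_neg: "tau < v \<Longrightarrow> v < 1 \<Longrightarrow> tgt v < 0"
proof -
  show n: "tgt v < 0" if "tau < v" "v < 1" for v
    using tgt_dec[of tau v] tgt_inc[of v 1] tau_props that by (cases "v \<le> 0") auto
  show "v < 1 \<Longrightarrow> tgt v > 0 \<longleftrightarrow> v < tau"
    using tgt_dec[of v tau] n[of v] tau_props by (cases v tau rule: linorder_cases) auto
qed

lemma chord_eq: "v < 1 \<Longrightarrow> F1 v - chord F v = tgt v / (1 - v)"
  by (simp add: chord_def tgt_def field_simps)

lemma chord_deriv: assumes "v < 1" shows "(chord F has_real_derivative - tgt v / (1 - v)^2) (at v)"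
proof -
  have "((\<lambda>v. (F v - F 1) / (v - 1)) has_real_derivative (F1 v * (v - 1) - (F v - F 1) * 1) / ((v - 1) * (v - 1))) (at v)"
    using assms by (auto intro!: derivative_eq_intros dF)
  moreover have "(F1 v * (v - 1) - (F v - F 1) * 1) / ((v - 1) * (v - 1)) = - tgt v / (1 - v)^2"
    by (simp add: tgt_def power2_eq_square algebra_simps)
  ultimately show ?thesis unfolding chord_def[abs_def] by simp
qed

lemma chord_cont: "A \<subseteq> {..<1} \<Longrightarrow> continuous_on A (chord F)"
  by (rule continuous_at_imp_continuous_on) (use chord_deriv DERIV_isCont in fast)

lemma chord_dec: assumes "x < y" "y \<le> tau" shows "chord F y < chord F x"
proof (rule DERIV_neg_imp_decreasing_open[OF assms(1)])
  show "continuous_on {x..y} (chord F)" by (rule chord_cont) (use assms tau_props in auto)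
  fix s assume s: "x < s" "s < y"
  hence "- tgt s / (1 - s)^2 < 0" using tgt_pos_iff[of s] assms tau_props by (auto simp: divide_neg_pos)
  thus "\<exists>l. (chord F has_real_derivative l) (at s) \<and> l < 0"
    using chord_deriv[of s] s assms tau_props by (intro exI[of _ "- tgt s / (1 - s)^2"]) auto
qed

section \<open>Sign pattern of the gap between flux and chord\<close>

lemma gap_deriv: "(gap F v has_real_derivative F1 s - chord F v) (at s)"
  unfolding gap_def[abs_def] by (auto intro!: derivative_eq_intros dF)

lemma gap_cont: "continuous_on A (gap F v)"
  by (rule continuous_at_imp_continuous_on) (use gap_deriv DERIV_isCont in fast)

text \<open>The chord slope is an average of \<open>F1\<close>, hence above its minimum; this makes
  it a level to which \<open>F1_level\<close> applies.\<close>

lemma chord_gt_F1_0: assumes "v < 0" shows "chord F v > F1 0"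
proof -
  obtain x where x: "v < x" "x < 0" "F 0 - F v = (0 - v) * F1 x" using F_mvt[of v 0] assms by auto
  obtain y where y: "0 < y" "y < 1" "F 1 - F 0 = (1 - 0) * F1 y" using F_mvt[of 0 1] by auto
  have "v * F1 x < v * F1 0" using F1_dec[of x 0] x assms by (intro mult_strict_left_mono_neg) auto
  moreover have "F1 0 < F1 y" using F1_inc[of 0 y] y by auto
  moreover have "(1 - v) * F1 0 = F1 0 - v * F1 0" by (simp add: algebra_simps)
  ultimately have "(1 - v) * F1 0 < F 1 - F v" using x(3) y(3) by simp
  thus ?thesis using assms by (simp add: chord_def field_simps)
qed

text \<open>\<open>F1\<close> crosses the chord slope at \<open>r1 < 0 < r2\<close>, so the gap
  rises, falls and rises again, with zeros at \<open>v\<close> and 1; \<open>v \<le> tau\<close>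
  places \<open>v\<close> at or left of \<open>r1\<close>. If \<open>r2 \<ge> 1\<close> the gap is
  positive on the whole interval and \<open>m = 1\<close>; otherwise \<open>m\<close> is the third
  zero, between \<open>r1\<close> and \<open>r2\<close>. For \<open>v = tau\<close> the zero at
  \<open>v = r1\<close> is double and \<open>m\<close> collapses to \<open>v\<close>.\<close>

lemma gap_sign:
  assumes v: "v \<le> tau"
  obtains m where "v \<le> m" "m \<le> 1" "\<And>s. s \<in> {v<..<m} \<Longrightarrow> gap F v s > 0" "\<And>s. s \<in> {m<..<1} \<Longrightarrow> gap F v s < 0"
    "v < tau \<Longrightarrow> v < m" "v = tau \<Longrightarrow> m = v" "\<And>s. m < 1 \<Longrightarrow> s > 1 \<Longrightarrow> gap F v s > 0" "\<And>s. s < v \<Longrightarrow> gap F v s < 0"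
proof -
  define l where "l = chord F v"
  have v0: "v < 0" using v tau_props by auto
  obtain r1 r2 where r: "r1 < 0" "r2 > 0" "\<And>s. s < r1 \<Longrightarrow> F1 s > l" "\<And>s. s > r2 \<Longrightarrow> F1 s > l"
    "\<And>s. r1 < s \<Longrightarrow> s < r2 \<Longrightarrow> F1 s < l" "F1 r1 = l" "F1 r2 = l"
    using F1_level[OF chord_gt_F1_0[OF v0]] unfolding l_def by metis
  have gd: "(gap F v has_real_derivative F1 s - l) (at s)" for s unfolding l_def by (rule gap_deriv)
  have inc: "gap F v x < gap F v y" if "x < y" "y \<le> r1 \<or> r2 \<le> x" for x y
    by (rule DERIV_pos_imp_increasing_open[OF that(1) _ gap_cont])
      (use gd r that in \<open>metis diff_gt_0_iff_gt le_less_trans less_le_trans order.strict_trans1 order.strict_trans2\<close>)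
  have dec: "gap F v y < gap F v x" if "x < y" "r1 \<le> x" "y \<le> r2" for x y
    by (rule DERIV_neg_imp_decreasing_open[OF that(1) _ gap_cont])
      (use gd r that in \<open>metis diff_less_0_iff_less le_less_trans less_le_trans\<close>)
  have g0: "gap F v v = 0" "gap F v 1 = 0" using v0 by auto
  have Tv: "F1 v - l = tgt v / (1 - v)" using chord_eq[of v] v0 by (simp add: l_def)
  have lt: "v < r1" if "v < tau"
  proof -
    have "F1 v > l" using Tv tgt_pos_iff[of v] that v0 by (smt (verit) divide_pos_pos)
    thus ?thesis using r(5)[of v] r(6) v0 r(2) by (cases v r1 rule: linorder_cases) auto
  qed
  have eq: "v = r1" if "v = tau"
  proof -
    have "F1 v = l" using Tv tau_props that by auto
    thus ?thesis using r(3)[of v] r(5)[of v] v0 r(2) by (cases v r1 rule: linorder_cases) auto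
  qed
  have vr: "v \<le> r1" using lt eq v by force
  have left: "gap F v s < 0" if "s < v" for s using inc[of s v] that vr g0 by auto
  show ?thesis
  proof (cases "r2 \<ge> 1")
    case True
    have vt: "v < tau" using eq dec[of r1 1] g0 True r v by (cases "v = tau") auto
    have pos: "gap F v s > 0" if "s \<in> {v<..<1}" for s
      using inc[of v s] dec[of s 1] that True g0 by (cases "s \<le> r1") auto
    show ?thesis by (rule that[of 1]) (use pos left vt v0 in auto)
  next
    case False
    have g2: "gap F v r2 < 0" using inc[of r2 1] False g0 by auto
    have g1: "gap F v r1 \<ge> 0" using inc[of v r1] vr g0 by (cases "v = r1") auto
    obtain m where m: "r1 \<le> m" "m \<le> r2" "gap F v m = 0"
      using IVT2'[of "gap F v" r2 0 r1] g1 g2 r gap_cont by auto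
    have mr: "m < r2" using m g2 by (cases "m = r2") auto
    have pos: "gap F v s > 0" if "s \<in> {v<..<m}" for s
      using inc[of v s] dec[of s m] that m mr g0 by (cases "s \<le> r1") auto
    have neg: "gap F v s < 0" if "s \<in> {m<..<1}" for s
      using dec[of m s] inc[of s 1] that m mr g0 by (cases "s \<le> r2") auto
    have hi: "gap F v s > 0" if "s > 1" for s using inc[of 1 s] that False g0 by auto
    have mv: "m = v" if "v = tau" using eq[OF that] dec[of r1 m] m g0 by (cases "m = r1") auto
    show ?thesis by (rule that[of m]) (use pos neg left hi m mr vr lt mv False in auto)
  qed
qed

section \<open>The shooting value at the target and the kinetic value\<close>

lemma shoots_gap_exists:
  assumes "a \<le> 1" "\<beta> \<ge> 0" "q > 0" shows "\<exists>y. shoots (gap F v) \<beta> q a y"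
  by (rule shoots_exists[OF assms(1) gap_cont assms(2,3)])

text \<open>\<open>v\<close> enters twice, as the far end of the chord and as the point where the
  shooting stops. For \<open>v \<le> tau\<close> and \<open>\<beta> > 0\<close>, vanishing of
  \<open>dv\<close> will turn out to be equivalent to a wave from 1 to \<open>v\<close>.\<close>

abbreviation dv :: "real \<Rightarrow> real \<Rightarrow> real \<Rightarrow> real" where "dv \<beta> q v \<equiv> endval (gap F v) \<beta> q v"

text \<open>Moving the target left raises the chord slope and hence the gap to the left of 1, which
  lowers the backward solution. So it is already nonpositive at \<open>v2\<close>, and
  \<open>shoots_neg\<close> makes it negative at \<open>v1\<close>. This single crossing is the
  uniqueness of the kinetic value.\<close>

lemma dv_le_0_imp_neg:
  assumes v: "v1 < v2" "v2 \<le> tau" and b: "\<beta> \<ge> 0" "q > 0" and d: "dv \<beta> q v2 \<le> 0"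
  shows "dv \<beta> q v1 < 0"
proof -
  have v21: "v2 < 1" using v tau_props by auto
  obtain y1 where y1: "shoots (gap F v1) \<beta> q v1 y1" using shoots_gap_exists[OF _ b, of v1 v1] v v21 by fastforce
  obtain y2 where y2: "shoots (gap F v2) \<beta> q v2 y2" using shoots_gap_exists[of v2] v v21 b by (metis less_imp_le less_trans le_less_trans less_le_trans)
  have y1': "shoots (gap F v1) \<beta> q v2 y1" using shoots_restrict[OF y1] v by auto
  have "gap F v2 s \<le> gap F v1 s" if "s \<in> {v2..1}" for s
  proof -
    have "chord F v2 * (1 - s) \<le> chord F v1 * (1 - s)" using chord_dec[OF v] that by (intro mult_right_mono) auto
    thus ?thesis by (simp add: gap_def algebra_simps)
  qed
  hence "y1 v2 \<le> y2 v2 + 2 * 0 * (1 - v2)"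
    by (intro shoots_perturb[OF y1' y2 b order.refl]) (use v21 in auto)
  hence le: "y1 v2 \<le> 0" using d endval_eq[OF y2, of v2] v21 b by auto
  obtain m where m: "v1 \<le> m" "m \<le> 1" "\<And>s. s \<in> {v1<..<m} \<Longrightarrow> gap F v1 s > 0" "\<And>s. s \<in> {m<..<1} \<Longrightarrow> gap F v1 s < 0"
    using gap_sign[of v1] v by (metis less_le_trans less_imp_le)
  have "y1 v1 < 0" by (rule shoots_neg[OF y1 b(1) m v(1) _ _ le]) (use v21 in auto)
  thus ?thesis using endval_eq[OF y1, of v1] v v21 b by auto
qed

text \<open>For the tangent chord the gap is negative on the whole interval, so the solution is
  positive inside and its end value is a limit of positive numbers.\<close>

lemma dv_tau_nonneg:
  assumes b: "\<beta> \<ge> 0" "q > 0" shows "dv \<beta> q tau \<ge> 0"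
proof (rule ccontr)
  have t1: "tau < 1" using tau_props by auto
  obtain y where y: "shoots (gap F tau) \<beta> q tau y" using shoots_gap_exists[of tau] t1 b by (metis less_imp_le less_trans le_less_trans less_le_trans)
  assume "\<not> dv \<beta> q tau \<ge> 0"
  hence neg: "y tau < 0" using endval_eq[OF y, of tau] t1 b by auto
  obtain m where m: "m = tau" "\<And>s. s \<in> {m<..<1} \<Longrightarrow> gap F tau s < 0"
    using gap_sign[of tau] by blast
  have pos: "y s > 0" if "s \<in> {tau<..<1}" for s
    by (rule shoots_pos[OF y order.refl _ that]) (use m in auto)
  define c where "c = (tau + 1) / 2"
  have c: "c \<in> {tau<..<1}" using t1 by (auto simp: c_def)
  obtain x where "tau \<le> x" "x \<le> c" "y x = 0"
    using IVT'[of y tau 0 c] neg pos[OF c] c continuous_on_subset[OF shoots_continuous[OF y], of "{tau..c}"] by auto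
  thus False using pos[of x] neg c by (cases "x = tau") auto
qed

text \<open>Coercivity of \<open>F1\<close> makes the flux superlinear at minus infinity. Such an
  \<open>a\<close> is too far left to be reached by a wave and bounds the search for the kinetic
  value.\<close>

lemma chord_large: "\<exists>a<tau. chord F a > F1 1"
proof -
  obtain A0 where A0: "\<And>s. s \<le> A0 \<Longrightarrow> F1 s \<ge> F1 1 + 1" using F1_ge_far(1)[of "F1 1 + 1"] by auto
  define A where "A = min A0 (tau - 1)"
  have A: "\<And>s. s \<le> A \<Longrightarrow> F1 s \<ge> F1 1 + 1" "A < tau" using A0 by (auto simp: A_def)
  \<comment> \<open>\<open>C\<close> is the excess of the increment of \<open>F\<close> from
    \<open>A\<close> to 1 over slope \<open>F1 1\<close>. Left of \<open>A\<close> the slope exceeds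
    \<open>F1 1\<close> by at least 1, so moving \<open>\<bar>C\<bar> + 1\<close> further left makes
    the excess positive.\<close>
  define C where "C = F 1 - F A - F1 1 * (1 - A)"
  define a where "a = A - \<bar>C\<bar> - 1"
  have a: "a < A" by (auto simp: a_def)
  obtain z where z: "a < z" "z < A" "F A - F a = (A - a) * F1 z" using F_mvt[OF a] by auto
  have "(A - a) * (F1 1 + 1) \<le> (A - a) * F1 z" using A(1)[of z] z a by (intro mult_left_mono) auto
  hence "F 1 - F a - F1 1 * (1 - a) \<ge> C + (A - a)" using z by (simp add: C_def algebra_simps)
  moreover have "C + (A - a) > 0" unfolding a_def by linarith
  ultimately have "F 1 - F a > F1 1 * (1 - a)" by linarith
  hence "chord F a > F1 1" using a A(2) tau_props by (simp add: chord_def field_simps)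
  thus ?thesis using a A(2) by (intro exI[of _ a]) auto
qed

text \<open>The gap vanishes at 1 with slope \<open>F1 1 - chord F a < 0\<close>, so it is positive
  just left of 1 and the interval of negativity in \<open>gap_sign\<close> must be empty.\<close>

lemma gap_pos_of_chord_large:
  assumes a: "a < tau" "chord F a > F1 1" and s: "s \<in> {a<..<1}" shows "gap F a s > 0"
proof -
  obtain m where m: "a \<le> m" "m \<le> 1" "\<And>s. s \<in> {a<..<m} \<Longrightarrow> gap F a s > 0" "\<And>s. s \<in> {m<..<1} \<Longrightarrow> gap F a s < 0"
    using gap_sign[of a] a by (metis less_imp_le)
  have "m = 1"
  proof (rule ccontr)
    assume "m \<noteq> 1"
    obtain d where d: "d > 0" "\<And>h. h > 0 \<Longrightarrow> h < d \<Longrightarrow> gap F a 1 < gap F a (1 - h)"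
      using DERIV_neg_dec_left[OF gap_deriv[of a 1]] a by auto
    define h where "h = min (d/2) ((1 - m)/2)"
    have "h > 0" "h < d" "1 - h \<in> {m<..<1}" using d(1) m(2) \<open>m \<noteq> 1\<close> by (auto simp: h_def min_def field_simps)
    thus False using d(2)[of h] m(4)[of "1 - h"] by auto
  qed
  thus ?thesis using m(3) s by auto
qed

lemma dv_neg_of_chord_large:
  assumes a: "a < tau" "chord F a > F1 1" and b: "\<beta> \<ge> 0" "q > 0" shows "dv \<beta> q a < 0"
proof -
  have a1: "a < 1" using a tau_props by auto
  obtain y where y: "shoots (gap F a) \<beta> q a y" using shoots_gap_exists[of a] a1 b by (metis less_imp_le less_trans le_less_trans less_le_trans)
  have "y a < y 1" by (rule shoots_strict_increase[OF y b(1) order.refl a1 order.refl])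
      (use gap_pos_of_chord_large[OF a] in auto)
  thus ?thesis using endval_eq[OF y, of a] a1 b shoots_end[OF y] by auto
qed

text \<open>Solving on the common interval \<open>{a..1}\<close> separates the two roles of
  \<open>v\<close>: changing the chord moves the solution uniformly little by
  \<open>shoots_perturb\<close>, and changing the stopping point is continuity of one fixed
  solution.\<close>

lemma dv_continuous:
  assumes b: "\<beta> \<ge> 0" "q > 0" shows "continuous_on {a..tau} (dv \<beta> q)"
proof (cases "a \<le> tau")
  case True
  have a1: "a \<le> 1" "tau < 1" using True tau_props by auto
  have "\<forall>v. \<exists>y. shoots (gap F v) \<beta> q a y" using shoots_gap_exists a1 b by auto
  then obtain y where y: "\<And>v. shoots (gap F v) \<beta> q a (y v)" by metis
  have eq: "dv \<beta> q v = y v v" if "v \<in> {a..tau}" for v using endval_eq[OF y, of v v] that a1 b by auto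
  have cmp: "y v s - y w s \<le> 2 * (\<bar>chord F v - chord F w\<bar> * (1 - a)) * (1 - a)" if "s \<in> {a..1}" for v w s
  proof -
    let ?e = "\<bar>chord F v - chord F w\<bar> * (1 - a)"
    have e: "?e \<ge> 0" using a1 by auto
    have "y v s \<le> y w s + 2 * ?e * (1 - s)"
    proof (rule shoots_perturb[OF y y b e _ that])
      fix s assume "s \<in> {a..1}"
      thus "gap F w s + \<beta> * ppow q (y w s) - ?e \<le> gap F v s + \<beta> * ppow q (y w s)"
        using gap_diff_le[of F s F 0 v w "\<bar>chord F v - chord F w\<bar>" a] by auto
    qed
    also have "\<dots> \<le> y w s + 2 * ?e * (1 - a)" using e that by (intro add_left_mono mult_left_mono) auto
    finally show ?thesis by auto
  qed
  have "continuous_on {a..tau} (\<lambda>v. y v v)"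
    unfolding continuous_on_def
  proof
    fix w assume w: "w \<in> {a..tau}"
    have c: "continuous_on {a..tau} (chord F)" by (rule chord_cont) (use a1 in auto)
    have "((\<lambda>v. 2 * (\<bar>chord F v - chord F w\<bar> * (1 - a)) * (1 - a)) \<longlongrightarrow> 2 * (\<bar>chord F w - chord F w\<bar> * (1 - a)) * (1 - a)) (at w within {a..tau})"
      using c w unfolding continuous_on_def by (intro tendsto_intros) auto
    hence l: "((\<lambda>v. 2 * (\<bar>chord F v - chord F w\<bar> * (1 - a)) * (1 - a)) \<longlongrightarrow> 0) (at w within {a..tau})" by simp
    have "\<forall>\<^sub>F v in at w within {a..tau}. norm (y v v - y w v) \<le> 2 * (\<bar>chord F v - chord F w\<bar> * (1 - a)) * (1 - a)"
      unfolding eventually_at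
    proof (intro exI[of _ 1] conjI ballI impI)
      fix v assume "v \<in> {a..tau}"
      hence "v \<in> {a..1}" using a1 by auto
      thus "norm (y v v - y w v) \<le> 2 * (\<bar>chord F v - chord F w\<bar> * (1 - a)) * (1 - a)"
        using cmp[of v v w] cmp[of v w v] by (simp add: abs_minus_commute abs_le_iff)
    qed auto
    from Lim_null_comparison[OF this l] have "((\<lambda>v. y v v - y w v) \<longlongrightarrow> 0) (at w within {a..tau})" .
    moreover have "((\<lambda>v. y w v) \<longlongrightarrow> y w w) (at w within {a..tau})"
      using continuous_on_subset[OF shoots_continuous[OF y], of "{a..tau}" w] a1 w unfolding continuous_on_def by auto
    ultimately have "((\<lambda>v. (y v v - y w v) + y w v) \<longlongrightarrow> 0 + y w w) (at w within {a..tau})" by (rule tendsto_add)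
    thus "((\<lambda>v. y v v) \<longlongrightarrow> y w w) (at w within {a..tau})" by simp
  qed
  thus ?thesis by (rule continuous_on_eq) (use eq in auto)
qed auto

lemma kappa_ex1: assumes b: "\<beta> \<ge> 0" "q > 0" shows "\<exists>!v. v \<le> tau \<and> dv \<beta> q v = 0"
proof -
  obtain a where a: "a < tau" "dv \<beta> q a < 0" using chord_large dv_neg_of_chord_large b by metis
  obtain v where v: "a \<le> v" "v \<le> tau" "dv \<beta> q v = 0"
    using IVT'[of "dv \<beta> q" a 0 tau] a dv_tau_nonneg[OF b] dv_continuous[OF b] by auto
  show ?thesis
  proof (rule ex1I[of _ v])
    show "v \<le> tau \<and> dv \<beta> q v = 0" using v by auto
    fix w assume w: "w \<le> tau \<and> dv \<beta> q w = 0"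
    thus "w = v" using dv_le_0_imp_neg[OF _ _ b, of v w] dv_le_0_imp_neg[OF _ _ b, of w v] v
      by (cases v w rule: linorder_cases) auto
  qed
qed

text \<open>The kinetic value of the left state 1. The case \<open>\<beta> = 0\<close> is included
  because it is the limit problem for p > 1/2.\<close>

definition kappa :: "real \<Rightarrow> real \<Rightarrow> real" where "kappa \<beta> q = (THE v. v \<le> tau \<and> dv \<beta> q v = 0)"

context fixes \<beta> q :: real assumes b: "\<beta> \<ge> 0" "q > 0"
begin

lemma kappa: "kappa \<beta> q \<le> tau" "dv \<beta> q (kappa \<beta> q) = 0"
  using theI'[OF kappa_ex1[OF b]] unfolding kappa_def by auto

lemma kappa_less: assumes "v \<le> tau" "dv \<beta> q v > 0" shows "kappa \<beta> q < v"
  using dv_le_0_imp_neg[OF _ _ b, of v "kappa \<beta> q"] kappa assms by (cases v "kappa \<beta> q" rule: linorder_cases) auto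

lemma kappa_greater: assumes "v \<le> tau" "dv \<beta> q v < 0" shows "v < kappa \<beta> q"
  using dv_le_0_imp_neg[OF _ _ b, of "kappa \<beta> q" v] kappa assms by (cases v "kappa \<beta> q" rule: linorder_cases) auto

lemma kappa_eq_tau_iff: "kappa \<beta> q = tau \<longleftrightarrow> dv \<beta> q tau \<le> 0"
proof
  show "kappa \<beta> q = tau \<Longrightarrow> dv \<beta> q tau \<le> 0" using kappa(2) by simp
  assume "dv \<beta> q tau \<le> 0"
  thus "kappa \<beta> q = tau" using dv_le_0_imp_neg[OF _ order.refl b, of "kappa \<beta> q"] kappa by force
qed

end

end

section \<open>Traveling waves and the phase-plane equation\<close>

text \<open>The wave equation with arbitrary reaction \<open>g\<close> and left state
  \<open>l\<close>, so that waves of \<open>f\<close> and waves of the rescaled fluxes are both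
  instances and can be carried into each other.\<close>

definition profile :: "(real \<Rightarrow> real) \<Rightarrow> real \<Rightarrow> real \<Rightarrow> real \<Rightarrow> real \<Rightarrow> (real \<Rightarrow> real) \<Rightarrow> (real \<Rightarrow> real) \<Rightarrow> (real \<Rightarrow> real) \<Rightarrow> bool" where
  "profile g \<beta> p l v w w1 w2 \<longleftrightarrow>
     (\<forall>x. (w has_real_derivative w1 x) (at x)) \<and> (\<forall>x. (w1 has_real_derivative w2 x) (at x)) \<and>
     continuous_on UNIV w2 \<and> (w \<longlongrightarrow> l) at_bot \<and> (w \<longlongrightarrow> v) at_top \<and>
     (w1 \<longlongrightarrow> 0) at_bot \<and> (w1 \<longlongrightarrow> 0) at_top \<and>
     (\<forall>x. g (w x) = \<beta> * (\<bar>w1 x\<bar> powr p) * w1 x + w2 x)"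

text \<open>The second derivative of \<open>c * w (k * x)\<close> carries the factor
  \<open>c * k^2\<close>; the assumptions \<open>G\<close> and \<open>B\<close> ask for the same
  factor in the other two terms.\<close>

lemma profile_rescale:
  assumes pr: "profile g \<beta> p l v w w1 w2" and k: "k > 0"
    and G: "\<And>s. G (c * s) = c * k^2 * g s"
    and B: "\<And>z. B * (\<bar>c * k * z\<bar> powr p) * (c * k * z) = c * k^2 * (\<beta> * (\<bar>z\<bar> powr p) * z)"
  shows "profile G B p (c * l) (c * v) (\<lambda>x. c * w (k * x)) (\<lambda>x. c * k * w1 (k * x)) (\<lambda>x. c * k^2 * w2 (k * x))"
proof -
  have dw: "\<And>x. (w has_real_derivative w1 x) (at x)" and dw1: "\<And>x. (w1 has_real_derivative w2 x) (at x)"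
    and c: "continuous_on UNIV w2"
    and lim: "(w \<longlongrightarrow> l) at_bot" "(w \<longlongrightarrow> v) at_top" "(w1 \<longlongrightarrow> 0) at_bot" "(w1 \<longlongrightarrow> 0) at_top"
    and ode: "\<And>x. g (w x) = \<beta> * (\<bar>w1 x\<bar> powr p) * w1 x + w2 x"
    using pr by (auto simp: profile_def)
  have top: "filterlim (\<lambda>x. k * x) at_top at_top"
    by (rule filterlim_tendsto_pos_mult_at_top[OF tendsto_const k filterlim_ident])
  have bot: "filterlim (\<lambda>x. k * x) at_bot at_bot"
    by (rule filterlim_tendsto_pos_mult_at_bot[OF tendsto_const k filterlim_ident])
  show ?thesis unfolding profile_def
  proof (intro conjI allI)
    fix x
    show "((\<lambda>x. c * w (k * x)) has_real_derivative c * k * w1 (k * x)) (at x)"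
      by (auto intro!: derivative_eq_intros DERIV_chain2[OF dw])
    show "((\<lambda>x. c * k * w1 (k * x)) has_real_derivative c * k^2 * w2 (k * x)) (at x)"
      by (auto intro!: derivative_eq_intros DERIV_chain2[OF dw1] simp: power2_eq_square)
    show "G (c * w (k * x)) = B * (\<bar>c * k * w1 (k * x)\<bar> powr p) * (c * k * w1 (k * x)) + c * k^2 * w2 (k * x)"
      unfolding G ode B by (rule distrib_left)
  next
    show "continuous_on UNIV (\<lambda>x. c * k^2 * w2 (k * x))"
      by (intro continuous_intros continuous_on_compose2[OF c]) auto
    show "((\<lambda>x. c * w (k * x)) \<longlongrightarrow> c * l) at_bot" "((\<lambda>x. c * w (k * x)) \<longlongrightarrow> c * v) at_top"
      by (intro tendsto_intros filterlim_compose[OF lim(1) bot] filterlim_compose[OF lim(2) top])+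
    show "((\<lambda>x. c * k * w1 (k * x)) \<longlongrightarrow> 0) at_bot" "((\<lambda>x. c * k * w1 (k * x)) \<longlongrightarrow> 0) at_top"
      by (intro tendsto_mult_right_zero filterlim_compose[OF lim(3) bot] filterlim_compose[OF lim(4) top])+
  qed
qed

lemma continuous_antiderivative_real:
  fixes g :: "real \<Rightarrow> real" assumes "continuous_on UNIV g"
  shows "\<exists>G. \<forall>x. (G has_real_derivative g x) (at x)"
proof -
  have "isCont g x" for x using assms by (simp add: continuous_on_eq_continuous_at)
  thus ?thesis using einterval_antiderivative[of "-\<infinity>" "\<infinity>" g]
    by (simp add: has_real_derivative_iff_has_vector_derivative)
qed

lemma second_derivative_local_min:
  fixes w w1 w2 :: "real \<Rightarrow> real"
  assumes d1: "\<And>x. (w has_real_derivative w1 x) (at x)" and d2: "(w1 has_real_derivative l) (at c)"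
    and d: "d > 0" and min: "\<And>x. \<bar>c - x\<bar> < d \<Longrightarrow> w c \<le> w x"
  shows "w1 c = 0 \<and> l \<ge> 0"
proof
  show w1: "w1 c = 0" by (rule DERIV_local_min[OF d1 d]) (use min in auto)
  show "l \<ge> 0"
  proof (rule ccontr)
    assume "\<not> l \<ge> 0"
    then obtain e where e: "e > 0" "\<And>h. h > 0 \<Longrightarrow> h < e \<Longrightarrow> w1 (c + h) < w1 c"
      using DERIV_neg_dec_right[OF d2] by auto
    define h where "h = min d e / 2"
    have h: "h > 0" "h < d" "h < e" using d e by (auto simp: h_def)
    obtain z where z: "c < z" "z < c + h" "w (c + h) - w c = (c + h - c) * w1 z"
      using MVT2[of c "c + h" w w1] d1 h by auto
    have "w1 z < 0" using e(2)[of "z - c"] z h w1 by auto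
    hence "w (c + h) < w c" using z(3) h by (smt (verit) mult_pos_neg)
    thus False using min[of "c + h"] h by auto
  qed
qed

lemma second_derivative_local_max:
  fixes w w1 w2 :: "real \<Rightarrow> real"
  assumes d1: "\<And>x. (w has_real_derivative w1 x) (at x)" and d2: "(w1 has_real_derivative l) (at c)"
    and d: "d > 0" and max: "\<And>x. \<bar>c - x\<bar> < d \<Longrightarrow> w x \<le> w c"
  shows "w1 c = 0 \<and> l \<le> 0"
  using second_derivative_local_min[of "\<lambda>x. - w x" "\<lambda>x. - w1 x" "- l" c d] d1 d2 d max
  by (auto intro: DERIV_minus)

lemma attains_min_half_line:
  fixes w :: "real \<Rightarrow> real"
  assumes c: "continuous_on UNIV w" and ev: "(w \<longlongrightarrow> l) at_bot" and x': "w x' < l" "x' \<le> b"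
  shows "\<exists>c\<le>b. \<forall>x\<le>b. w c \<le> w x"
proof -
  obtain N where N: "\<And>x. x \<le> N \<Longrightarrow> w x > w x'"
    using order_tendstoD(1)[OF ev x'(1)] by (auto simp: eventually_at_bot_linorder)
  define X where "X = min N x'"
  have X: "X \<le> b" using x' by (auto simp: X_def)
  obtain c where c: "c \<in> {X..b}" "\<And>x. x \<in> {X..b} \<Longrightarrow> w c \<le> w x"
    using continuous_attains_inf[of "{X..b}" w] continuous_on_subset[OF c, of "{X..b}"] X by fastforce
  have "w c \<le> w x" if "x \<le> b" for x
  proof (cases "x \<ge> X")
    case False
    hence "w x > w x'" using N[of x] by (auto simp: X_def)
    moreover have "w c \<le> w x'" using x' by (intro c(2)) (auto simp: X_def)
    ultimately show ?thesis by auto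
  qed (use c(2) that in auto)
  thus ?thesis using c(1) by auto
qed

lemma attains_min_line:
  fixes w :: "real \<Rightarrow> real"
  assumes c: "continuous_on UNIV w" and b: "(w \<longlongrightarrow> l) at_bot" "w x' < l" and t: "(w \<longlongrightarrow> k) at_top" "w x' < k"
  shows "\<exists>c. \<forall>x. w c \<le> w x"
proof -
  obtain N where N: "\<And>x. x \<ge> N \<Longrightarrow> w x > w x'"
    using order_tendstoD(1)[OF t] by (auto simp: eventually_at_top_linorder)
  define X where "X = max N x'"
  obtain c where c: "\<And>x. x \<le> X \<Longrightarrow> w c \<le> w x"
    using attains_min_half_line[OF c b, of X] by (auto simp: X_def)
  have "w c \<le> w x" for x
  proof (cases "x \<le> X")
    case False
    hence "w x > w x'" using N[of x] by (auto simp: X_def)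
    thus ?thesis using c[of x'] by (auto simp: X_def)
  qed (use c in auto)
  thus ?thesis by auto
qed

lemma ppow_square_abs: "ppow ((p + 1) / 2) (z\<^sup>2) = \<bar>z\<bar> powr p * \<bar>z\<bar>"
proof (cases "z = 0")
  case False
  have "z\<^sup>2 = \<bar>z\<bar> powr 2" using False by (simp add: powr_numeral)
  hence "ppow ((p + 1) / 2) (z\<^sup>2) = (\<bar>z\<bar> powr 2) powr ((p + 1) / 2)" by (simp add: ppow_pos_eq)
  also have "\<dots> = \<bar>z\<bar> powr (2 * ((p + 1) / 2))" by (rule powr_powr)
  also have "2 * ((p + 1) / 2) = p + 1" by simp
  also have "\<bar>z\<bar> powr (p + 1) = \<bar>z\<bar> powr p * \<bar>z\<bar>" using False by (simp add: powr_add)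
  finally show ?thesis .
qed auto

lemma antimono_real_derivative:
  fixes E :: "real \<Rightarrow> real"
  assumes "\<And>x. (E has_real_derivative E' x) (at x)" "\<And>x. E' x \<le> 0" "x \<le> y" shows "E y \<le> E x"
  by (rule DERIV_nonpos_imp_nonincreasing[OF assms(3)]) (use assms in blast)

lemma antimono_le_limit_at_bot:
  fixes E :: "real \<Rightarrow> real"
  assumes "\<And>x y. x \<le> y \<Longrightarrow> E y \<le> E x" "(E \<longlongrightarrow> l) at_bot" shows "E x \<le> l"
  by (rule tendsto_lowerbound[OF assms(2)]) (use assms(1) in \<open>auto simp: eventually_at_bot_linorder\<close>)

lemma antimono_ge_limit_at_top:
  fixes E :: "real \<Rightarrow> real"
  assumes "\<And>x y. x \<le> y \<Longrightarrow> E y \<le> E x" "(E \<longlongrightarrow> l) at_top" shows "l \<le> E x"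
  by (rule tendsto_upperbound[OF assms(2)]) (use assms(1) in \<open>auto simp: eventually_at_top_linorder\<close>)

context flux begin

text \<open>An extremum of \<open>w\<close> above 1 or below \<open>v\<close> contradicts the sign
  of the gap there. For monotonicity, the energy \<open>E\<close> decreases from
  \<open>- G 1\<close> to \<open>- G v\<close>. If \<open>w1 x > 0\<close>, then \<open>w\<close>
  has a minimum at some \<open>c < x\<close>, where the gap is nonnegative, so
  \<open>w c \<le> m\<close>; the energy bound gives \<open>G (w c) \<le> G v\<close>, and
  \<open>G\<close> increases on \<open>[v, m]\<close>, so \<open>w c = v\<close>. Then the energy is
  exhausted at \<open>c\<close>, yet \<open>w1 x > 0\<close> still dissipates.\<close>

lemma profile_monotone:
  assumes v: "v \<le> tau" and \<beta>: "\<beta> > 0" and pr: "profile (gap F v) \<beta> p 1 v w w1 w2"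
  shows "v \<le> w x \<and> w x \<le> 1 \<and> w1 x \<le> 0"
proof -
  define g where "g = gap F v"
  have dw: "\<And>x. (w has_real_derivative w1 x) (at x)" and dw1: "\<And>x. (w1 has_real_derivative w2 x) (at x)"
    and lim: "(w \<longlongrightarrow> 1) at_bot" "(w \<longlongrightarrow> v) at_top" "(w1 \<longlongrightarrow> 0) at_bot" "(w1 \<longlongrightarrow> 0) at_top"
    and ode: "\<And>x. g (w x) = \<beta> * (\<bar>w1 x\<bar> powr p) * w1 x + w2 x"
    using pr by (auto simp: profile_def g_def)
  have v0: "v < 0" using v tau_props by auto
  have wc: "continuous_on UNIV w" by (rule continuous_at_imp_continuous_on) (use dw DERIV_isCont in fast)
  obtain m where m: "v \<le> m" "m \<le> 1" "\<And>s. s \<in> {v<..<m} \<Longrightarrow> g s > 0" "\<And>s. s \<in> {m<..<1} \<Longrightarrow> g s < 0"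
    "\<And>s. m < 1 \<Longrightarrow> s > 1 \<Longrightarrow> g s > 0" "\<And>s. s < v \<Longrightarrow> g s < 0"
    unfolding g_def by (rule gap_sign[OF v]) blast
  obtain G where G: "\<And>s. (G has_real_derivative g s) (at s)"
    using continuous_antiderivative_real[of g] gap_cont unfolding g_def by blast
  have Gc: "continuous_on A G" for A by (rule continuous_at_imp_continuous_on) (use G DERIV_isCont in fast)
  have Ginc: "G a < G b" if "v \<le> a" "a < b" "b \<le> m" for a b
    by (rule DERIV_pos_imp_increasing_open[OF that(2) _ Gc]) (use G m(3) that in fastforce)
  define E where "E x = (w1 x)\<^sup>2 / 2 - G (w x)" for x
  define E' where "E' x = - (\<beta> * \<bar>w1 x\<bar> powr p * (w1 x)\<^sup>2)" for x
  have dE: "(E has_real_derivative E' x) (at x)" for x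
  proof -
    have "((\<lambda>x. G (w x)) has_real_derivative g (w x) * w1 x) (at x)"
      using DERIV_chain2[OF G dw] .
    hence "(E has_real_derivative (2 * w1 x * w2 x) / 2 - g (w x) * w1 x) (at x)"
      unfolding E_def by (auto intro!: derivative_eq_intros dw1)
    moreover have "(2 * w1 x * w2 x) / 2 - g (w x) * w1 x = E' x"
      unfolding ode E'_def by (simp add: power2_eq_square algebra_simps)
    ultimately show ?thesis by simp
  qed
  have E'le: "E' x \<le> 0" for x using \<beta> by (simp add: E'_def)
  have Emono: "E y \<le> E x" if "x \<le> y" for x y by (rule antimono_real_derivative[OF dE E'le that])
  have "isCont G s" for s using G DERIV_isCont by blast
  hence "(E \<longlongrightarrow> 0\<^sup>2 / 2 - G 1) at_bot" "(E \<longlongrightarrow> 0\<^sup>2 / 2 - G v) at_top"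
    unfolding E_def[abs_def] by (intro tendsto_intros lim isCont_tendsto_compose[of _ G]; simp)+
  hence limE: "(E \<longlongrightarrow> - G 1) at_bot" "(E \<longlongrightarrow> - G v) at_top" by simp_all
  have Ele: "E x \<le> - G 1" and Ege: "E x \<ge> - G v" for x
    using antimono_le_limit_at_bot[OF Emono limE(1)] antimono_ge_limit_at_top[OF Emono limE(2)] by auto
  \<comment> \<open>If the gap were positive all the way to 1, then \<open>G v < G 1\<close>, and
    the energy would have to increase along the wave.\<close>
  have m1: "m < 1"
  proof (rule ccontr)
    assume "\<not> m < 1"
    hence "G v < G 1" using Ginc[of v 1] m v0 by auto
    thus False using Ele[of 0] Ege[of 0] by auto
  qed
  have ub: "w x \<le> 1" for x
  proof (rule ccontr)
    assume "\<not> w x \<le> 1"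
    hence w: "- w x < - 1" "- w x < - v" using v0 by auto
    have "continuous_on UNIV (\<lambda>x. - w x)" by (intro continuous_intros wc)
    from attains_min_line[OF this tendsto_minus[OF lim(1)] w(1) tendsto_minus[OF lim(2)] w(2)]
    obtain c where c: "\<And>x. w x \<le> w c" by auto
    have "w1 c = 0 \<and> w2 c \<le> 0" by (rule second_derivative_local_max[OF dw dw1 zero_less_one]) (use c in auto)
    hence "g (w c) \<le> 0" by (simp add: ode)
    moreover have "w c > 1" using c[of x] w by auto
    ultimately show False using m(5)[OF m1, of "w c"] by auto
  qed
  have lb: "v \<le> w x" for x
  proof (rule ccontr)
    assume "\<not> v \<le> w x"
    hence w: "w x < 1" "w x < v" using v0 by auto
    from attains_min_line[OF wc lim(1) w(1) lim(2) w(2)]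
    obtain c where c: "\<And>x. w c \<le> w x" by auto
    have "w1 c = 0 \<and> w2 c \<ge> 0" by (rule second_derivative_local_min[OF dw dw1 zero_less_one]) (use c in auto)
    hence "g (w c) \<ge> 0" by (simp add: ode)
    moreover have "w c < v" using c[of x] w by auto
    ultimately show False using m(6)[of "w c"] by auto
  qed
  have "w1 x \<le> 0"
  proof (rule ccontr)
    assume neg: "\<not> w1 x \<le> 0"
    then obtain d where d: "d > 0" "\<And>h. h > 0 \<Longrightarrow> h < d \<Longrightarrow> w (x - h) < w x"
      using DERIV_pos_inc_left[OF dw[of x]] by (meson not_le)
    define x' where "x' = x - d / 2"
    have x': "x' < x" "w x' < w x" using d by (auto simp: x'_def)
    have "w x' < 1" using x' ub[of x] by auto
    from attains_min_half_line[OF wc lim(1) this, of x] x'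
    obtain c where c: "c \<le> x" "\<And>y. y \<le> x \<Longrightarrow> w c \<le> w y" by auto
    have wc': "w c < w x" using c(2)[of x'] x' by auto
    hence cx: "c < x" using c(1) by (cases "c = x") auto
    have "w1 c = 0 \<and> w2 c \<ge> 0"
      by (rule second_derivative_local_min[OF dw dw1, of "x - c"]) (use c(2) cx in auto)
    hence w1c: "w1 c = 0" and gc: "g (w c) \<ge> 0" by (auto simp: ode)
    have wc1: "w c < 1" using wc' ub[of x] by auto
    have "w c \<le> m"
    proof (rule ccontr)
      assume "\<not> w c \<le> m"
      hence "g (w c) < 0" using wc1 by (intro m(4)) auto
      thus False using gc by auto
    qed
    moreover have "G (w c) \<le> G v" using Ege[of c] w1c by (simp add: E_def)
    ultimately have "w c = v" using Ginc[OF order.refl, of "w c"] lb[of c] by (meson leD less_le_trans not_le_imp_less order.not_eq_order_implies_strict)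
    hence "E c = - G v" using w1c by (simp add: E_def)
    hence Econst: "E y = - G v" if "y \<ge> c" for y using Emono[OF that] Ege[of y] by auto
    have "E' x < 0" using \<beta> neg by (simp add: E'_def)
    then obtain d where d: "d > 0" "\<And>h. h > 0 \<Longrightarrow> h < d \<Longrightarrow> E x > E (x + h)"
      using DERIV_neg_dec_right[OF dE] by blast
    show False using d(2)[of "d / 2"] d(1) Econst[of x] Econst[of "x + d / 2"] cx by auto
  qed
  thus ?thesis using ub lb by auto
qed

text \<open>Along a profile, \<^term>\<open>w1\<^sup>2\<close> and the shooting solution evaluated at \<^term>\<open>w\<close> satisfy the same
  scalar equation, in the direction of \<^term>\<open>x\<close> in which their difference is contracted.\<close>
lemma profile_imp_dv_zero:
  assumes v: "v \<le> tau" and \<beta>: "\<beta> > 0" and p: "p \<ge> 0" and pr: "profile (gap F v) \<beta> p 1 v w w1 w2"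
  shows "dv \<beta> ((p + 1) / 2) v = 0"
proof -
  define g where "g = gap F v"
  define q where "q = (p + 1) / 2"
  have q: "q > 0" using p by (auto simp: q_def)
  have dw: "\<And>x. (w has_real_derivative w1 x) (at x)" and dw1: "\<And>x. (w1 has_real_derivative w2 x) (at x)"
    and lim: "(w \<longlongrightarrow> 1) at_bot" "(w \<longlongrightarrow> v) at_top" "(w1 \<longlongrightarrow> 0) at_bot" "(w1 \<longlongrightarrow> 0) at_top"
    and ode: "\<And>x. g (w x) = \<beta> * (\<bar>w1 x\<bar> powr p) * w1 x + w2 x"
    using pr by (auto simp: profile_def g_def)
  have mon: "v \<le> w x" "w x \<le> 1" "w1 x \<le> 0" for x using profile_monotone[OF v \<beta> pr] by auto
  have v1: "v < 1" using v tau_props by auto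
  obtain y where y: "shoots g \<beta> q v y" unfolding g_def using shoots_gap_exists[of v \<beta> q v] v1 \<beta> q by fastforce
  define D where "D x = (w1 x)\<^sup>2 - y (w x)" for x
  have dD: "(D has_real_derivative 2 * \<beta> * w1 x * (ppow q ((w1 x)\<^sup>2) - ppow q (y (w x)))) (at x)" for x
  proof -
    have "(y has_real_derivative 2 * g (w x) + 2 * \<beta> * ppow q (y (w x))) (at (w x) within range w)"
      by (rule has_field_derivative_subset[OF shoots_deriv[OF y]]) (use mon in auto)
    from DERIV_image_chain[OF this, of "w1 x"] dw
    have "((\<lambda>x. y (w x)) has_real_derivative (2 * g (w x) + 2 * \<beta> * ppow q (y (w x))) * w1 x) (at x)"
      by (simp add: o_def)
    hence "(D has_real_derivative 2 * w1 x * w2 x - (2 * g (w x) + 2 * \<beta> * ppow q (y (w x))) * w1 x) (at x)"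
      unfolding D_def by (auto intro!: derivative_eq_intros dw1)
    moreover have "ppow q ((w1 x)\<^sup>2) = - (\<bar>w1 x\<bar> powr p * w1 x)"
      using mon(3)[of x] unfolding q_def ppow_square_abs by simp
    hence "2 * w1 x * w2 x - (2 * g (w x) + 2 * \<beta> * ppow q (y (w x))) * w1 x
      = 2 * \<beta> * w1 x * (ppow q ((w1 x)\<^sup>2) - ppow q (y (w x)))"
      unfolding ode by (simp add: algebra_simps)
    ultimately show ?thesis by simp
  qed
  have d2: "((\<lambda>x. (D x)\<^sup>2) has_real_derivative
      2 * D x * (2 * \<beta> * w1 x * (ppow q ((w1 x)\<^sup>2) - ppow q (y (w x))))) (at x)" for x
    using dD by (auto intro!: derivative_eq_intros)
  have "2 * D x * (2 * \<beta> * w1 x * (ppow q ((w1 x)\<^sup>2) - ppow q (y (w x)))) \<le> 0" for x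
  proof -
    have "D x * (ppow q ((w1 x)\<^sup>2) - ppow q (y (w x))) \<ge> 0"
      using ppow_mono[OF q, of "(w1 x)\<^sup>2" "y (w x)"] ppow_mono[OF q, of "y (w x)" "(w1 x)\<^sup>2"]
      by (cases "(w1 x)\<^sup>2 \<le> y (w x)") (auto simp: D_def mult_nonpos_nonpos)
    moreover have "4 * \<beta> * (- w1 x) \<ge> 0" using mon(3)[of x] \<beta> by (intro mult_nonneg_nonneg) auto
    ultimately have "4 * \<beta> * (- w1 x) * (D x * (ppow q ((w1 x)\<^sup>2) - ppow q (y (w x)))) \<ge> 0"
      using mult_nonneg_nonneg by blast
    thus ?thesis by (simp add: algebra_simps)
  qed
  note D2mono = antimono_real_derivative[OF d2 this]
  have yw: "((\<lambda>x. y (w x)) \<longlongrightarrow> y 1) at_bot" "((\<lambda>x. y (w x)) \<longlongrightarrow> y v) at_top"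
    by (rule continuous_on_tendsto_compose[OF shoots_continuous[OF y]]; use mon v1 lim in auto)+
  have "((\<lambda>x. (D x)\<^sup>2) \<longlongrightarrow> (0\<^sup>2 - y 1)\<^sup>2) at_bot"
    unfolding D_def by (intro tendsto_intros lim yw)
  hence "((\<lambda>x. (D x)\<^sup>2) \<longlongrightarrow> 0) at_bot" using shoots_end[OF y] by simp
  \<comment> \<open>\<open>D^2\<close> is nonincreasing and tends to 0 at minus infinity, because
    \<open>w1\<close> and \<open>y 1\<close> vanish there. So it is zero throughout, and the limit
    at plus infinity reads off \<open>y v = 0\<close>.\<close>
  from antimono_le_limit_at_bot[OF D2mono this] have D0: "D x = 0" for x by simp
  have "(D \<longlongrightarrow> 0\<^sup>2 - y v) at_top" unfolding D_def[abs_def] by (intro tendsto_intros lim yw)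
  moreover have "(D \<longlongrightarrow> 0) at_top" using D0 by (simp add: tendsto_const_iff D0[abs_def] fun_eq_iff)
  ultimately have "y v = 0" using tendsto_unique[of at_top D] by force
  thus ?thesis using endval_eq[OF y, of v] v1 \<beta> q by (simp add: g_def q_def)
qed

end

text \<open>The linear bounds make the travel time infinite at both ends.\<close>
lemma heteroclinic_exists:
  fixes r :: "real \<Rightarrow> real"
  assumes ab: "a < b" and rc: "\<And>s. s \<in> {a<..<b} \<Longrightarrow> isCont r s" and rpos: "\<And>s. s \<in> {a<..<b} \<Longrightarrow> r s > 0"
    and C: "C > 0" and ra: "\<And>s. s \<in> {a<..<b} \<Longrightarrow> r s \<le> C * (s - a)" and rb: "\<And>s. s \<in> {a<..<b} \<Longrightarrow> r s \<le> C * (b - s)"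
  shows "\<exists>w. (\<forall>x. w x \<in> {a<..<b} \<and> (w has_real_derivative - r (w x)) (at x)) \<and> (w \<longlongrightarrow> b) at_bot \<and> (w \<longlongrightarrow> a) at_top"
proof -
  have rn: "r s \<noteq> 0" if "s \<in> {a<..<b}" for s using rpos[OF that] by auto
  have "\<exists>X. \<forall>x. ereal a < ereal x \<longrightarrow> ereal x < ereal b \<longrightarrow> (X has_vector_derivative - (1 / r x)) (at x)"
    by (rule einterval_antiderivative) (use ab rc rn in \<open>auto intro!: continuous_intros\<close>)
  \<comment> \<open>\<open>X s\<close> is the position at which the profile takes the value
    \<open>s\<close>, and \<open>w\<close> will be its inverse. Comparison with logarithms at both
    ends shows that \<open>X\<close> takes every real value.\<close>
  then obtain X where X: "\<And>s. s \<in> {a<..<b} \<Longrightarrow> (X has_real_derivative - (1 / r s)) (at s)"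
    by (auto simp: has_real_derivative_iff_has_vector_derivative)
  have XisCont: "isCont X s" if "s \<in> {a<..<b}" for s using DERIV_isCont[OF X[OF that]] .
  have Xdec: "X t < X s" if "s \<in> {a<..<b}" "t \<in> {a<..<b}" "s < t" for s t
  proof (rule DERIV_neg_imp_decreasing[OF that(3)])
    fix x assume "s \<le> x" "x \<le> t"
    hence "x \<in> {a<..<b}" using that by auto
    thus "\<exists>y. (X has_real_derivative y) (at x) \<and> y < 0" using X rpos by (intro exI[of _ "- (1 / r x)"]) auto
  qed
  define c where "c = (a + b) / 2"
  have c: "c \<in> {a<..<b}" using ab by (auto simp: c_def)
  have lowX: "X s \<ge> X c + ln (c - a) / C - ln (s - a) / C" if s: "a < s" "s \<le> c" for s
  proof -
    have "X c + ln (c - a) / C \<le> X s + ln (s - a) / C"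
    proof (rule DERIV_nonpos_imp_nonincreasing[OF s(2)])
      fix x assume "s \<le> x" "x \<le> c"
      hence x: "x \<in> {a<..<b}" using s c by auto
      have "((\<lambda>s. X s + ln (s - a) / C) has_real_derivative - (1 / r x) + (1 / (x - a)) / C) (at x)"
        using x C by (auto intro!: derivative_eq_intros X)
      moreover have "(1 / (x - a)) / C \<le> 1 / r x"
        using ra[OF x] rpos[OF x] x C by (simp add: frac_le mult.commute)
      ultimately show "\<exists>y. ((\<lambda>s. X s + ln (s - a) / C) has_real_derivative y) (at x) \<and> y \<le> 0" by force
    qed
    thus ?thesis by auto
  qed
  have upX: "X s \<le> X c - ln (b - c) / C + ln (b - s) / C" if s: "c \<le> s" "s < b" for s
  proof -
    have "X s - ln (b - s) / C \<le> X c - ln (b - c) / C"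
    proof (rule DERIV_nonpos_imp_nonincreasing[OF s(1)])
      fix x assume "c \<le> x" "x \<le> s"
      hence x: "x \<in> {a<..<b}" using s c by auto
      have "((\<lambda>s. X s - ln (b - s) / C) has_real_derivative - (1 / r x) + (1 / (b - x)) / C) (at x)"
        using x C by (auto intro!: derivative_eq_intros X simp: field_simps)
      moreover have "(1 / (b - x)) / C \<le> 1 / r x"
        using rb[OF x] rpos[OF x] x C by (simp add: frac_le mult.commute)
      ultimately show "\<exists>y. ((\<lambda>s. X s - ln (b - s) / C) has_real_derivative y) (at x) \<and> y \<le> 0" by force
    qed
    thus ?thesis by auto
  qed
  have surj: "\<exists>s\<in>{a<..<b}. X s = x" for x
  proof -
    \<comment> \<open>Small enough for the lower bound \<open>lowX\<close> at \<open>a + e1\<close>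
      to be at least \<open>x\<close>; \<open>e2\<close> is the mirror image at
      \<open>b\<close>.\<close>
    define e1 where "e1 = min ((c - a)) (exp (C * (X c + ln (c - a) / C - x)))"
    have e1: "e1 > 0" "e1 \<le> c - a" using c by (auto simp: e1_def)
    have "ln e1 \<le> ln (exp (C * (X c + ln (c - a) / C - x)))" using e1(1) by (subst ln_le_cancel_iff) (auto simp: e1_def)
    hence "ln e1 \<le> C * (X c + ln (c - a) / C - x)" by simp
    hence "ln e1 / C \<le> X c + ln (c - a) / C - x" by (simp only: pos_divide_le_eq[OF C] mult.commute)
    hence l: "X (a + e1) \<ge> x" using lowX[of "a + e1"] e1 by auto
    define e2 where "e2 = min ((b - c)) (exp (C * (x - X c + ln (b - c) / C)))"
    have e2: "e2 > 0" "e2 \<le> b - c" using c by (auto simp: e2_def)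
    have "ln e2 \<le> ln (exp (C * (x - X c + ln (b - c) / C)))" using e2(1) by (subst ln_le_cancel_iff) (auto simp: e2_def)
    hence "ln e2 \<le> C * (x - X c + ln (b - c) / C)" by simp
    hence "ln e2 / C \<le> x - X c + ln (b - c) / C" by (simp only: pos_divide_le_eq[OF C] mult.commute)
    hence u: "X (b - e2) \<le> x" using upX[of "b - e2"] e2 by auto
    have le: "a + e1 \<le> b - e2" using e1 e2 by auto
    have "continuous_on {a + e1..b - e2} X"
      by (rule continuous_at_imp_continuous_on) (use XisCont e1 e2 in auto)
    from IVT2'[OF u l le this] obtain s where "a + e1 \<le> s" "s \<le> b - e2" "X s = x" by auto
    thus ?thesis using e1 e2 by (intro bexI[of _ s]) auto
  qed
  then obtain w where w: "\<And>x. w x \<in> {a<..<b}" "\<And>x. X (w x) = x" by metis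
  have wX: "w (X s) = s" if "s \<in> {a<..<b}" for s
    using Xdec[of s "w (X s)"] Xdec[of "w (X s)" s] w[of "X s"] that by (cases s "w (X s)" rule: linorder_cases) auto
  have wCont: "isCont w x" for x
  proof -
    define d where "d = min (w x - a) (b - w x) / 2"
    have d: "d > 0" using w(1)[of x] by (auto simp: d_def)
    have dz: "z \<in> {a<..<b}" if "\<bar>z - w x\<bar> \<le> d" for z
    proof -
      have "d \<le> (w x - a) / 2" "d \<le> (b - w x) / 2" by (auto simp: d_def)
      thus ?thesis using that d by (auto simp: abs_le_iff)
    qed
    have "isCont w (X (w x))"
      by (rule isCont_inverse_function[OF d]) (use dz wX XisCont in auto)
    thus ?thesis by (simp add: w)
  qed
  have wd: "(w has_real_derivative - r (w x)) (at x)" for x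
  proof -
    have "(w has_real_derivative inverse (- (1 / r (w x)))) (at x)"
      by (rule DERIV_inverse_function[where f=X and a="x - 1" and b="x + 1"]) (use rn w wCont X[OF w(1)] in auto)
    thus ?thesis by (simp add: field_simps)
  qed
  have wdec: "w y < w x" if "x < y" for x y
    by (rule DERIV_neg_imp_decreasing[OF that]) (use wd rpos w(1) in \<open>metis neg_less_0_iff_less\<close>)
  have "(w \<longlongrightarrow> b) at_bot"
  proof (rule order_tendstoI)
    fix k assume k: "k < b"
    define s where "s = max c k"
    have s: "s \<in> {a<..<b}" using c k by (auto simp: s_def)
    have "w x > k" if "x \<le> X s - 1" for x using wdec[of x "X s"] wX[OF s] that by (auto simp: s_def)
    thus "\<forall>\<^sub>F x in at_bot. k < w x" unfolding eventually_at_bot_linorder by blast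
  next
    fix k assume k: "b < k"
    thus "\<forall>\<^sub>F x in at_bot. w x < k" using w(1) by (intro always_eventually allI) (meson greaterThanLessThan_iff order.strict_trans)
  qed
  moreover have "(w \<longlongrightarrow> a) at_top"
  proof (rule order_tendstoI)
    fix k assume k: "a < k"
    define s where "s = min c k"
    have s: "s \<in> {a<..<b}" using c k by (auto simp: s_def)
    have "w x < k" if "x \<ge> X s + 1" for x using wdec[of "X s" x] wX[OF s] that by (auto simp: s_def)
    thus "\<forall>\<^sub>F x in at_top. w x < k" unfolding eventually_at_top_linorder by blast
  next
    fix k assume k: "k < a"
    thus "\<forall>\<^sub>F x in at_top. k < w x" using w(1) by (intro always_eventually allI) (meson greaterThanLessThan_iff order.strict_trans)
  qed
  ultimately show ?thesis using w(1) wd by blast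
qed

section \<open>From zeros of the shooting value to waves\<close>

lemma shoots_quadratic_bound_right:
  assumes y: "shoots g \<beta> q a y" and \<beta>: "\<beta> \<ge> 0" and k: "k \<ge> 0"
    and g: "\<And>s. s \<in> {a..1} \<Longrightarrow> \<bar>g s\<bar> \<le> k * (1 - s)" and s: "s \<in> {a..1}"
  shows "y s \<le> k * (1 - s)\<^sup>2"
proof -
  have "y s - k * (1 - s)\<^sup>2 \<le> 0"
  proof (rule backward_comparison[where d'="\<lambda>s. (2 * g s + 2 * \<beta> * ppow q (y s)) + 2 * k * (1 - s)", OF _ _ _ s])
    show "((\<lambda>s. y s - k * (1 - s)\<^sup>2) has_real_derivative (2 * g s + 2 * \<beta> * ppow q (y s)) + 2 * k * (1 - s)) (at s within {a..1})"
      if "s \<in> {a..1}" for s using shoots_deriv[OF y that] by (auto intro!: derivative_eq_intros simp: algebra_simps)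
    show "0 \<le> (2 * g s + 2 * \<beta> * ppow q (y s)) + 2 * k * (1 - s)" if "s \<in> {a..1}" for s
      using g[OF that] mult_nonneg_nonneg[OF \<beta> ppow_nonneg[of q "y s"]] by (auto simp: abs_le_iff)
  qed (use shoots_end[OF y] in auto)
  thus ?thesis by auto
qed

text \<open>At the maximum point \<open>t\<close> of \<open>y\<close> on \<open>{a..s}\<close>, with
  \<open>z = sqrt (y t)\<close>, the mean value theorem bounds \<open>z^2\<close> by
  \<open>t - a\<close> times a value of the right-hand side. Since \<open>q \<ge> 1/2\<close>, the
  power is at most \<open>M powr (q - 1/2) * z\<close>; if \<open>z\<close> exceeded
  \<open>C * (t - a)\<close>, the source would be at most \<open>k * z\<close> as well, and
  cancelling \<open>z\<close> gives a contradiction.\<close>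

lemma shoots_quadratic_bound_left:
  assumes y: "shoots g \<beta> q a y" and \<beta>: "\<beta> \<ge> 0" and q: "q \<ge> 1/2" and k: "k \<ge> 0"
    and ya: "y a = 0" and pos: "\<And>s. s \<in> {a..1} \<Longrightarrow> y s \<ge> 0" and M: "\<And>s. s \<in> {a..1} \<Longrightarrow> y s \<le> M"
    and g: "\<And>s. s \<in> {a..1} \<Longrightarrow> \<bar>g s\<bar> \<le> k * (s - a)" and s: "s \<in> {a..1}"
  shows "sqrt (y s) \<le> (2 * k + 2 * \<beta> * M powr (q - 1/2) + 1) * (s - a)"
proof -
  define B where "B = M powr (q - 1/2)"
  define C where "C = 2 * k + 2 * \<beta> * B + 1"
  have B0: "B \<ge> 0" by (simp add: B_def)
  have C1: "C \<ge> 1" using k \<beta> B0 by (simp add: C_def)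
  have "continuous_on {a..s} y" using shoots_continuous[OF y] by (rule continuous_on_subset) (use s in auto)
  then obtain t where t: "t \<in> {a..s}" "\<And>r. r \<in> {a..s} \<Longrightarrow> y r \<le> y t"
    using continuous_attains_sup[of "{a..s}" y] s by auto
  define z where "z = sqrt (y t)"
  have z0: "z \<ge> 0" "z\<^sup>2 = y t" using pos[of t] t(1) s by (auto simp: z_def)
  have "z \<le> C * (t - a)"
  proof (rule ccontr)
    assume nz: "\<not> z \<le> C * (t - a)"
    define x where "x = t - a"
    have x0: "x \<ge> 0" using t by (auto simp: x_def)
    have zC: "z > C * x" using nz by (simp add: x_def)
    have zp: "z > 0" using zC mult_nonneg_nonneg[OF _ x0, of C] C1 by linarith
    have "x \<noteq> 0" using zC z0 ya by (auto simp: x_def z_def)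
    hence at: "a < t" using x0 by (auto simp: x_def)
    obtain \<xi> where \<xi>: "\<xi> \<in> {a<..<t}" "y t - y a = (2 * g \<xi> + 2 * \<beta> * ppow q (y \<xi>)) * (t - a)"
      using mvt_within_Icc[OF at shoots_deriv_within[OF y order.refl]] t s by auto
    have yx: "0 \<le> y \<xi>" "y \<xi> \<le> y t" "y t \<le> M" using pos[of \<xi>] t(2)[of \<xi>] M[of t] \<xi> t s by auto
    have "ppow q (y \<xi>) \<le> y t powr q" using yx q by (simp add: ppow_pos_eq powr_mono2)
    also have "y t powr q = y t powr (q - 1/2) * y t powr (1/2)" by (simp add: powr_add[symmetric])
    also have "\<dots> \<le> B * z" unfolding B_def z_def using yx q
      by (intro mult_mono powr_mono2) (auto simp: powr_half_sqrt)
    finally have pp: "ppow q (y \<xi>) \<le> B * z" .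
    have "g \<xi> \<le> k * (\<xi> - a)" using g[of \<xi>] \<xi> t s by auto
    also have "\<dots> \<le> k * x" using \<xi> k by (intro mult_left_mono) (auto simp: x_def)
    also have "\<dots> \<le> k * z"
      using zC mult_right_mono[OF C1 x0] k by (intro mult_left_mono) auto
    finally have "2 * g \<xi> \<le> 2 * (k * z)" by simp
    moreover have "2 * \<beta> * ppow q (y \<xi>) \<le> 2 * \<beta> * (B * z)" using pp \<beta> by (intro mult_left_mono) auto
    ultimately have "2 * g \<xi> + 2 * \<beta> * ppow q (y \<xi>) \<le> (2 * k + 2 * \<beta> * B) * z" by (simp add: algebra_simps)
    hence "z\<^sup>2 \<le> (2 * k + 2 * \<beta> * B) * z * x"
      using \<xi>(2) ya z0 x0 mult_right_mono[OF _ x0] unfolding x_def by (metis diff_zero)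
    also have "\<dots> \<le> C * z * x" using z0 x0 by (intro mult_right_mono) (auto simp: C_def)
    also have "\<dots> = z * (C * x)" by simp
    also have "\<dots> < z * z" using zC zp by (intro mult_strict_left_mono)
    finally show False by (simp add: power2_eq_square)
  qed
  hence "sqrt (y t) \<le> C * (t - a)" by (simp add: z_def)
  also have "\<dots> \<le> C * (s - a)" using t C1 by (intro mult_left_mono) auto
  finally have "sqrt (y t) \<le> C * (s - a)" .
  moreover have "sqrt (y s) \<le> sqrt (y t)" using t(2)[of s] s by auto
  ultimately show ?thesis unfolding C_def B_def by linarith
qed

context flux begin

lemma gap_linear_bound:
  assumes "v < 1" obtains k where "k \<ge> 0" "\<And>s. s \<in> {v..1} \<Longrightarrow> \<bar>gap F v s\<bar> \<le> k * (1 - s)"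
    "\<And>s. s \<in> {v..1} \<Longrightarrow> \<bar>gap F v s\<bar> \<le> k * (s - v)"
proof -
  have "bounded ((\<lambda>s. F1 s - chord F v) ` {v..1})"
    by (intro compact_imp_bounded compact_continuous_image continuous_intros contF1) auto
  then obtain k where k: "k > 0" "\<And>s. s \<in> {v..1} \<Longrightarrow> \<bar>F1 s - chord F v\<bar> \<le> k"
    by (auto simp: bounded_pos)
  have L: "\<bar>gap F v y - gap F v x\<bar> \<le> k * (y - x)" if xy: "v \<le> x" "x \<le> y" "y \<le> 1" for x y
  proof (cases "x = y")
    case False
    hence "x < y" using xy by auto
    then obtain z where "x < z" "z < y" "gap F v y - gap F v x = (y - x) * (F1 z - chord F v)"
      using MVT2[of x y "gap F v" "\<lambda>s. F1 s - chord F v"] gap_deriv by blast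
    thus ?thesis using k(2)[of z] xy by (auto simp: abs_mult)
  qed auto
  show ?thesis
  proof (rule that[of k])
    show "\<bar>gap F v s\<bar> \<le> k * (1 - s)" if "s \<in> {v..1}" for s using L[of s 1] that by auto
    show "\<bar>gap F v s\<bar> \<le> k * (s - v)" if "s \<in> {v..1}" for s using L[of v s] that assms by auto
  qed (use k in auto)
qed

text \<open>The wave solves \<open>w' = - sqrt (y w)\<close>. Inside the interval \<open>y\<close>
  is positive, since by \<open>shoots_neg\<close> a nonpositive interior value would make
  \<open>y v\<close> negative, and \<open>sqrt y\<close> decays at least linearly at both ends, as
  \<open>heteroclinic_exists\<close> requires.\<close>

lemma dv_zero_imp_profile:
  assumes v: "v \<le> tau" and \<beta>: "\<beta> > 0" and p: "p \<ge> 0" and dv0: "dv \<beta> ((p + 1) / 2) v = 0"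
  shows "\<exists>w w1 w2. profile (gap F v) \<beta> p 1 v w w1 w2"
proof -
  define g where "g = gap F v"
  define q where "q = (p + 1) / 2"
  have q: "q > 0" "q \<ge> 1/2" using p by (auto simp: q_def)
  have v1: "v < 1" using v tau_props by auto
  obtain y where y: "shoots g \<beta> q v y" unfolding g_def using shoots_gap_exists[of v \<beta> q v] v1 \<beta> q by fastforce
  have yv: "y v = 0" using endval_eq[OF y, of v] dv0 v1 \<beta> q by (simp add: g_def q_def)
  obtain m where m: "v \<le> m" "m \<le> 1" "\<And>s. s \<in> {v<..<m} \<Longrightarrow> g s > 0" "\<And>s. s \<in> {m<..<1} \<Longrightarrow> g s < 0"
    unfolding g_def by (rule gap_sign[OF v]) blast
  have ypos: "y s > 0" if "s \<in> {v<..<1}" for s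
    using shoots_neg[OF y less_imp_le[OF \<beta>] m, of s] that yv by force
  have ynn: "y s \<ge> 0" if "s \<in> {v..1}" for s
    using ypos[of s] that yv shoots_end[OF y] by (cases "s = v \<or> s = 1") auto
  obtain k where k: "k \<ge> 0" "\<And>s. s \<in> {v..1} \<Longrightarrow> \<bar>g s\<bar> \<le> k * (1 - s)" "\<And>s. s \<in> {v..1} \<Longrightarrow> \<bar>g s\<bar> \<le> k * (s - v)"
    unfolding g_def by (rule gap_linear_bound[OF v1]) blast
  have yr: "y s \<le> k * (1 - s)\<^sup>2" if "s \<in> {v..1}" for s
    by (rule shoots_quadratic_bound_right[OF y _ k(1,2) that]) (use \<beta> in auto)
  define M where "M = k * (1 - v)\<^sup>2"
  have yM: "y s \<le> M" if "s \<in> {v..1}" for s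
  proof -
    have "k * (1 - s)\<^sup>2 \<le> M" unfolding M_def using that k v1 by (intro mult_left_mono power_mono) auto
    thus ?thesis using yr[OF that] by auto
  qed
  define C where "C = (2 * k + 2 * \<beta> * M powr (q - 1/2) + 1) + sqrt k"
  have yl: "sqrt (y s) \<le> C * (s - v)" if "s \<in> {v..1}" for s
  proof -
    have "sqrt (y s) \<le> (2 * k + 2 * \<beta> * M powr (q - 1/2) + 1) * (s - v)"
      by (rule shoots_quadratic_bound_left[OF y _ q(2) k(1) yv ynn yM k(3) that]) (use \<beta> in auto)
    also have "\<dots> \<le> C * (s - v)" unfolding C_def using that k by (intro mult_right_mono) auto
    finally show ?thesis .
  qed
  have yr': "sqrt (y s) \<le> C * (1 - s)" if "s \<in> {v..1}" for s
  proof -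
    have "sqrt (y s) \<le> sqrt (k * (1 - s)\<^sup>2)" using yr[OF that] by (rule real_sqrt_le_mono)
    also have "\<dots> = sqrt k * (1 - s)" using that by (simp add: real_sqrt_mult)
    also have "\<dots> \<le> C * (1 - s)" using that k \<beta> unfolding C_def by (intro mult_right_mono) auto
    finally show ?thesis .
  qed
  have C: "C > 0" using k \<beta> unfolding C_def by (smt (verit) mult_nonneg_nonneg powr_ge_zero real_sqrt_ge_zero)
  have yd: "(y has_real_derivative 2 * g s + 2 * \<beta> * ppow q (y s)) (at s)" if "s \<in> {v<..<1}" for s
    using shoots_deriv_at[OF y] that by auto
  obtain w where w: "\<And>x. w x \<in> {v<..<1}" "\<And>x. (w has_real_derivative - sqrt (y (w x))) (at x)"
    "(w \<longlongrightarrow> 1) at_bot" "(w \<longlongrightarrow> v) at_top"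
  proof -
    have "\<exists>w. (\<forall>x. w x \<in> {v<..<1} \<and> (w has_real_derivative - sqrt (y (w x))) (at x)) \<and> (w \<longlongrightarrow> 1) at_bot \<and> (w \<longlongrightarrow> v) at_top"
    proof (rule heteroclinic_exists[OF v1 _ _ C])
      show "isCont (\<lambda>s. sqrt (y s)) s" if "s \<in> {v<..<1}" for s
        using DERIV_isCont[OF yd[OF that]] by (intro continuous_intros)
    qed (use ypos yl yr' in auto)
    thus ?thesis using that by blast
  qed
  define w1 where "w1 x = - sqrt (y (w x))" for x
  define w2 where "w2 x = g (w x) + \<beta> * ppow q (y (w x))" for x
  have wc: "continuous_on UNIV w" by (rule continuous_at_imp_continuous_on) (use w(2) DERIV_isCont in fast)
  have dw1: "(w1 has_real_derivative w2 x) (at x)" for x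
  proof -
    have yp: "y (w x) > 0" using ypos w(1) by auto
    have "((\<lambda>x. y (w x)) has_real_derivative (2 * g (w x) + 2 * \<beta> * ppow q (y (w x))) * (- sqrt (y (w x)))) (at x)"
      by (rule DERIV_chain2[OF yd[OF w(1)] w(2)])
    hence "(w1 has_real_derivative - ((2 * g (w x) + 2 * \<beta> * ppow q (y (w x))) * (- sqrt (y (w x))) * (inverse (sqrt (y (w x))) / 2))) (at x)"
      unfolding w1_def[abs_def] using yp by (intro DERIV_minus) (auto intro!: derivative_eq_intros)
    moreover have "- ((2 * g (w x) + 2 * \<beta> * ppow q (y (w x))) * (- sqrt (y (w x))) * (inverse (sqrt (y (w x))) / 2)) = w2 x"
      using yp by (simp add: w2_def field_simps)
    ultimately show ?thesis by simp
  qed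
  have yc: "continuous_on {v..1} y" by (rule shoots_continuous[OF y])
  have ywc: "continuous_on UNIV (\<lambda>x. y (w x))"
    by (rule continuous_on_compose2[OF yc wc]) (use w(1) in \<open>auto simp: less_imp_le\<close>)
  have gwc: "continuous_on UNIV (\<lambda>x. g (w x))"
    unfolding g_def by (rule continuous_on_compose2[OF gap_cont[of UNIV] wc]) auto
  have w2c: "continuous_on UNIV w2" unfolding w2_def[abs_def] by (intro continuous_intros ywc gwc q)
  have wm: "w x \<in> {v..1}" for x using w(1)[of x] by auto
  have ylim: "((\<lambda>x. y (w x)) \<longlongrightarrow> y 1) at_bot" "((\<lambda>x. y (w x)) \<longlongrightarrow> y v) at_top"
    by (rule continuous_on_tendsto_compose[OF yc]; use wm v1 w in auto)+
  have "(w1 \<longlongrightarrow> - sqrt (y 1)) at_bot" "(w1 \<longlongrightarrow> - sqrt (y v)) at_top"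
    unfolding w1_def[abs_def] by (intro tendsto_intros ylim)+
  hence w1lim: "(w1 \<longlongrightarrow> 0) at_bot" "(w1 \<longlongrightarrow> 0) at_top" using yv shoots_end[OF y] by simp_all
  have "g (w x) = \<beta> * (\<bar>w1 x\<bar> powr p) * w1 x + w2 x" for x
  proof -
    have "y (w x) = (w1 x)\<^sup>2" using ynn[OF wm] by (simp add: w1_def)
    hence "ppow q (y (w x)) = \<bar>w1 x\<bar> powr p * \<bar>w1 x\<bar>" by (simp only: q_def ppow_square_abs)
    also have "\<bar>w1 x\<bar> = - w1 x" using ynn[OF wm] by (simp add: w1_def)
    finally have "ppow q (y (w x)) = (- w1 x) powr p * (- w1 x)" by simp
    moreover have "\<bar>w1 x\<bar> = - w1 x" using ynn[OF wm] by (simp add: w1_def)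
    ultimately show ?thesis by (simp add: w2_def)
  qed
  hence "profile g \<beta> p 1 v w w1 w2" unfolding profile_def
    using w(2,3,4) dw1 w2c w1lim by (auto simp: w1_def)
  thus ?thesis unfolding g_def by blast
qed

end

section \<open>The threshold for a fixed flux\<close>

lemma ppow_scale: "m \<ge> 0 \<Longrightarrow> ppow q (m * y) = m powr q * ppow q y"
proof -
  assume m: "m \<ge> 0"
  have "max 0 (m * y) = m * max 0 y" using m by (simp add: max_def zero_le_mult_iff mult_le_0_iff)
  thus ?thesis using m by (simp add: ppow_def powr_mult)
qed

lemma endval_uniform_limit:
  fixes g :: "'x \<Rightarrow> real \<Rightarrow> real"
  assumes a: "a \<le> 1" and q: "q > 0" and g0: "continuous_on {a..1} g0"
    and g: "\<And>x. continuous_on {a..1} (g x)" and lim: "uniform_limit {a..1} g g0 Fl"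
    and b: "(b \<longlongrightarrow> b0) Fl" "\<And>x. b x \<ge> 0" "b0 \<ge> 0"
  shows "uniform_limit {a..1} (\<lambda>x. endval (g x) (b x) q) (endval g0 b0 q) Fl"
proof (rule uniform_limitI)
  fix e :: real assume e: "e > 0"
  have "\<forall>x. \<exists>y. shoots (g x) (b x) q a y" using shoots_exists[OF a g b(2) q] by blast
  then obtain y where y: "\<And>x. shoots (g x) (b x) q a (y x)" by metis
  obtain y0 where y0: "shoots g0 b0 q a y0" using shoots_exists[OF a g0 b(3) q] by blast
  have "bounded (g0 ` {a..1})" by (intro compact_imp_bounded compact_continuous_image g0) auto
  then obtain k where k: "k > 0" "\<And>s. s \<in> {a..1} \<Longrightarrow> \<bar>g0 s\<bar> \<le> k" by (auto simp: bounded_pos)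
  \<comment> \<open>A common bound for the power along \<open>y0\<close> and all nearby solutions:
    changing the viscosity by less than \<open>d\<close> changes the right-hand side by at most
    \<open>d * M\<close>, and \<open>d\<close> keeps the total error
    \<open>2 * (d + d * M) * (1 - a)\<close> below \<open>e\<close>.\<close>
  define M where "M = ppow q (2 * (k + 1) * (1 - a))"
  define d where "d = e / (2 * (1 - a) + 1) / (2 + M)"
  have M0: "M \<ge> 0" by (simp add: M_def)
  have d0: "d > 0" using e a M0 unfolding d_def by (intro divide_pos_pos) auto
  have "\<forall>\<^sub>F x in Fl. \<forall>s\<in>{a..1}. dist (g x s) (g0 s) < min d 1" using uniform_limitD[OF lim, of "min d 1"] d0 by simp
  moreover have "\<forall>\<^sub>F x in Fl. dist (b x) b0 < d" using tendstoD[OF b(1) d0] .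
  ultimately show "\<forall>\<^sub>F x in Fl. \<forall>s\<in>{a..1}. dist (endval (g x) (b x) q s) (endval g0 b0 q s) < e"
  proof eventually_elim
    case (elim x)
    have gx: "\<bar>g x s - g0 s\<bar> < d" "\<bar>g x s - g0 s\<bar> < 1" if "s \<in> {a..1}" for s
      using bspec[OF elim(1) that] by (auto simp: dist_real_def)
    have bd: "ppow q (z s) \<le> M" if "shoots h c q a z" "c \<ge> 0" "\<And>s. s \<in> {a..1} \<Longrightarrow> h s \<ge> - (k + 1)" "s \<in> {a..1}" for z h c s
    proof -
      have "z s \<le> 2 * (k + 1) * (1 - s)" using shoots_upper[OF that(1,2) _ that(3,4)] k by auto
      also have "\<dots> \<le> 2 * (k + 1) * (1 - a)" using that(4) k by (intro mult_left_mono) auto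
      finally show ?thesis unfolding M_def by (rule ppow_mono[OF q])
    qed
    have m0: "ppow q (y0 s) \<le> M" if "s \<in> {a..1}" for s
    proof (rule bd[OF y0 b(3) _ that])
      fix s assume "s \<in> {a..1}"
      thus "g0 s \<ge> - (k + 1)" using k(2)[of s] by linarith
    qed
    have mx: "ppow q (y x s) \<le> M" if "s \<in> {a..1}" for s
    proof (rule bd[OF y b(2) _ that])
      fix s assume "s \<in> {a..1}"
      thus "g x s \<ge> - (k + 1)" using k(2)[of s] gx(2)[of s] by linarith
    qed
    define E where "E = d + d * M"
    have E0: "E \<ge> 0" using d0 M0 by (simp add: E_def)
    have bM: "\<bar>(b x - b0) * P\<bar> \<le> d * M" if "0 \<le> P" "P \<le> M" for P
      using elim(2) that by (auto simp: abs_mult dist_real_def intro!: mult_mono)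
    have E2: "2 * E * (1 - a) < e"
    proof -
      have "2 * E * (1 - a) = (1 + M) * d * (2 * (1 - a))" by (simp add: E_def algebra_simps)
      also have "\<dots> \<le> (2 + M) * d * (2 * (1 - a))" using d0 M0 a by (intro mult_right_mono) auto
      also have "\<dots> < (2 + M) * d * (2 * (1 - a) + 1)" using d0 M0 a by (intro mult_strict_left_mono) auto
      also have "\<dots> = e" using a M0 by (simp add: d_def)
      finally show ?thesis .
    qed
    show ?case
    proof
      fix s assume s: "s \<in> {a..1}"
      have "y x s \<le> y0 s + 2 * E * (1 - s)"
      proof (rule shoots_perturb[OF y y0 b(2) q E0 _ s])
        fix r assume r: "r \<in> {a..1}"
        show "g0 r + b0 * ppow q (y0 r) - E \<le> g x r + b x * ppow q (y0 r)"
          using gx(1)[OF r] bM[OF ppow_nonneg m0[OF r]] unfolding E_def by (simp add: algebra_simps abs_le_iff abs_less_iff)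
      qed
      moreover have "y0 s \<le> y x s + 2 * E * (1 - s)"
      proof (rule shoots_perturb[OF y0 y b(3) q E0 _ s])
        fix r assume r: "r \<in> {a..1}"
        show "g x r + b x * ppow q (y x r) - E \<le> g0 r + b0 * ppow q (y x r)"
          using gx(1)[OF r] bM[OF ppow_nonneg mx[OF r]] unfolding E_def by (simp add: algebra_simps abs_le_iff abs_less_iff)
      qed
      moreover have "2 * E * (1 - s) \<le> 2 * E * (1 - a)" using s E0 by (intro mult_left_mono) auto
      ultimately have "\<bar>y x s - y0 s\<bar> < e" using E2 by linarith
      thus "dist (endval (g x) (b x) q s) (endval g0 b0 q s) < e"
        using endval_eq[OF y, of s x] endval_eq[OF y0, of s] s b q by (simp add: dist_real_def)
    qed
  qed
qed

lemma endval_continuous: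
  assumes a: "a \<le> 1" and q: "q > 0" and g0: "continuous_on {a..1} g0" and b: "b0 \<ge> 0"
  shows "continuous_on {a..1} (endval g0 b0 q)"
proof -
  obtain y0 where y0: "shoots g0 b0 q a y0" using shoots_exists[OF a g0 b q] by blast
  show ?thesis by (rule continuous_on_eq[OF shoots_continuous[OF y0]]) (use endval_eq[OF y0] b q in auto)
qed

lemma uniform_limit_tendsto_moving:
  fixes f :: "'x \<Rightarrow> real \<Rightarrow> real"
  assumes "uniform_limit S f l Fl" "continuous_on S l" "(c \<longlongrightarrow> c0) Fl" "\<forall>\<^sub>F x in Fl. c x \<in> S" "c0 \<in> S"
  shows "((\<lambda>x. f x (c x)) \<longlongrightarrow> l c0) Fl"
proof -
  have t0: "((\<lambda>x. l (c x)) \<longlongrightarrow> l c0) Fl"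
    by (rule continuous_on_tendsto_compose[OF assms(2,3,5,4)])
  have "((\<lambda>x. f x (c x) - l (c x)) \<longlongrightarrow> 0) Fl"
  proof (rule tendstoI)
    fix e :: real assume "e > 0"
    from uniform_limitD[OF assms(1) this] assms(4)
    show "\<forall>\<^sub>F x in Fl. dist (f x (c x) - l (c x)) 0 < e"
      by eventually_elim (auto simp: dist_real_def)
  qed
  from tendsto_add[OF this t0] show ?thesis by simp
qed

lemma endval_tendsto:
  fixes g :: "'x \<Rightarrow> real \<Rightarrow> real"
  assumes a: "a \<le> 1" and q: "q > 0" and g0: "continuous_on {a..1} g0"
    and g: "\<And>x. continuous_on {a..1} (g x)" and lim: "uniform_limit {a..1} g g0 Fl"
    and b: "(b \<longlongrightarrow> b0) Fl" "\<And>x. b x \<ge> 0" "b0 \<ge> 0"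
    and c: "(c \<longlongrightarrow> c0) Fl" "\<forall>\<^sub>F x in Fl. c x \<in> {a..1}" "c0 \<in> {a..1}"
  shows "((\<lambda>x. endval (g x) (b x) q (c x)) \<longlongrightarrow> endval g0 b0 q c0) Fl"
  by (rule uniform_limit_tendsto_moving[OF endval_uniform_limit[OF a q g0 g lim b] endval_continuous[OF a q g0 b(3)] c])

text \<open>An exact solution vanishing at \<^term>\<open>a\<close> is at most of order \<^term>\<open>(s - a)^4\<close>, too flat for the
  power term to balance a quadratic source.\<close>
lemma shoots_three_quarters_not_zero:
  assumes y: "shoots g \<beta> (3/4) a y" and \<beta>: "\<beta> \<ge> 0" and b: "a < b" "b \<le> 1" and k: "k > 0"
    and g: "\<And>s. s \<in> {a..b} \<Longrightarrow> g s \<le> - k * (s - a)\<^sup>2" and pos: "\<And>s. s \<in> {a<..<b} \<Longrightarrow> y s > 0"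
  shows "y a \<noteq> 0"
proof
  assume ya: "y a = 0"
  have flat: "ppow (3/4) (y s) \<le> (2 * \<beta> * (s - a)) ^ 3" if s: "s \<in> {a<..<b}" for s
  proof -
    have "continuous_on {a..s} y" using shoots_continuous[OF y] by (rule continuous_on_subset) (use s b in auto)
    then obtain t where t: "t \<in> {a..s}" "\<And>r. r \<in> {a..s} \<Longrightarrow> y r \<le> y t"
      using continuous_attains_sup[of "{a..s}" y] s by auto
    have yt: "y t > 0" using t(2)[of s] pos[OF s] s by auto
    hence at: "a < t" using ya t by (cases "t = a") auto
    obtain x where x: "x \<in> {a<..<t}" "y t - y a = (2 * g x + 2 * \<beta> * ppow (3/4) (y x)) * (t - a)"
      using mvt_within_Icc[OF at shoots_deriv_within[OF y order.refl, of t]] t s b by auto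
    \<comment> \<open>With the fourth root \<open>r\<close> of the maximum, the mean value estimate
      reads \<open>r^4 \<le> 2 * \<beta> * r^3 * (t - a)\<close>, so \<open>r\<close> grows at most
      linearly.\<close>
    define r where "r = y t powr (1/4)"
    have r: "r > 0" using yt by (simp add: r_def)
    have rn: "r ^ n = y t powr (real n * (1/4))" for n
      using yt r by (simp add: r_def powr_powr mult.commute flip: powr_realpow)
    have r4: "r ^ 4 = y t" and r3: "y t powr (3/4) = r ^ 3" using rn[of 4] rn[of 3] yt by simp_all
    have "ppow (3/4) (y x) \<le> ppow (3/4) (y t)" using x t by (intro ppow_mono) auto
    hence p: "ppow (3/4) (y x) \<le> r ^ 3" using r3 yt by (simp add: ppow_pos_eq)
    have "x \<in> {a..b}" using x t s by auto
    moreover have "k * (x - a)\<^sup>2 \<ge> 0" using k by simp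
    ultimately have "g x \<le> 0" using g[of x] by simp
    hence "2 * g x + 2 * \<beta> * ppow (3/4) (y x) \<le> 2 * \<beta> * r ^ 3" using mult_left_mono[OF p, of "2 * \<beta>"] \<beta> by auto
    hence "r ^ 4 \<le> 2 * \<beta> * r ^ 3 * (t - a)" unfolding r4 using x(2) ya at mult_right_mono[of _ _ "t - a"] by (metis diff_gt_0_iff_gt diff_zero less_imp_le)
    hence "r ^ 3 * r \<le> r ^ 3 * (2 * \<beta> * (t - a))" by (simp add: power_numeral_reduce algebra_simps)
    hence "r \<le> 2 * \<beta> * (t - a)" using r by simp
    also have "\<dots> \<le> 2 * \<beta> * (s - a)" using t \<beta> by (intro mult_left_mono) auto
    finally have "r ^ 3 \<le> (2 * \<beta> * (s - a)) ^ 3" using r by (intro power_mono) auto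
    moreover have "ppow (3/4) (y s) \<le> r ^ 3" using ppow_mono[of "3/4" "y s" "y t"] t(2)[of s] s r3 yt by (simp add: ppow_pos_eq)
    ultimately show ?thesis by linarith
  qed
  \<comment> \<open>For \<open>h < c - a\<close> the power term is at most
    \<open>16 * \<beta>^4 * h^3\<close>, which the choice of \<open>c\<close> keeps below
    \<open>k * h^2\<close>, half of the source bound. The \<open>+ 1\<close> avoids division by zero
    for \<open>\<beta> = 0\<close>.\<close>
  define c where "c = min ((a + b) / 2) (a + k / (16 * \<beta> ^ 4 + 1))"
  have B: "16 * \<beta> ^ 4 + 1 > 0" using zero_le_power[OF \<beta>, of 4] by linarith
  have "k / (16 * \<beta> ^ 4 + 1) > 0" using k B by simp
  hence "a < c" using b by (simp add: c_def)
  moreover have "c \<le> (a + b) / 2" unfolding c_def by (rule min.cobounded1)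
  ultimately have ac: "a < c" "c < b" using b by auto
  obtain x where x: "x \<in> {a<..<c}" "y c - y a = (2 * g x + 2 * \<beta> * ppow (3/4) (y x)) * (c - a)"
    using mvt_within_Icc[OF ac(1) shoots_deriv_within[OF y order.refl, of c]] ac b by auto
  define h where "h = x - a"
  have h: "h > 0" "h < k / (16 * \<beta> ^ 4 + 1)" using x by (auto simp: h_def c_def)
  have "2 * \<beta> * ppow (3/4) (y x) \<le> 2 * \<beta> * (2 * \<beta> * h) ^ 3"
    using flat[of x] x ac \<beta> unfolding h_def by (intro mult_left_mono) auto
  also have "\<dots> = (16 * \<beta> ^ 4) * h * h\<^sup>2" by (simp add: power_mult_distrib eval_nat_numeral algebra_simps)
  also have "\<dots> \<le> k * h\<^sup>2"
  proof (intro mult_right_mono)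
    have "(16 * \<beta> ^ 4) * h \<le> (16 * \<beta> ^ 4 + 1) * h" using h by (intro mult_right_mono) auto
    also have "\<dots> \<le> k" using h(2) B by (simp add: field_simps)
    finally show "(16 * \<beta> ^ 4) * h \<le> k" .
  qed auto
  finally have "2 * g x + 2 * \<beta> * ppow (3/4) (y x) \<le> - k * h\<^sup>2" using g[of x] x ac by (auto simp: h_def)
  also have "- k * h\<^sup>2 < 0" using k h by simp
  finally have "y c - y a < 0" using x(2) ac by (simp add: mult_neg_pos)
  thus False using pos[of c] ac ya by auto
qed

section \<open>The threshold viscosity at the tangent point\<close>

context flux begin

lemma dv_antimono_beta:
  assumes v: "v < 1" and b: "0 \<le> \<beta>1" "\<beta>1 \<le> \<beta>2" and q: "q > 0"
  shows "dv \<beta>2 q v \<le> dv \<beta>1 q v"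
proof -
  obtain y1 where y1: "shoots (gap F v) \<beta>1 q v y1" using shoots_gap_exists[of v \<beta>1 q v] v b q by fastforce
  obtain y2 where y2: "shoots (gap F v) \<beta>2 q v y2" using shoots_gap_exists[of v \<beta>2 q v] v b q by fastforce
  have "y2 v \<le> y1 v + 2 * 0 * (1 - v)"
    by (rule shoots_perturb[OF y2 y1 _ q]) (use b v mult_right_mono[OF b(2) ppow_nonneg] in auto)
  thus ?thesis using endval_eq[OF y1, of v] endval_eq[OF y2, of v] v b q by auto
qed

lemma dv_continuous_beta:
  assumes v: "v < 1" and b: "(b \<longlongrightarrow> b0) Fl" "\<And>x. b x \<ge> 0" "b0 \<ge> 0" and q: "q > 0"
  shows "((\<lambda>x. dv (b x) q v) \<longlongrightarrow> dv b0 q v) Fl"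
  by (rule endval_tendsto[OF _ q gap_cont gap_cont uniform_limit_const b tendsto_const, where a=v]) (use v in auto)

text \<open>A large viscosity keeps \<open>y\<close> below the constant \<open>C\<close> at
  \<open>b\<close>. The gap of at least \<open>\<eta>\<close> on \<open>[c, b]\<close> then lowers
  \<open>y\<close> by at least \<open>C\<close>, so it is nonpositive at \<open>c\<close> and
  \<open>shoots_neg\<close> applies. The explicit constants make the bound uniform over nearby
  fluxes.\<close>

lemma dv_neg_large_beta:
  assumes v: "v \<le> tau" "v < c" "c < b" "b \<le> 1" and \<beta>: "\<beta> \<ge> 0" and q: "q > 0" and k: "\<And>s. s \<in> {v..1} \<Longrightarrow> gap F v s \<ge> - k"
    and \<eta>: "\<And>s. s \<in> {c..b} \<Longrightarrow> gap F v s \<ge> \<eta>" and C: "C \<ge> 0" "k \<le> \<beta> * C powr q" "C \<le> 2 * \<eta> * (b - c)"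
  shows "dv \<beta> q v < 0"
proof -
  obtain y where y: "shoots (gap F v) \<beta> q v y" using shoots_gap_exists[of v \<beta> q v] v \<beta> q by fastforce
  have yb: "y b \<le> C" by (rule shoots_le_const[OF y \<beta> q C(1) k C(2)]) (use v in auto)
  obtain x where x: "x \<in> {c<..<b}" "y b - y c = (2 * gap F v x + 2 * \<beta> * ppow q (y x)) * (b - c)"
    using mvt_within_Icc[OF v(3) shoots_deriv_within[OF y, of c b]] v by auto
  have "2 * gap F v x + 2 * \<beta> * ppow q (y x) \<ge> 2 * \<eta>"
    using \<eta>[of x] x(1) mult_nonneg_nonneg[OF \<beta> ppow_nonneg[of q "y x"]] by auto
  hence "y b - y c \<ge> 2 * \<eta> * (b - c)" unfolding x(2) using v by (intro mult_right_mono) auto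
  hence yc: "y c \<le> 0" using yb C by auto
  obtain m where m: "v \<le> m" "m \<le> 1" "\<And>s. s \<in> {v<..<m} \<Longrightarrow> gap F v s > 0" "\<And>s. s \<in> {m<..<1} \<Longrightarrow> gap F v s < 0"
    by (rule gap_sign[OF v(1)]) blast
  have "y v < 0" by (rule shoots_neg[OF y \<beta> m v(2) _ _ yc]) (use v in auto)
  thus ?thesis using endval_eq[OF y, of v] v \<beta> q by auto
qed

lemma chord_tau: "chord F tau = F1 tau"
  using chord_eq[of tau] tau_props by auto

lemma gap_tau_neg: "s \<in> {tau<..<1} \<Longrightarrow> gap F tau s < 0"
  using gap_sign[of tau] by blast

lemma dv_0_tau_pos: assumes q: "q > 0" shows "dv 0 q tau > 0"
proof -
  have t1: "tau < 1" using tau_props by auto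
  obtain y where y: "shoots (gap F tau) 0 q tau y" using shoots_gap_exists[of tau 0 q tau] t1 q by fastforce
  obtain x where x: "x \<in> {tau<..<1}" "y 1 - y tau = (2 * gap F tau x + 2 * 0 * ppow q (y x)) * (1 - tau)"
    using mvt_within_Icc[OF t1 shoots_deriv[OF y]] by auto
  have "y 1 - y tau < 0" unfolding x(2) using gap_tau_neg[OF x(1)] t1 by (intro mult_neg_pos) auto
  thus ?thesis using shoots_end[OF y] endval_eq[OF y, of tau] t1 q by auto
qed

text \<open>Tangency makes the zero of the gap at \<open>tau\<close> double, so two mean value steps
  bound it by the maximum of \<open>F2\<close>.\<close>

lemma gap_tau_lower: obtains K where "K \<ge> 0" "\<And>s. s \<in> {tau..1} \<Longrightarrow> gap F tau s \<ge> - K * (s - tau)\<^sup>2"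
proof -
  have "bounded (F2 ` {tau..1})"
    by (intro compact_imp_bounded compact_continuous_image continuous_on_subset[OF contF2]) auto
  then obtain K where K: "K > 0" "\<And>s. s \<in> {tau..1} \<Longrightarrow> \<bar>F2 s\<bar> \<le> K" by (auto simp: bounded_pos)
  have "gap F tau s \<ge> - K * (s - tau)\<^sup>2" if s: "s \<in> {tau..1}" for s
  proof (cases "s = tau")
    case False
    hence ts: "tau < s" using s by auto
    obtain z where z: "tau < z" "z < s" "gap F tau s - gap F tau tau = (s - tau) * (F1 z - chord F tau)"
      using MVT2[OF ts, of "gap F tau" "\<lambda>s. F1 s - chord F tau"] gap_deriv by blast
    obtain x where x: "tau < x" "x < z" "F1 z - F1 tau = (z - tau) * F2 x" using MVT2[OF z(1), of F1 F2] dF1 by blast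
    have "(z - tau) * F2 x \<ge> (z - tau) * (- K)" using K(2)[of x] x z s by (intro mult_left_mono) (auto simp: abs_le_iff)
    moreover have "(z - tau) * K \<le> (s - tau) * K" using z K by (intro mult_right_mono) auto
    moreover have "- (s - tau) * K = - ((s - tau) * K)" by (simp add: algebra_simps)
    ultimately have "F1 z - F1 tau \<ge> - (s - tau) * K" unfolding x(3) by linarith
    hence "(s - tau) * (F1 z - F1 tau) \<ge> (s - tau) * (- (s - tau) * K)" using ts by (intro mult_left_mono) auto
    thus ?thesis using z(3) chord_tau tau_props by (simp add: power2_eq_square algebra_simps)
  qed (use tau_props in auto)
  thus ?thesis using that[of K] K by auto
qed

text \<open>\<^term>\<open>(s - tau)^3\<close> is a supersolution for large \<^term>\<open>\<beta>\<close>, because \<^term>\<open>3 * q \<le> (2::real)\<close>.\<close>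
lemma dv_tau_nonpos_ex:
  assumes q: "0 < q" "q \<le> 2/3" shows "\<exists>\<beta>\<ge>0. dv \<beta> q tau \<le> 0"
proof -
  obtain K where K: "K \<ge> 0" "\<And>s. s \<in> {tau..1} \<Longrightarrow> gap F tau s \<ge> - K * (s - tau)\<^sup>2" by (rule gap_tau_lower) blast
  define L where "L = 1 - tau"
  have L: "L > 0" using tau_props by (auto simp: L_def)
  \<comment> \<open>Chosen so that \<open>2 * \<beta> * L powr (3 * q - 2) = 3 + 2 * K\<close>: the
    3 pays for the slope of the cube and \<open>2 * K\<close> for the source. As
    \<open>3 * q - 2 \<le> 0\<close>, the worst case is \<open>x = L\<close>.\<close>
  define \<beta> where "\<beta> = (3 + 2 * K) / (2 * L powr (3 * q - 2))"
  have \<beta>: "\<beta> \<ge> 0" using K L by (auto simp: \<beta>_def)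
  have t1: "tau < 1" using tau_props by auto
  obtain y where y: "shoots (gap F tau) \<beta> q tau y" using shoots_gap_exists[of tau \<beta> q tau] t1 q \<beta> by fastforce
  have "y tau \<le> (tau - tau) ^ 3"
  proof (rule shoots_le_supersolution[OF y \<beta> q(1) order.refl, where z="\<lambda>s. (s - tau)^3" and z'="\<lambda>s. 3 * (s - tau)^2"])
    show "((\<lambda>s. (s - tau)^3) has_real_derivative 3 * (s - tau)^2) (at s within {tau..1})" for s
      by (auto intro!: derivative_eq_intros)
    show "3 * (s - tau)^2 \<le> 2 * gap F tau s + 2 * \<beta> * ppow q ((s - tau)^3)" if s: "s \<in> {tau..1}" for s
    proof (cases "s = tau")
      case False
      define x where "x = s - tau"
      have x: "x > 0" "x \<le> L" using s False by (auto simp: x_def L_def)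
      have "ppow q (x^3) = x powr (3 * q)" using x by (simp add: ppow_pos_eq powr_powr flip: powr_numeral)
      also have "\<dots> = x powr (3 * q - 2) * x powr 2" by (simp add: powr_add[symmetric])
      also have "x powr 2 = x^2" using x by (simp add: powr_numeral)
      finally have e: "ppow q (x^3) = x powr (3 * q - 2) * x^2" .
      have "L powr (3 * q - 2) \<le> x powr (3 * q - 2)" using x q by (intro powr_mono2') auto
      hence "2 * \<beta> * (L powr (3 * q - 2) * x^2) \<le> 2 * \<beta> * ppow q (x^3)"
        unfolding e using \<beta> by (intro mult_left_mono mult_right_mono) auto
      moreover have "2 * \<beta> * (L powr (3 * q - 2) * x^2) = (3 + 2 * K) * x^2" using L by (simp add: \<beta>_def)
      ultimately show ?thesis using K(2)[OF s] by (simp add: x_def algebra_simps)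
    qed (use tau_props in auto)
  qed (use t1 shoots_end[OF y] in auto)
  hence "y tau \<le> 0" by simp
  thus ?thesis using endval_eq[OF y, of tau] t1 q \<beta> by (intro exI[of _ \<beta>]) auto
qed

text \<open>For \<open>0 < q \<le> 2/3\<close> the set is a closed half line
  (\<open>thr_le_iff\<close>). As \<open>dv \<beta> q tau\<close> is never negative, membership
  means that it vanishes, that is, \<open>kappa \<beta> q = tau\<close>.\<close>

definition thr :: "real \<Rightarrow> real" where "thr q = Inf {\<beta>. \<beta> \<ge> 0 \<and> dv \<beta> q tau \<le> 0}"

context fixes q :: real assumes q: "0 < q" "q \<le> 2/3"
begin

lemma thr_nonneg: "thr q \<ge> 0"
  unfolding thr_def using dv_tau_nonpos_ex[OF q] by (intro cInf_greatest) auto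

text \<open>Monotonicity in \<open>\<beta>\<close> puts everything above the infimum into the set,
  and continuity in \<open>\<beta>\<close> adds the infimum itself.\<close>

lemma thr_le_iff: assumes "\<beta> \<ge> 0" shows "thr q \<le> \<beta> \<longleftrightarrow> dv \<beta> q tau \<le> 0"
proof
  define S where "S = {\<beta>. \<beta> \<ge> 0 \<and> dv \<beta> q tau \<le> 0}"
  have S: "S \<noteq> {}" "bdd_below S" using dv_tau_nonpos_ex[OF q] by (auto simp: S_def)
  have t1: "tau < 1" using tau_props by auto
  show "thr q \<le> \<beta>" if "dv \<beta> q tau \<le> 0"
    unfolding thr_def using S(2) that assms by (intro cInf_lower) (auto simp: S_def)
  assume le: "thr q \<le> \<beta>"
  have le0: "dv \<gamma> q tau \<le> 0" if g: "\<gamma> > \<beta>" for \<gamma>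
  proof -
    have "Inf S < \<gamma>" using g le by (simp add: thr_def S_def)
    then obtain b where "b \<in> S" "b < \<gamma>" using cInf_lessD[OF S(1)] by auto
    thus ?thesis using dv_antimono_beta[OF t1, of b \<gamma> q] q by (auto simp: S_def)
  qed
  have "((\<lambda>n. dv (\<beta> + inverse (real (Suc n))) q tau) \<longlonglongrightarrow> dv \<beta> q tau)"
  proof (rule dv_continuous_beta[OF t1 _ _ assms q(1)])
    show "(\<lambda>n. \<beta> + inverse (real (Suc n))) \<longlonglongrightarrow> \<beta>"
      using tendsto_add[OF tendsto_const LIMSEQ_inverse_real_of_nat, of \<beta>] by simp
  qed (use assms in auto)
  moreover have "dv (\<beta> + inverse (real (Suc n))) q tau \<le> 0" for n by (rule le0) auto
  ultimately show "dv \<beta> q tau \<le> 0" by (intro LIMSEQ_le_const2) auto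
qed

lemma thr_pos: "thr q > 0"
  using thr_nonneg thr_le_iff[of 0] dv_0_tau_pos[of q] q by (cases "thr q = 0") auto

lemma kappa_eq_tau_iff_thr: "\<beta> \<ge> 0 \<Longrightarrow> kappa \<beta> q = tau \<longleftrightarrow> thr q \<le> \<beta>"
  using kappa_eq_tau_iff[of \<beta> q] thr_le_iff[of \<beta>] q by auto

end

end

section \<open>Continuous families of fluxes\<close>

lemma deriv_bound_from_zero:
  fixes d d' :: "real \<Rightarrow> real"
  assumes "\<And>s. (d has_real_derivative d' s) (at s)" "\<And>s. s \<in> {-R..R} \<Longrightarrow> \<bar>d' s\<bar> \<le> e" "d 0 = 0" "s \<in> {-R..R}"
  shows "\<bar>d s\<bar> \<le> e * R"
proof -
  have e: "e \<ge> 0" using assms(2)[of s] assms(4) by force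
  consider "s = 0" | "s > 0" | "s < 0" by linarith
  hence "\<exists>z\<in>{-R..R}. d s = s * d' z"
  proof cases
    case 1 thus ?thesis using assms by (intro bexI[of _ 0]) auto
  next
    case 2
    then obtain z where "0 < z" "z < s" "d s - d 0 = (s - 0) * d' z" using MVT2[of 0 s d d'] assms(1) by blast
    thus ?thesis using assms by (intro bexI[of _ z]) auto
  next
    case 3
    then obtain z where "s < z" "z < 0" "d 0 - d s = (0 - s) * d' z" using MVT2[of s 0 d d'] assms(1) by blast
    thus ?thesis using assms by (intro bexI[of _ z]) auto
  qed
  then obtain z where z: "z \<in> {-R..R}" "d s = s * d' z" by auto
  have "\<bar>s\<bar> * \<bar>d' z\<bar> \<le> R * e" using assms(4) assms(2)[OF z(1)] e by (intro mult_mono) auto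
  thus ?thesis by (simp add: z(2) abs_mult mult.commute)
qed

text \<open>Joint continuity is required of the second derivatives only; since \<open>\<Phi>\<close>
  and \<open>\<Phi>1\<close> vanish at \<open>s = 0\<close>, their locally uniform dependence on
  \<open>u\<close> follows by integrating from 0.\<close>

locale flux_family =
  fixes \<Phi> \<Phi>1 \<Phi>2 :: "real \<Rightarrow> real \<Rightarrow> real"
  assumes flux: "flux (\<Phi> u) (\<Phi>1 u) (\<Phi>2 u)"
    and cont_\<Phi>2: "continuous_on UNIV (\<lambda>(u, s). \<Phi>2 u s)"
    and \<Phi>_0: "\<Phi> u 0 = 0" and \<Phi>1_0: "\<Phi>1 u 0 = 0"

sublocale flux_family \<subseteq> fl: flux "\<Phi> u" "\<Phi>1 u" "\<Phi>2 u" for u by (rule flux)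

context flux_family begin

lemma \<Phi>2_close:
  assumes "e > 0"
  shows "\<exists>d>0. \<forall>u. \<bar>u - u0\<bar> < d \<longrightarrow> (\<forall>s\<in>{-R..R}. \<bar>\<Phi>2 u s - \<Phi>2 u0 s\<bar> \<le> e)"
proof -
  define K where "K = {u0 - 1..u0 + 1} \<times> {-R..R}"
  have "uniformly_continuous_on K (\<lambda>(u, s). \<Phi>2 u s)"
    by (rule compact_uniformly_continuous[OF continuous_on_subset[OF cont_\<Phi>2]])
      (auto simp: K_def intro: compact_Times)
  then obtain d where d: "d > 0" "\<And>x y. x \<in> K \<Longrightarrow> y \<in> K \<Longrightarrow> dist y x < d \<Longrightarrow>
      dist ((\<lambda>(u, s). \<Phi>2 u s) y) ((\<lambda>(u, s). \<Phi>2 u s) x) < e"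
    using assms unfolding uniformly_continuous_on_def by metis
  have "\<bar>\<Phi>2 u s - \<Phi>2 u0 s\<bar> \<le> e" if "\<bar>u - u0\<bar> < min d 1" "s \<in> {-R..R}" for u s
  proof -
    have "u \<in> {u0 - 1..u0 + 1}" using that(1) by (simp add: abs_less_iff)
    hence "(u0, s) \<in> K" "(u, s) \<in> K" using that(2) by (auto simp: K_def)
    moreover have "dist (u, s) (u0, s) < d" using that(1) by (simp add: dist_Pair_Pair dist_real_def)
    ultimately show ?thesis using d(2)[of "(u0, s)" "(u, s)"] by (simp add: dist_real_def)
  qed
  thus ?thesis using d(1) by (intro exI[of _ "min d 1"]) auto
qed

lemma \<Phi>_close:
  assumes e: "e > 0" and R: "R \<ge> 0"
  shows "\<exists>d>0. \<forall>u. \<bar>u - u0\<bar> < d \<longrightarrow> (\<forall>s\<in>{-R..R}. \<bar>\<Phi> u s - \<Phi> u0 s\<bar> \<le> e \<and> \<bar>\<Phi>1 u s - \<Phi>1 u0 s\<bar> \<le> e)"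
proof -
  define e' where "e' = e / (1 + R + R * R)"
  have P: "1 + R + R * R > 0" using R mult_nonneg_nonneg[OF R R] by linarith
  have e': "e' > 0" "e' * (1 + R + R * R) = e" using e P by (auto simp: e'_def)
  have "e' * R + e' + e' * R * R = e" using e'(2) by (simp add: algebra_simps)
  moreover have "e' * R \<ge> 0" "e' * R * R \<ge> 0" using e' R by auto
  moreover have "A \<le> E \<and> C \<le> E" if "A + B + C = E" "A \<ge> 0" "B > 0" "C \<ge> 0" for A B C E :: real
    using that by linarith
  ultimately have le: "e' * R \<le> e" "e' * R * R \<le> e" using e'(1) by blast+
  obtain d where d: "d > 0" "\<And>u s. \<bar>u - u0\<bar> < d \<Longrightarrow> s \<in> {-R..R} \<Longrightarrow> \<bar>\<Phi>2 u s - \<Phi>2 u0 s\<bar> \<le> e'"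
    using \<Phi>2_close[OF e'(1), of u0 R] by metis
  have b1: "\<bar>\<Phi>1 u s - \<Phi>1 u0 s\<bar> \<le> e' * R" if "\<bar>u - u0\<bar> < d" "s \<in> {-R..R}" for u s
    by (rule deriv_bound_from_zero[where d'="\<lambda>s. \<Phi>2 u s - \<Phi>2 u0 s", OF DERIV_diff[OF fl.dF1 fl.dF1] d(2)[OF that(1)] _ that(2)])
      (auto simp: \<Phi>1_0)
  have b0: "\<bar>\<Phi> u s - \<Phi> u0 s\<bar> \<le> e' * R * R" if "\<bar>u - u0\<bar> < d" "s \<in> {-R..R}" for u s
    by (rule deriv_bound_from_zero[where d'="\<lambda>s. \<Phi>1 u s - \<Phi>1 u0 s", OF DERIV_diff[OF fl.dF fl.dF] b1[OF that(1)] _ that(2)])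
      (auto simp: \<Phi>_0)
  show ?thesis using d(1) b0 b1 le by (intro exI[of _ d]) (meson order_trans)
qed

section \<open>Limits in the parameter of the family\<close>

context
  fixes U :: "'x \<Rightarrow> real" and u0 :: real and Fl :: "'x filter"
  assumes U: "(U \<longlongrightarrow> u0) Fl"
begin

text \<open>Working along a filter with a moving parameter \<open>U\<close> covers both uses at
  once: u tending to 0, and the fixed flux u = 0 with varying viscosity.\<close>

lemma \<Phi>_uniform_limit: "uniform_limit {-R..R} (\<lambda>x. \<Phi> (U x)) (\<Phi> u0) Fl"
  and \<Phi>1_uniform_limit: "uniform_limit {-R..R} (\<lambda>x. \<Phi>1 (U x)) (\<Phi>1 u0) Fl"
proof -
  have "\<forall>\<^sub>F x in Fl. \<forall>s\<in>{-R..R}. dist (\<Phi> (U x) s) (\<Phi> u0 s) < e \<and> dist (\<Phi>1 (U x) s) (\<Phi>1 u0 s) < e"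
    if e: "e > 0" for e
  proof (cases "R \<ge> 0")
    case True
    obtain d where d: "d > 0" "\<And>u s. \<bar>u - u0\<bar> < d \<Longrightarrow> s \<in> {-R..R} \<Longrightarrow> \<bar>\<Phi> u s - \<Phi> u0 s\<bar> \<le> e/2 \<and> \<bar>\<Phi>1 u s - \<Phi>1 u0 s\<bar> \<le> e/2"
      using \<Phi>_close[OF half_gt_zero[OF e] True, of u0] by metis
    from tendstoD[OF U d(1)] show ?thesis
    proof eventually_elim
      case (elim x)
      show ?case using d(2)[of "U x"] elim e by (force simp: dist_real_def)
    qed
  qed auto
  thus "uniform_limit {-R..R} (\<lambda>x. \<Phi> (U x)) (\<Phi> u0) Fl" "uniform_limit {-R..R} (\<lambda>x. \<Phi>1 (U x)) (\<Phi>1 u0) Fl"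
    by (simp_all add: uniform_limit_iff) (fastforce elim: eventually_mono)+
qed

lemma \<Phi>_tendsto:
  assumes c: "(c \<longlongrightarrow> c0) Fl"
  shows "((\<lambda>x. \<Phi> (U x) (c x)) \<longlongrightarrow> \<Phi> u0 c0) Fl" "((\<lambda>x. \<Phi>1 (U x) (c x)) \<longlongrightarrow> \<Phi>1 u0 c0) Fl"
proof -
  define R where "R = \<bar>c0\<bar> + 1"
  have "\<forall>\<^sub>F x in Fl. c x \<in> {-R..R}"
    using tendstoD[OF c zero_less_one] by eventually_elim (auto simp: R_def dist_real_def)
  moreover have "c0 \<in> {-R..R}" by (auto simp: R_def)
  ultimately show "((\<lambda>x. \<Phi> (U x) (c x)) \<longlongrightarrow> \<Phi> u0 c0) Fl" "((\<lambda>x. \<Phi>1 (U x) (c x)) \<longlongrightarrow> \<Phi>1 u0 c0) Fl"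
    using uniform_limit_tendsto_moving[OF \<Phi>_uniform_limit[of R] fl.contF c]
      uniform_limit_tendsto_moving[OF \<Phi>1_uniform_limit[of R] fl.contF1 c] by auto
qed

lemma tgt_tendsto: "((\<lambda>x. fl.tgt (U x) v) \<longlongrightarrow> fl.tgt u0 v) Fl"
  unfolding fl.tgt_def by (intro tendsto_intros \<Phi>_tendsto)

text \<open>The sign of \<open>tgt\<close> at a fixed point \<open>k\<close> tells on which side of
  \<open>k\<close> the tangent point lies, and strict signs persist in the limit.\<close>

lemma tau_tendsto: "((\<lambda>x. fl.tau (U x)) \<longlongrightarrow> fl.tau u0) Fl"
proof (rule order_tendstoI)
  fix k assume k: "k < fl.tau u0"
  hence k1: "k < 1" using fl.tau_props(1)[of u0] by auto
  have "fl.tgt u0 k > 0" using fl.tgt_pos_iff[OF k1] k by simp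
  from order_tendstoD(1)[OF tgt_tendsto this] show "\<forall>\<^sub>F x in Fl. k < fl.tau (U x)"
    by eventually_elim (use fl.tgt_pos_iff[OF k1] in auto)
next
  fix k assume k: "fl.tau u0 < k"
  define k' where "k' = min k 0"
  have k': "fl.tau u0 < k'" "k' < 1" using k fl.tau_props(1)[of u0] by (auto simp: k'_def)
  from order_tendstoD(2)[OF tgt_tendsto fl.tgt_neg[OF k']] show "\<forall>\<^sub>F x in Fl. fl.tau (U x) < k"
  proof eventually_elim
    case (elim x)
    have "\<not> k' < fl.tau (U x)" using fl.tgt_pos_iff[OF k'(2), of "U x"] elim by auto
    moreover have "k' \<noteq> fl.tau (U x)" using fl.tau_props(2)[of "U x"] elim by auto
    ultimately show ?case by (auto simp: k'_def)
  qed
qed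

lemma gap_uniform_limit:
  assumes v: "(v \<longlongrightarrow> v0) Fl" "v0 < 1"
  shows "uniform_limit {a..1} (\<lambda>x. gap (\<Phi> (U x)) (v x)) (gap (\<Phi> u0) v0) Fl"
proof (rule uniform_limitI)
  fix e :: real assume e: "e > 0"
  define e' where "e' = e / (4 + \<bar>1 - a\<bar>)"
  have e': "e' > 0" "e' * (4 + \<bar>1 - a\<bar>) = e" using e by (auto simp: e'_def)
  have "((\<lambda>x. chord (\<Phi> (U x)) (v x)) \<longlongrightarrow> chord (\<Phi> u0) v0) Fl"
    unfolding chord_def by (intro tendsto_intros \<Phi>_tendsto v) (use v in auto)
  from tendstoD[OF this e'(1)] uniform_limitD[OF \<Phi>_uniform_limit[of "\<bar>a\<bar> + 1"] e'(1)]
  show "\<forall>\<^sub>F x in Fl. \<forall>s\<in>{a..1}. dist (gap (\<Phi> (U x)) (v x) s) (gap (\<Phi> u0) v0 s) < e"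
  proof eventually_elim
    case (elim x)
    show ?case
    proof
      fix s assume s: "s \<in> {a..1}"
      have "\<bar>gap (\<Phi> (U x)) (v x) s - gap (\<Phi> u0) v0 s\<bar> \<le> 2 * e' + e' * (1 - a)"
      proof (rule gap_diff_le)
        have m: "s \<in> {- (\<bar>a\<bar> + 1)..\<bar>a\<bar> + 1}" "1 \<in> {- (\<bar>a\<bar> + 1)..\<bar>a\<bar> + 1}" using s by auto
        show "\<bar>\<Phi> (U x) s - \<Phi> u0 s\<bar> \<le> e'" "\<bar>\<Phi> (U x) 1 - \<Phi> u0 1\<bar> \<le> e'"
          using bspec[OF elim(2) m(1)] bspec[OF elim(2) m(2)] by (auto simp: dist_real_def)
      qed (use elim(1) s in \<open>auto simp: dist_real_def\<close>)
      also have "\<dots> < e' * (4 + \<bar>1 - a\<bar>)" using e' s by (simp add: algebra_simps)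
      finally show "dist (gap (\<Phi> (U x)) (v x) s) (gap (\<Phi> u0) v0 s) < e" using e'(2) by (simp add: dist_real_def)
    qed
  qed
qed

lemma dv_tendsto:
  assumes v: "(v \<longlongrightarrow> v0) Fl" "v0 < 1" and c: "(c \<longlongrightarrow> c0) Fl" "c0 < 1"
    and b: "(b \<longlongrightarrow> b0) Fl" "\<And>x. b x \<ge> 0" "b0 \<ge> 0" and q: "q > 0"
  shows "((\<lambda>x. endval (gap (\<Phi> (U x)) (v x)) (b x) q (c x)) \<longlongrightarrow> endval (gap (\<Phi> u0) v0) b0 q c0) Fl"
proof -
  define a where "a = c0 - 1"
  have "\<forall>\<^sub>F x in Fl. a < c x" "\<forall>\<^sub>F x in Fl. c x < 1" using order_tendstoD[OF c(1)] c(2) by (auto simp: a_def)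
  hence "\<forall>\<^sub>F x in Fl. c x \<in> {a..1}" by eventually_elim auto
  thus ?thesis
    using endval_tendsto[OF _ q fl.gap_cont fl.gap_cont gap_uniform_limit[OF v] b c(1), of a] c by (auto simp: a_def)
qed

text \<open>Again a strict sign at a fixed point decides: \<open>dv\<close> is negative to the left
  of \<open>kappa\<close> and positive between \<open>kappa\<close> and \<open>tau\<close>, and both
  persist for nearby parameters.\<close>

lemma kappa_tendsto:
  assumes b: "(b \<longlongrightarrow> b0) Fl" "\<And>x. b x \<ge> 0" "b0 \<ge> 0" and q: "q > 0"
  shows "((\<lambda>x. fl.kappa (U x) (b x) q) \<longlongrightarrow> fl.kappa u0 b0 q) Fl"
proof (rule order_tendstoI)
  note kap = fl.kappa[OF b(3) q, of u0]
  fix k assume k: "k < fl.kappa u0 b0 q"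
  hence kt: "k < fl.tau u0" using kap by auto
  have k1: "k < 1" using kt fl.tau_props(1)[of u0] by auto
  have "endval (gap (\<Phi> u0) k) b0 q k < 0" using fl.dv_le_0_imp_neg[OF k kap(1) b(3) q] kap(2) by simp
  from order_tendstoD(2)[OF dv_tendsto[OF tendsto_const k1 tendsto_const k1 b q] this] order_tendstoD(1)[OF tau_tendsto kt]
  show "\<forall>\<^sub>F x in Fl. k < fl.kappa (U x) (b x) q"
    by eventually_elim (rule fl.kappa_greater[OF b(2) q], auto)
next
  note kap = fl.kappa[OF b(3) q, of u0]
  fix k assume k: "fl.kappa u0 b0 q < k"
  show "\<forall>\<^sub>F x in Fl. fl.kappa (U x) (b x) q < k"
  proof (cases "k > fl.tau u0")
    case True
    from order_tendstoD(2)[OF tau_tendsto this] show ?thesis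
      by eventually_elim (use fl.kappa(1)[OF b(2) q] le_less_trans in blast)
  next
    case False
    \<comment> \<open>The midpoint stays strictly below the limit tangent point even when
      \<open>k\<close> equals it, so it remains an admissible target for nearby fluxes.\<close>
    define v where "v = (fl.kappa u0 b0 q + k) / 2"
    have v: "fl.kappa u0 b0 q < v" "v < k" "v < fl.tau u0" using k False by (auto simp: v_def)
    have v1: "v < 1" using v fl.tau_props(1)[of u0] by auto
    have "endval (gap (\<Phi> u0) v) b0 q v > 0"
      using fl.dv_le_0_imp_neg[OF v(1) less_imp_le[OF v(3)] b(3) q] kap(2) by force
    from order_tendstoD(1)[OF dv_tendsto[OF tendsto_const v1 tendsto_const v1 b q] this] order_tendstoD(1)[OF tau_tendsto v(3)]
    show ?thesis
    proof eventually_elim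
      case (elim x)
      have "fl.kappa (U x) (b x) q < v" by (rule fl.kappa_less[OF b(2) q]) (use elim in auto)
      thus ?case using v by auto
    qed
  qed
qed

text \<open>\<open>kappa \<le> tau\<close> settles the upper side. For \<open>k\<close> below the
  limit tangent point the gap is positive just right of \<open>k\<close>, and
  \<open>dv_neg_large_beta\<close> with constants common to all nearby fluxes places
  \<open>kappa\<close> to the right of \<open>k\<close>.\<close>

lemma kappa_tendsto_tau:
  assumes b: "filterlim b at_top Fl" "\<And>x. b x \<ge> 0" and q: "q > 0"
  shows "((\<lambda>x. fl.kappa (U x) (b x) q) \<longlongrightarrow> fl.tau u0) Fl"
proof (rule order_tendstoI)
  fix k assume k: "k < fl.tau u0"
  have k1: "k < 1" using k fl.tau_props(1)[of u0] by auto
  obtain m where m: "k < m" "m \<le> 1" "\<And>s. s \<in> {k<..<m} \<Longrightarrow> gap (\<Phi> u0) k s > 0"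
    using fl.gap_sign[of k u0] k by (metis less_imp_le)
  define c where "c = k + (m - k) / 3"
  define d where "d = k + 2 * (m - k) / 3"
  have cd: "k < c" "c < d" "d < m" using m by (auto simp: c_def d_def field_simps)
  obtain z where z: "z \<in> {c..d}" "\<And>s. s \<in> {c..d} \<Longrightarrow> gap (\<Phi> u0) k z \<le> gap (\<Phi> u0) k s"
    using continuous_attains_inf[of "{c..d}" "gap (\<Phi> u0) k"] fl.gap_cont cd by auto
  \<comment> \<open>Half of the minimum of the limit gap on the middle third \<open>[c, d]\<close>;
    the other half is left for the perturbation of the flux.\<close>
  define \<eta> where "\<eta> = gap (\<Phi> u0) k z / 2"
  have \<eta>: "\<eta> > 0" using m(3)[of z] z(1) cd by (auto simp: \<eta>_def)
  have "bounded (gap (\<Phi> u0) k ` {k..1})" by (intro compact_imp_bounded compact_continuous_image fl.gap_cont) auto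
  then obtain K where K: "K > 0" "\<And>s. s \<in> {k..1} \<Longrightarrow> \<bar>gap (\<Phi> u0) k s\<bar> \<le> K" by (auto simp: bounded_pos)
  define C where "C = 2 * \<eta> * (d - c)"
  have C: "C > 0" using \<eta> cd by (auto simp: C_def)
  have "\<forall>\<^sub>F x in Fl. b x \<ge> (K + 1) / C powr q" using b(1) by (auto simp: filterlim_at_top)
  moreover have "\<forall>\<^sub>F x in Fl. \<forall>s\<in>{k..1}. dist (gap (\<Phi> (U x)) k s) (gap (\<Phi> u0) k s) < min \<eta> 1"
    using uniform_limitD[OF gap_uniform_limit[OF tendsto_const k1], of "min \<eta> 1" k] \<eta> by simp
  moreover have "\<forall>\<^sub>F x in Fl. k < fl.tau (U x)" by (rule order_tendstoD(1)[OF tau_tendsto k])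
  ultimately show "\<forall>\<^sub>F x in Fl. k < fl.kappa (U x) (b x) q"
  proof eventually_elim
    case (elim x)
    have cl: "\<bar>gap (\<Phi> (U x)) k s - gap (\<Phi> u0) k s\<bar> < \<eta>" "\<bar>gap (\<Phi> (U x)) k s - gap (\<Phi> u0) k s\<bar> < 1" if "s \<in> {k..1}" for s
      using bspec[OF elim(2) that] by (auto simp: dist_real_def)
    have "endval (gap (\<Phi> (U x)) k) (b x) q k < 0"
    proof (rule fl.dv_neg_large_beta[where c=c and b=d and k="K + 1" and C=C and \<eta>=\<eta>])
      show "- (K + 1) \<le> gap (\<Phi> (U x)) k s" if "s \<in> {k..1}" for s
        using cl(2)[OF that] K(2)[OF that] by linarith
      show "\<eta> \<le> gap (\<Phi> (U x)) k s" if "s \<in> {c..d}" for s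
      proof -
        have "s \<in> {k..1}" using that cd m by auto
        from cl(1)[OF this] z(2)[OF that] show ?thesis unfolding \<eta>_def by argo
      qed
      show "K + 1 \<le> b x * C powr q" using elim(1) C by (simp add: field_simps)
      show "C \<le> 2 * \<eta> * (d - c)" by (simp add: C_def)
    qed (use elim cd m q b(2) C in auto)
    thus ?case using fl.kappa_greater[OF b(2) q] elim(3) by auto
  qed
next
  fix k assume "fl.tau u0 < k"
  from order_tendstoD(2)[OF tau_tendsto this] show "\<forall>\<^sub>F x in Fl. fl.kappa (U x) (b x) q < k"
    by eventually_elim (use fl.kappa(1)[OF b(2) q] le_less_trans in blast)
qed

text \<open>Both gaps have double zeros at their own tangent points, and near these the second
  derivatives are close to the same \<open>N < 0\<close>. As \<open>m > 1\<close>, multiplying the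
  limit one by \<open>m\<close> makes it the more negative; integrating twice from the tangent point
  gives the claim.\<close>

lemma gap_tau_ratio:
  assumes m: "m > 1"
  shows "\<exists>d>0. \<forall>\<^sub>F x in Fl. \<forall>h\<in>{0..d}. gap (\<Phi> (U x)) (fl.tau (U x)) (fl.tau (U x) + h) \<ge> m * gap (\<Phi> u0) (fl.tau u0) (fl.tau u0 + h)"
proof -
  define t0 where "t0 = fl.tau u0"
  define N where "N = \<Phi>2 u0 t0"
  have N: "N < 0" unfolding N_def t0_def using fl.F2_neg[OF fl.tau_props(1)] by auto
  \<comment> \<open>The tolerance for which \<open>m * (N + e) = N - e\<close>, so that deviations
    up to \<open>e\<close> in both second derivatives are affordable.\<close>
  define e where "e = (m - 1) * (- N) / (1 + m)"
  have e: "e > 0" unfolding e_def using N m by (intro divide_pos_pos mult_pos_pos) auto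
  have eN: "m * (N + e) = N - e" using m by (simp add: e_def field_simps)
  have "isCont (\<lambda>(u, s). \<Phi>2 u s) (u0, t0)" using cont_\<Phi>2 by (simp add: continuous_on_eq_continuous_at)
  then obtain r where r: "r > 0" "\<And>u s. dist (u, s) (u0, t0) < r \<Longrightarrow> \<bar>\<Phi>2 u s - N\<bar> < e"
    unfolding continuous_at_eps_delta N_def using e by (fastforce simp: dist_real_def)
  define d where "d = r / 4"
  have d: "d > 0" using r by (simp add: d_def)
  have near: "\<bar>\<Phi>2 u s - N\<bar> < e" if "\<bar>u - u0\<bar> < r/4" "\<bar>s - t0\<bar> \<le> r/2" for u s
  proof (rule r(2))
    have "dist (u, s) (u0, t0) \<le> dist u u0 + dist s t0" unfolding dist_Pair_Pair by (rule sqrt_sum_squares_le_sum) auto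
    thus "dist (u, s) (u0, t0) < r" using that r(1) by (auto simp: dist_real_def)
  qed
  have "\<forall>\<^sub>F x in Fl. dist (U x) u0 < d" by (rule tendstoD[OF U d])
  moreover have "\<forall>\<^sub>F x in Fl. dist (fl.tau (U x)) t0 < d" unfolding t0_def by (rule tendstoD[OF tau_tendsto d])
  ultimately have "\<forall>\<^sub>F x in Fl. \<forall>h\<in>{0..d}. gap (\<Phi> (U x)) (fl.tau (U x)) (fl.tau (U x) + h) \<ge> m * gap (\<Phi> u0) t0 (t0 + h)"
  proof eventually_elim
    case (elim x)
    define t where "t = fl.tau (U x)"
    have tt: "\<bar>t - t0\<bar> < d" using elim by (simp add: t_def dist_real_def)
    define f0 where "f0 h = gap (\<Phi> (U x)) t (t + h) - m * gap (\<Phi> u0) t0 (t0 + h)" for h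
    define f1 where "f1 h = (\<Phi>1 (U x) (t + h) - \<Phi>1 (U x) t) - m * (\<Phi>1 u0 (t0 + h) - \<Phi>1 u0 t0)" for h
    define f2 where "f2 h = \<Phi>2 (U x) (t + h) - m * \<Phi>2 u0 (t0 + h)" for h
    have ch: "chord (\<Phi> (U x)) t = \<Phi>1 (U x) t" "chord (\<Phi> u0) t0 = \<Phi>1 u0 t0"
      unfolding t_def t0_def by (rule fl.chord_tau)+
    have d0: "(f0 has_real_derivative f1 h) (at h)" for h
      unfolding f0_def f1_def by (auto intro!: derivative_eq_intros DERIV_chain2[OF fl.gap_deriv] simp: ch)
    have d1: "(f1 has_real_derivative f2 h) (at h)" for h
      unfolding f1_def f2_def by (auto intro!: derivative_eq_intros DERIV_chain2[OF fl.dF1])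
    have f2: "f2 h \<ge> 0" if "h \<in> {0..d}" for h
    proof -
      have r4: "0 \<le> h" "h \<le> r / 4" using that by (auto simp: d_def)
      have tr: "\<bar>t - t0\<bar> < r / 4" "\<bar>U x - u0\<bar> < r / 4" using tt elim(1) by (auto simp: d_def dist_real_def)
      have "\<bar>t + h - t0\<bar> \<le> r / 2" using r4 tr(1) by linarith
      from near[OF tr(2) this] have a1: "\<bar>\<Phi>2 (U x) (t + h) - N\<bar> < e" .
      have a2: "\<bar>\<Phi>2 u0 (t0 + h) - N\<bar> < e" by (rule near) (use r4 r(1) in auto)
      have "m * \<Phi>2 u0 (t0 + h) \<le> m * (N + e)" using a2 m by (intro mult_left_mono) auto
      thus ?thesis using a1 eN by (auto simp: f2_def)
    qed
    have f1: "f1 h \<ge> 0" if "h \<in> {0..d}" for h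
    proof -
      have "f1 0 \<le> f1 h" by (rule DERIV_nonneg_imp_nondecreasing) (use that d1 f2 in \<open>auto intro!: exI\<close>)
      thus ?thesis by (simp add: f1_def)
    qed
    have "f0 h \<ge> 0" if "h \<in> {0..d}" for h
    proof -
      have "f0 0 \<le> f0 h" by (rule DERIV_nonneg_imp_nondecreasing) (use that d0 f1 in \<open>auto intro!: exI\<close>)
      moreover have "f0 0 = 0" unfolding f0_def t_def t0_def using fl.tau_props(1)[of "U x"] fl.tau_props(1)[of u0] by simp
      ultimately show ?thesis by simp
    qed
    thus ?case by (auto simp: f0_def t_def)
  qed
  thus ?thesis using d unfolding t0_def by blast
qed

text \<open>For the upper bound, a multiple of the solution at the limit threshold, shifted from one tangent
  point to the other, is a supersolution for the nearby fluxes and a slightly larger viscosity.\<close>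
lemma thr_tendsto:
  assumes q: "0 < q" "q \<le> 2/3"
  shows "((\<lambda>x. fl.thr (U x) q) \<longlongrightarrow> fl.thr u0 q) Fl"
proof (rule order_tendstoI)
  fix b assume b: "b < fl.thr u0 q"
  \<comment> \<open>Below the threshold the shooting value at the tangent point is strictly
    positive, which persists; cutting at 0 keeps the viscosity admissible.\<close>
  define b' where "b' = max b 0"
  have b': "0 \<le> b'" "b' < fl.thr u0 q" using b fl.thr_pos[OF q, of u0] by (auto simp: b'_def)
  have t1: "fl.tau u0 < 1" using fl.tau_props(1)[of u0] by auto
  have "endval (gap (\<Phi> u0) (fl.tau u0)) b' q (fl.tau u0) > 0"
    using fl.thr_le_iff[OF q b'(1), of u0] b'(2) by auto
  from order_tendstoD(1)[OF dv_tendsto[OF tau_tendsto t1 tau_tendsto t1 tendsto_const b'(1) b'(1) q(1)] this]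
  show "\<forall>\<^sub>F x in Fl. b < fl.thr (U x) q"
  proof eventually_elim
    case (elim x)
    hence "\<not> fl.thr (U x) q \<le> b'" using fl.thr_le_iff[OF q b'(1), of "U x"] by auto
    thus ?case by (auto simp: b'_def)
  qed
next
  fix B assume B: "fl.thr u0 q < B"
  define b0 where "b0 = fl.thr u0 q"
  define b where "b = (b0 + B) / 2"
  define t0 where "t0 = fl.tau u0"
  have b0: "b0 > 0" unfolding b0_def by (rule fl.thr_pos[OF q])
  have b: "b0 < b" "b < B" using B by (auto simp: b_def b0_def)
  have t01: "t0 < 1" using fl.tau_props(1)[of u0] by (auto simp: t0_def)
  obtain y0 where y0: "shoots (gap (\<Phi> u0) t0) b0 q t0 y0"
    using fl.shoots_gap_exists[of t0 b0 q u0 t0] t01 b0 q by fastforce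
  have "endval (gap (\<Phi> u0) t0) b0 q t0 = 0"
    using fl.thr_le_iff[OF q, of b0 u0] fl.dv_tau_nonneg[of b0 q u0] b0 q by (auto simp: b0_def t0_def)
  hence y0t: "y0 t0 = 0" using endval_eq[OF y0, of t0] b0 q t01 by auto
  \<comment> \<open>\<open>m\<close> solves \<open>m * b0 = b * m powr q\<close>, so
    \<open>m * y0\<close> satisfies the equation with source \<open>m * gap\<close> and viscosity
    \<open>b\<close>; \<open>m > 1\<close> because \<open>b > b0\<close>.\<close>
  define m where "m = (b / b0) powr (1 / (1 - q))"
  have m1: "m > 1" unfolding m_def using b b0 q by (intro gr_one_powr) auto
  have "m powr (1 - q) = b / b0" unfolding m_def using b b0 q by (simp add: powr_powr)
  moreover have "m powr (1 - q) = m / m powr q" using m1 by (simp add: powr_diff)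
  ultimately have mb: "m * b0 = b * m powr q" using b0 m1 by (simp add: field_simps)
  obtain d where d: "d > 0" "\<forall>\<^sub>F x in Fl. \<forall>h\<in>{0..d}. gap (\<Phi> (U x)) (fl.tau (U x)) (fl.tau (U x) + h) \<ge> m * gap (\<Phi> u0) t0 (t0 + h)"
    using gap_tau_ratio[OF m1] unfolding t0_def by blast
  define h1 where "h1 = min d ((1 - t0) / 2)"
  have h1: "h1 > 0" "h1 \<le> d" "t0 + h1 < 1" using d t01 by (auto simp: h1_def min_def field_simps)
  have y0pos: "y0 (t0 + h1) > 0"
    by (rule shoots_pos[OF y0 order.refl]) (use fl.gap_tau_neg h1 in \<open>auto simp: t0_def\<close>)
  \<comment> \<open>The sources are comparable only near the tangent point, so the supersolution
    must dominate at the right end \<open>t0 + h1\<close>. There the factor \<open>m > 1\<close>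
    gives strict inequality for the limit flux, which survives for nearby ones.\<close>
  have "endval (gap (\<Phi> u0) t0) b q (t0 + h1) \<le> y0 (t0 + h1)"
  proof -
    obtain y where y: "shoots (gap (\<Phi> u0) t0) b q t0 y"
      using fl.shoots_gap_exists[of t0 b q u0 t0] t01 b b0 q by fastforce
    have "y (t0 + h1) \<le> y0 (t0 + h1) + 2 * 0 * (1 - (t0 + h1))"
      by (rule shoots_perturb[OF y y0 _ q(1)]) (use b b0 h1 mult_right_mono[OF less_imp_le[OF b(1)] ppow_nonneg] in auto)
    thus ?thesis using endval_eq[OF y, of "t0 + h1"] h1 b b0 q by auto
  qed
  also have "\<dots> < m * y0 (t0 + h1)" using y0pos m1 by simp
  finally have lt: "endval (gap (\<Phi> u0) t0) b q (t0 + h1) < m * y0 (t0 + h1)" .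
  have bn: "b \<ge> 0" using b b0 by auto
  have tt: "((\<lambda>x. fl.tau (U x)) \<longlongrightarrow> t0) Fl" unfolding t0_def by (rule tau_tendsto)
  from order_tendstoD(2)[OF dv_tendsto[OF tt t01 tendsto_add[OF tt tendsto_const] h1(3) tendsto_const bn bn q(1)] lt]
    d(2) order_tendstoD(2)[OF tendsto_add[OF tt tendsto_const] h1(3)]
  show "\<forall>\<^sub>F x in Fl. fl.thr (U x) q < B"
  proof eventually_elim
    case (elim x)
    define t where "t = fl.tau (U x)"
    have t1: "t < 1" using fl.tau_props(1)[of "U x"] by (auto simp: t_def)
    have th: "t + h1 < 1" using elim(3) by (simp add: t_def)
    obtain y where y: "shoots (gap (\<Phi> (U x)) t) b q t y"
      using fl.shoots_gap_exists[of t b q "U x" t] t1 bn q by fastforce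
    have ye: "y (t + h1) = endval (gap (\<Phi> (U x)) t) b q (t + h1)"
      using endval_eq[OF y, of "t + h1"] th h1 bn q by auto
    have "y t \<le> m * y0 (t0 + (t - t))"
    proof (rule shoots_le_supersolution[OF y bn q(1), where b="t + h1" and z="\<lambda>s. m * y0 (t0 + (s - t))"
          and z'="\<lambda>s. m * (2 * gap (\<Phi> u0) t0 (t0 + (s - t)) + 2 * b0 * ppow q (y0 (t0 + (s - t))))"])
      fix s assume s: "s \<in> {t..t + h1}"
      have im: "(\<lambda>s. t0 + (s - t)) ` {t..t + h1} \<subseteq> {t0..1}" using h1 by auto
      have "(y0 has_real_derivative 2 * gap (\<Phi> u0) t0 (t0 + (s - t)) + 2 * b0 * ppow q (y0 (t0 + (s - t))))
          (at (t0 + (s - t)) within (\<lambda>s. t0 + (s - t)) ` {t..t + h1})"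
        by (rule has_field_derivative_subset[OF shoots_deriv[OF y0] im]) (use s h1 in auto)
      moreover have "((\<lambda>s. t0 + (s - t)) has_real_derivative 1) (at s within {t..t + h1})"
        by (auto intro!: derivative_eq_intros)
      ultimately
      have "((\<lambda>s. y0 (t0 + (s - t))) has_real_derivative 2 * gap (\<Phi> u0) t0 (t0 + (s - t)) + 2 * b0 * ppow q (y0 (t0 + (s - t)))) (at s within {t..t + h1})"
        using DERIV_image_chain by (fastforce simp: o_def)
      thus "((\<lambda>s. m * y0 (t0 + (s - t))) has_real_derivative m * (2 * gap (\<Phi> u0) t0 (t0 + (s - t)) + 2 * b0 * ppow q (y0 (t0 + (s - t))))) (at s within {t..t + h1})"
        by (rule DERIV_cmult)
      have "m * gap (\<Phi> u0) t0 (t0 + (s - t)) \<le> gap (\<Phi> (U x)) t (t + (s - t))"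
        unfolding t_def by (rule bspec[OF elim(2)]) (use s h1 in \<open>auto simp: t_def\<close>)
      moreover have "m * (b0 * ppow q (y0 (t0 + (s - t)))) = b * ppow q (m * y0 (t0 + (s - t)))"
        using m1 mb by (simp add: ppow_scale mult.assoc[symmetric])
      ultimately show "m * (2 * gap (\<Phi> u0) t0 (t0 + (s - t)) + 2 * b0 * ppow q (y0 (t0 + (s - t))))
          \<le> 2 * gap (\<Phi> (U x)) t s + 2 * b * ppow q (m * y0 (t0 + (s - t)))"
        by (simp add: algebra_simps)
    next
      show "y (t + h1) \<le> m * y0 (t0 + (t + h1 - t))" unfolding ye using elim(1) by (simp add: t_def)
    qed (use th h1 in auto)
    hence "y t \<le> 0" using y0t by simp
    hence "fl.thr (U x) q \<le> b"
      using fl.thr_le_iff[OF q bn, of "U x"] endval_eq[OF y, of t] t1 bn q by (auto simp: t_def)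
    thus ?case using b by auto
  qed
qed

end

end

section \<open>Rescaling at the origin\<close>

locale concave_convex_flux =
  fixes f f1 f2 f3 :: "real \<Rightarrow> real"
  assumes df: "(f has_real_derivative f1 x) (at x)"
    and df1: "(f1 has_real_derivative f2 x) (at x)"
    and df2: "(f2 has_real_derivative f3 x) (at x)"
    and contf3: "continuous_on UNIV f3"
    and sf2: "x \<noteq> 0 \<Longrightarrow> x * f2 x > 0"
    and f3_0_nz: "f3 0 \<noteq> 0"
    and f1_top: "filterlim f1 at_top at_top"
    and f1_bot: "filterlim f1 at_top at_bot"
begin

lemma deriv_f: "deriv f = f1" using DERIV_imp_deriv[OF df] by (intro ext)

lemma contf2: "continuous_on A f2"
  by (rule continuous_at_imp_continuous_on) (use df2 DERIV_isCont in fast)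

lemma f2_0: "f2 0 = 0"
proof -
  have t: "(f2 \<longlongrightarrow> f2 0) (at_right 0)" "(f2 \<longlongrightarrow> f2 0) (at_left 0)"
    using DERIV_isCont[OF df2[of 0]] by (auto simp: isCont_def filterlim_at_split)
  have f2p: "f2 x > 0" if "x > 0" for x using sf2[of x] that by (simp add: zero_less_mult_iff)
  have f2n: "f2 x < 0" if "x < 0" for x using sf2[of x] that by (simp add: zero_less_mult_iff)
  have "f2 0 \<ge> 0"
    by (rule tendsto_lowerbound[OF t(1)])
      (use f2p in \<open>auto simp: eventually_at_right_field intro!: exI[of _ 1] less_imp_le\<close>)
  moreover have "f2 0 \<le> 0"
    by (rule tendsto_upperbound[OF t(2)])
      (use f2n in \<open>auto simp: eventually_at_left_field intro!: exI[of _ "-1"] less_imp_le\<close>)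
  ultimately show ?thesis by simp
qed

lemma f3_0: "f3 0 > 0"
proof (rule ccontr)
  assume "\<not> f3 0 > 0"
  hence "f3 0 < 0" using f3_0_nz by simp
  then obtain d where d: "d > 0" "\<And>h. h > 0 \<Longrightarrow> h < d \<Longrightarrow> f2 (0 + h) < f2 0"
    using DERIV_neg_dec_right[OF df2[of 0]] by auto
  show False using d(2)[of "d/2"] d(1) f2_0 sf2[of "d/2"] by (auto simp: zero_less_mult_iff)
qed

text \<open>The rescalings \<open>s \<mapsto> f (u s) / u^3\<close>, with the affine part of \<open>f\<close> removed so that they converge,
  as \<open>u\<close> tends to \<open>0\<close>, to the cubic flux \<open>fam 0\<close>.\<close>
definition fam :: "real \<Rightarrow> real \<Rightarrow> real" where
  "fam u s = (if u = 0 then f3 0 / 6 * s ^ 3 else (f (u * s) - f 0 - f1 0 * (u * s)) / u ^ 3)"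
definition fam1 :: "real \<Rightarrow> real \<Rightarrow> real" where
  "fam1 u s = (if u = 0 then f3 0 / 2 * s ^ 2 else (f1 (u * s) - f1 0) / u ^ 2)"
definition fam2 :: "real \<Rightarrow> real \<Rightarrow> real" where
  "fam2 u s = (if u = 0 then f3 0 * s else f2 (u * s) / u)"

text \<open>One formula covers \<open>u = 0\<close> and \<open>u \<noteq> 0\<close>: as
  \<open>f2 0 = 0\<close>, the quotient is a value of \<open>f3\<close> near 0 times
  \<open>s\<close>. Continuity of \<open>f3\<close> at 0 then gives joint continuity of
  \<open>fam2\<close> where \<open>u = 0\<close>.\<close>

lemma fam2_mvt: "\<exists>z. \<bar>z\<bar> \<le> \<bar>u * s\<bar> \<and> fam2 u s = s * f3 z"
proof (cases "u = 0 \<or> s = 0")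
  case True
  thus ?thesis using f2_0 by (intro exI[of _ 0]) (auto simp: fam2_def)
next
  case False
  define x where "x = u * s"
  have "\<exists>z. \<bar>z\<bar> \<le> \<bar>x\<bar> \<and> f2 x = x * f3 z"
  proof (cases "x > 0")
    case True
    then obtain z where "0 < z" "z < x" "f2 x - f2 0 = (x - 0) * f3 z" using MVT2[of 0 x f2 f3] df2 by blast
    thus ?thesis using f2_0 by (intro exI[of _ z]) auto
  next
    case F: False
    moreover have "x \<noteq> 0" using False by (simp add: x_def)
    ultimately have "x < 0" by simp
    then obtain z where "x < z" "z < 0" "f2 0 - f2 x = (0 - x) * f3 z" using MVT2[of x 0 f2 f3] df2 by blast
    thus ?thesis using f2_0 by (intro exI[of _ z]) auto
  qed
  then obtain z where "\<bar>z\<bar> \<le> \<bar>x\<bar>" "f2 x = x * f3 z" by auto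
  thus ?thesis using False by (intro exI[of _ z]) (auto simp: fam2_def x_def)
qed

lemma continuous_fam2: "continuous_on UNIV (\<lambda>(u, s). fam2 u s)"
proof (rule continuous_at_imp_continuous_on, rule ballI)
  fix x0 :: "real \<times> real"
  obtain Z where Z: "\<And>u s. \<bar>Z u s\<bar> \<le> \<bar>u * s\<bar>" "\<And>u s. fam2 u s = s * f3 (Z u s)"
    using fam2_mvt by metis
  show "isCont (\<lambda>(u, s). fam2 u s) x0"
  proof (cases "fst x0 = 0")
    case False
    let ?S = "{x :: real \<times> real. fst x \<noteq> 0}"
    have "open ?S" by (intro open_Collect_neq continuous_intros)
    moreover have "continuous_on ?S (\<lambda>x. f2 (fst x * snd x) / fst x)"
      by (intro continuous_intros continuous_on_compose2[OF contf2[of UNIV]]) auto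
    hence "continuous_on ?S (\<lambda>(u, s). fam2 u s)"
      by (rule continuous_on_eq) (auto simp: fam2_def)
    ultimately show ?thesis using False continuous_on_eq_continuous_at by blast
  next
    case True
    have "((\<lambda>x. Z (fst x) (snd x)) \<longlongrightarrow> 0) (at x0)"
    proof (rule Lim_null_comparison)
      show "\<forall>\<^sub>F x in at x0. norm (Z (fst x) (snd x)) \<le> \<bar>fst x * snd x\<bar>" using Z(1) by simp
      have "((\<lambda>x. \<bar>fst x * snd x\<bar>) \<longlongrightarrow> \<bar>fst x0 * snd x0\<bar>) (at x0)" by (intro tendsto_intros)
      thus "((\<lambda>x. \<bar>fst x * snd x\<bar>) \<longlongrightarrow> 0) (at x0)" using True by simp
    qed
    moreover have "isCont f3 0" using contf3 by (simp add: continuous_on_eq_continuous_at)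
    ultimately have "((\<lambda>x. f3 (Z (fst x) (snd x))) \<longlongrightarrow> f3 0) (at x0)" by (rule isCont_tendsto_compose[rotated])
    hence "((\<lambda>x. snd x * f3 (Z (fst x) (snd x))) \<longlongrightarrow> snd x0 * f3 0) (at x0)" by (intro tendsto_intros)
    moreover have "snd x0 * f3 0 = fam2 (fst x0) (snd x0)" using True by (simp add: fam2_def)
    ultimately show ?thesis unfolding isCont_def case_prod_beta by (simp add: Z(2))
  qed
qed

lemma fam1_large: "\<exists>B. \<forall>s. \<bar>s\<bar> \<ge> B \<longrightarrow> fam1 u s \<ge> M"
proof (cases "u = 0")
  case True
  define B where "B = max 1 (2 * \<bar>M\<bar> / f3 0)"
  have "fam1 u s \<ge> M" if s: "\<bar>s\<bar> \<ge> B" for s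
  proof -
    have s1: "\<bar>s\<bar> \<ge> 1" "\<bar>s\<bar> \<ge> 2 * \<bar>M\<bar> / f3 0" using s by (auto simp: B_def)
    have "\<bar>M\<bar> \<le> f3 0 / 2 * \<bar>s\<bar>" using s1(2) f3_0 by (simp add: field_simps)
    also have "\<dots> \<le> f3 0 / 2 * (\<bar>s\<bar> * \<bar>s\<bar>)" using mult_right_mono[OF s1(1), of "\<bar>s\<bar>"] f3_0 by (intro mult_left_mono) auto
    also have "\<dots> = fam1 u s" using True by (simp add: fam1_def power2_eq_square)
    finally show ?thesis by linarith
  qed
  thus ?thesis by blast
next
  case False
  obtain A1 where A1: "\<And>x. x \<ge> A1 \<Longrightarrow> f1 x \<ge> M * u^2 + f1 0"
    using f1_top by (auto simp: filterlim_at_top eventually_at_top_linorder)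
  obtain A2 where A2: "\<And>x. x \<le> A2 \<Longrightarrow> f1 x \<ge> M * u^2 + f1 0"
    using f1_bot by (auto simp: filterlim_at_top eventually_at_bot_linorder)
  define B where "B = (\<bar>A1\<bar> + \<bar>A2\<bar>) / \<bar>u\<bar>"
  have "fam1 u s \<ge> M" if s: "\<bar>s\<bar> \<ge> B" for s
  proof -
    have "\<bar>A1\<bar> + \<bar>A2\<bar> \<le> \<bar>u * s\<bar>" using s False by (simp add: B_def abs_mult field_simps)
    hence "u * s \<ge> A1 \<or> u * s \<le> A2" by linarith
    hence "f1 (u * s) \<ge> M * u^2 + f1 0" using A1 A2 by blast
    thus ?thesis using False by (simp add: fam1_def field_simps)
  qed
  thus ?thesis by blast
qed

lemma fam_flux_family: "flux_family fam fam1 fam2"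
proof (unfold_locales)
  fix u s :: real
  show "(fam u has_real_derivative fam1 u s) (at s)"
  proof (cases "u = 0")
    case True
    thus ?thesis unfolding fam_def[abs_def] fam1_def by (auto intro!: derivative_eq_intros)
  next
    case False
    have "((\<lambda>s. f (u * s)) has_real_derivative f1 (u * s) * u) (at s)"
      by (rule DERIV_chain2[OF df]) (auto intro!: derivative_eq_intros)
    hence "((\<lambda>s. f (u * s) - f 0 - f1 0 * (u * s)) has_real_derivative f1 (u * s) * u - f1 0 * u) (at s)"
      by (auto intro!: derivative_eq_intros)
    hence "((\<lambda>s. (f (u * s) - f 0 - f1 0 * (u * s)) / u ^ 3) has_real_derivative (f1 (u * s) * u - f1 0 * u) / u ^ 3) (at s)"
      by (rule DERIV_cdivide)
    moreover have "(f1 (u * s) * u - f1 0 * u) / u ^ 3 = fam1 u s"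
      using False by (simp add: fam1_def field_simps power2_eq_square power3_eq_cube)
    ultimately show ?thesis using False unfolding fam_def[abs_def] by simp
  qed
  show "(fam1 u has_real_derivative fam2 u s) (at s)"
  proof (cases "u = 0")
    case True
    thus ?thesis unfolding fam1_def[abs_def] fam2_def by (auto intro!: derivative_eq_intros)
  next
    case False
    have "((\<lambda>s. f1 (u * s)) has_real_derivative f2 (u * s) * u) (at s)"
      by (rule DERIV_chain2[OF df1]) (auto intro!: derivative_eq_intros)
    hence "((\<lambda>s. f1 (u * s) - f1 0) has_real_derivative f2 (u * s) * u) (at s)"
      by (auto intro!: derivative_eq_intros)
    hence "((\<lambda>s. (f1 (u * s) - f1 0) / u ^ 2) has_real_derivative (f2 (u * s) * u) / u ^ 2) (at s)"
      by (rule DERIV_cdivide)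
    moreover have "(f2 (u * s) * u) / u ^ 2 = fam2 u s"
      using False by (simp add: fam2_def field_simps power2_eq_square)
    ultimately show ?thesis using False unfolding fam1_def[abs_def] by simp
  qed
  have "continuous_on UNIV (\<lambda>s. (\<lambda>(u, s). fam2 u s) (u, s))"
    by (rule continuous_on_compose2[OF continuous_fam2]) (auto intro!: continuous_intros)
  thus "continuous_on UNIV (fam2 u)" by simp
  show "s \<noteq> 0 \<Longrightarrow> s * fam2 u s > 0"
  proof (cases "u = 0")
    case True
    assume "s \<noteq> 0"
    hence "f3 0 * s^2 > 0" using f3_0 by simp
    thus ?thesis using True by (simp add: fam2_def power2_eq_square algebra_simps)
  next
    case False
    assume "s \<noteq> 0"
    hence "(u * s) * f2 (u * s) / u^2 > 0" using sf2[of "u * s"] False by (intro divide_pos_pos) auto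
    moreover have "(u * s) * f2 (u * s) / u^2 = s * fam2 u s" using False by (simp add: fam2_def power2_eq_square)
    ultimately show ?thesis by simp
  qed
  show "filterlim (fam1 u) at_top at_top"
    unfolding filterlim_at_top
  proof
    fix M
    obtain B where "\<And>s. \<bar>s\<bar> \<ge> B \<Longrightarrow> fam1 u s \<ge> M" using fam1_large[of M u] by blast
    thus "\<forall>\<^sub>F s in at_top. M \<le> fam1 u s"
      unfolding eventually_at_top_linorder by (intro exI[of _ B]) auto
  qed
  show "filterlim (fam1 u) at_top at_bot"
    unfolding filterlim_at_top
  proof
    fix M
    obtain B where "\<And>s. \<bar>s\<bar> \<ge> B \<Longrightarrow> fam1 u s \<ge> M" using fam1_large[of M u] by blast
    thus "\<forall>\<^sub>F s in at_bot. M \<le> fam1 u s"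
      unfolding eventually_at_bot_linorder by (intro exI[of _ "- B"]) auto
  qed
  show "fam u 0 = 0" "fam1 u 0 = 0" by (auto simp: fam_def fam1_def)
qed (rule continuous_fam2)

sublocale flux_family fam fam1 fam2 by (rule fam_flux_family)

section \<open>Waves, tangent and kinetic functions in rescaled variables\<close>

lemma f_fam: "u \<noteq> 0 \<Longrightarrow> f (u * s) = u ^ 3 * fam u s + f 0 + f1 0 * (u * s)"
  by (simp add: fam_def)

lemma gap_fam:
  assumes u: "u \<noteq> 0" and v: "v \<noteq> 1"
  shows "- ((f (u * v) - f u) / (u * v - u)) * (u * s - u) + f (u * s) - f u = u ^ 3 * gap (fam u) v s"
proof -
  have f: "f u = u ^ 3 * fam u 1 + f 0 + f1 0 * u" using f_fam[OF u, of 1] by simp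
  have "(f (u * v) - f u) / (u * v - u) = u^2 * chord (fam u) v + f1 0"
  proof -
    have "f (u * v) - f u = u ^ 3 * (fam u v - fam u 1) + f1 0 * (u * (v - 1))"
      unfolding f f_fam[OF u, of v] by (simp add: algebra_simps)
    also have "\<dots> = u * (v - 1) * (u^2 * chord (fam u) v + f1 0)"
      using v by (simp add: chord_def power2_eq_square power3_eq_cube field_simps)
    also have "u * (v - 1) = u * v - u" by (simp add: algebra_simps)
    finally show ?thesis using u v by (simp add: right_diff_distrib[symmetric])
  qed
  thus ?thesis unfolding f f_fam[OF u, of s] gap_def
    by (simp add: power2_eq_square power3_eq_cube algebra_simps)
qed

text \<open>The rescaled slope is \<open>u * \<bar>u\<bar> * z\<close>, so the diffusion term scales
  in modulus like \<open>\<bar>u\<bar>\<close> to the power 2 (p + 1). Dividing by the flux scale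
  \<open>u ^ 3\<close> leaves the exponent 2 p - 1 of the effective viscosity.\<close>

lemma power_term_scale:
  fixes u z :: real assumes u: "u \<noteq> 0"
  shows "\<bar>u * \<bar>u\<bar> * z\<bar> powr p * (u * \<bar>u\<bar> * z) = u ^ 3 * (\<bar>u\<bar> powr (2 * p - 1) * (\<bar>z\<bar> powr p * z))"
proof -
  have u2: "\<bar>u\<bar> powr (2 * p) = \<bar>u\<bar> powr (2 * p - 1) * \<bar>u\<bar>" using u by (simp add: powr_diff)
  have "\<bar>u * \<bar>u\<bar> * z\<bar> = \<bar>u\<bar> * \<bar>u\<bar> * \<bar>z\<bar>" by (simp add: abs_mult)
  hence "\<bar>u * \<bar>u\<bar> * z\<bar> powr p = \<bar>u\<bar> powr p * \<bar>u\<bar> powr p * \<bar>z\<bar> powr p"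
    by (simp only: powr_mult abs_ge_zero mult_nonneg_nonneg)
  also have "\<bar>u\<bar> powr p * \<bar>u\<bar> powr p = \<bar>u\<bar> powr (2 * p)" by (simp add: powr_add[symmetric])
  finally have e: "\<bar>u * \<bar>u\<bar> * z\<bar> powr p = \<bar>u\<bar> powr (2 * p - 1) * \<bar>u\<bar> * \<bar>z\<bar> powr p" by (simp add: u2)
  have "\<bar>u\<bar> * \<bar>u\<bar> = u * u" by simp
  hence u3: "u * \<bar>u\<bar> * \<bar>u\<bar> = u ^ 3" by (simp add: power3_eq_cube mult.assoc)
  have "(P * a * Z) * (u * a * z) = (u * a * a) * (P * (Z * z))" for P a Z :: real
    by (simp only: mult.assoc mult.commute mult.left_commute)
  thus ?thesis unfolding e u3[symmetric] .
qed

text \<open>\<open>profile_rescale\<close> with amplitude \<open>u\<close> and space factor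
  \<open>\<bar>u\<bar>\<close>, then with their inverses. The modulus preserves the orientation of x
  for negative \<open>u\<close>, and \<open>u * \<bar>u\<bar>^2 = u ^ 3\<close> matches the scaling
  of the flux.\<close>

lemma traveling_wave_iff_profile:
  assumes u: "u \<noteq> 0" and v: "v \<noteq> 1"
  shows "(\<exists>W. traveling_wave f \<alpha> p u (u * v) W) \<longleftrightarrow>
    (\<exists>w w1 w2. profile (gap (fam u) v) (\<alpha> * \<bar>u\<bar> powr (2 * p - 1)) p 1 v w w1 w2)" (is "?L \<longleftrightarrow> ?R")
proof -
  define G where "G s = - ((f (u * v) - f u) / (u * v - u)) * (s - u) + f s - f u" for s
  have G: "G (u * s) = u ^ 3 * gap (fam u) v s" for s unfolding G_def by (rule gap_fam[OF u v])
  have uv: "u * v \<noteq> u" using u v by simp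
  have L: "?L \<longleftrightarrow> (\<exists>w w1 w2. profile G \<alpha> p u (u * v) w w1 w2)"
    unfolding traveling_wave_def profile_def G_def using uv by simp
  have u3: "u * \<bar>u\<bar>\<^sup>2 = u ^ 3" by (simp add: power2_eq_square power3_eq_cube)
  show ?thesis
  proof
    assume ?R
    then obtain w w1 w2 where pr: "profile (gap (fam u) v) (\<alpha> * \<bar>u\<bar> powr (2 * p - 1)) p 1 v w w1 w2" by blast
    have "profile G \<alpha> p (u * 1) (u * v) (\<lambda>x. u * w (\<bar>u\<bar> * x)) (\<lambda>x. u * \<bar>u\<bar> * w1 (\<bar>u\<bar> * x)) (\<lambda>x. u * \<bar>u\<bar>\<^sup>2 * w2 (\<bar>u\<bar> * x))"
    proof (rule profile_rescale[OF pr])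
      show "\<alpha> * (\<bar>u * \<bar>u\<bar> * z\<bar> powr p) * (u * \<bar>u\<bar> * z) = u * \<bar>u\<bar>\<^sup>2 * (\<alpha> * \<bar>u\<bar> powr (2 * p - 1) * (\<bar>z\<bar> powr p) * z)" for z
        unfolding u3 mult.assoc[of \<alpha>] power_term_scale[OF u] by (simp only: mult.assoc mult.left_commute)
    qed (use u G u3 in auto)
    thus ?L unfolding L by auto
  next
    assume ?L
    then obtain w w1 w2 where pr: "profile G \<alpha> p u (u * v) w w1 w2" unfolding L by blast
    have c3: "1 / u * (1 / \<bar>u\<bar>)\<^sup>2 = 1 / u ^ 3" unfolding u3[symmetric] by (simp add: power_divide)
    have "profile (gap (fam u) v) (\<alpha> * \<bar>u\<bar> powr (2 * p - 1)) p (1 / u * u) (1 / u * (u * v))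
      (\<lambda>x. 1 / u * w (1 / \<bar>u\<bar> * x)) (\<lambda>x. 1 / u * (1 / \<bar>u\<bar>) * w1 (1 / \<bar>u\<bar> * x)) (\<lambda>x. 1 / u * (1 / \<bar>u\<bar>)\<^sup>2 * w2 (1 / \<bar>u\<bar> * x))"
    proof (rule profile_rescale[OF pr])
      show "gap (fam u) v (1 / u * s) = 1 / u * (1 / \<bar>u\<bar>)\<^sup>2 * G s" for s
        using G[of "1 / u * s"] u unfolding c3 by simp
      show "\<alpha> * \<bar>u\<bar> powr (2 * p - 1) * (\<bar>1 / u * (1 / \<bar>u\<bar>) * z\<bar> powr p) * (1 / u * (1 / \<bar>u\<bar>) * z)
        = 1 / u * (1 / \<bar>u\<bar>)\<^sup>2 * (\<alpha> * (\<bar>z\<bar> powr p) * z)" for z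
      proof -
        define y where "y = 1 / u * (1 / \<bar>u\<bar>) * z"
        have z: "z = u * \<bar>u\<bar> * y" using u by (simp add: y_def)
        have e: "\<alpha> * (\<bar>z\<bar> powr p) * z = u ^ 3 * (\<alpha> * \<bar>u\<bar> powr (2 * p - 1) * (\<bar>y\<bar> powr p) * y)"
          unfolding z mult.assoc[of \<alpha>] power_term_scale[OF u] by (simp only: mult.assoc mult.left_commute)
        show ?thesis unfolding c3 y_def[symmetric] e using u by simp
      qed
    qed (use u in auto)
    thus ?R using u by auto
  qed
qed

lemma tangent_fun_eq: assumes u: "u \<noteq> 0" shows "tangent_fun f u = u * fl.tau u"
proof -
  have iff: "(u * t \<noteq> u \<and> deriv f (u * t) = (f u - f (u * t)) / (u - u * t)) \<longleftrightarrow>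
      (t \<noteq> 1 \<and> fam1 u t = (fam u 1 - fam u t) / (1 - t))" for t
  proof (cases "t = 1")
    case False
    have f: "f u = u ^ 3 * fam u 1 + f 0 + f1 0 * u" using f_fam[OF u, of 1] by simp
    have "f u - f (u * t) = u * (1 - t) * (u^2 * ((fam u 1 - fam u t) / (1 - t)) + f1 0)"
      unfolding f f_fam[OF u, of t] using False by (simp add: power2_eq_square power3_eq_cube field_simps)
    also have "u * (1 - t) = u - u * t" by (simp add: algebra_simps)
    finally have "(f u - f (u * t)) / (u - u * t) = u^2 * ((fam u 1 - fam u t) / (1 - t)) + f1 0"
      using False u by (simp add: right_diff_distrib[symmetric])
    moreover have "deriv f (u * t) = u^2 * fam1 u t + f1 0" using u by (simp add: deriv_f fam1_def)
    moreover have "u^2 * A + f1 0 = u^2 * B + f1 0 \<longleftrightarrow> A = B" for A B using u by simp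
    moreover have "u * t \<noteq> u" using u False by simp
    ultimately show ?thesis using False by presburger
  qed auto
  have tau: "fl.tau u \<noteq> 1 \<and> fam1 u (fl.tau u) = (fam u 1 - fam u (fl.tau u)) / (1 - fl.tau u)"
    unfolding fl.tau_def by (rule theI'[OF fl.tau_ex1])
  have "(THE v. v \<noteq> u \<and> deriv f v = (f u - f v) / (u - v)) = u * fl.tau u"
  proof (rule the_equality)
    show "u * fl.tau u \<noteq> u \<and> deriv f (u * fl.tau u) = (f u - f (u * fl.tau u)) / (u - u * fl.tau u)"
      using iff tau by blast
    fix v assume v: "v \<noteq> u \<and> deriv f v = (f u - f v) / (u - v)"
    have "v = u * (v / u)" using u by simp
    hence "v / u \<noteq> 1 \<and> fam1 u (v / u) = (fam u 1 - fam u (v / u)) / (1 - v / u)" using v iff by metis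
    hence "v / u = fl.tau u" using tau fl.tau_ex1 by blast
    thus "v = u * fl.tau u" using u by (simp add: field_simps)
  qed
  thus ?thesis using u by (simp add: tangent_fun_def)
qed

text \<open>Right states are written \<open>u * v\<close>. As the tangent point is negative, the
  sign and modulus conditions merge into \<open>v \<le> fl.tau u\<close>, and reachability becomes
  vanishing of the shooting value.\<close>

lemma kinetic_fun_eq:
  assumes u: "u \<noteq> 0" and \<alpha>: "\<alpha> > 0" and p: "p \<ge> 0"
  shows "kinetic_fun f \<alpha> p u = u * fl.kappa u (\<alpha> * \<bar>u\<bar> powr (2 * p - 1)) ((p + 1) / 2)"
proof -
  define b where "b = \<alpha> * \<bar>u\<bar> powr (2 * p - 1)"
  define q where "q = (p + 1) / 2"
  define k where "k = fl.kappa u b q"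
  have b: "b > 0" using u \<alpha> by (simp add: b_def)
  have q: "q > 0" using p by (simp add: q_def)
  let ?D = "\<lambda>v. endval (gap (fam u) v) b q v"
  have iff: "(u * v * u < 0 \<and> \<bar>u * v\<bar> \<ge> \<bar>tangent_fun f u\<bar> \<and> (\<exists>w. traveling_wave f \<alpha> p u (u * v) w)) \<longleftrightarrow>
      v \<le> fl.tau u \<and> ?D v = 0" for v
  proof -
    have t: "fl.tau u < 0" by (rule fl.tau_props)
    have "u * v * u = v * (u * u)" by (simp only: mult.commute mult.left_commute)
    moreover have "u * u > 0" using u not_real_square_gt_zero by blast
    ultimately have s: "u * v * u < 0 \<longleftrightarrow> v < 0" by (simp only: mult_less_0_iff) auto
    have m: "\<bar>u * v\<bar> \<ge> \<bar>tangent_fun f u\<bar> \<longleftrightarrow> \<bar>v\<bar> \<ge> \<bar>fl.tau u\<bar>"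
      unfolding tangent_fun_eq[OF u] using u by (simp add: abs_mult)
    have r: "(\<exists>w. traveling_wave f \<alpha> p u (u * v) w) \<longleftrightarrow> ?D v = 0" if "v \<le> fl.tau u"
    proof -
      have v1: "v \<noteq> 1" using that t by auto
      show ?thesis
        using traveling_wave_iff_profile[OF u v1, of \<alpha> p]
          fl.profile_imp_dv_zero[OF that b p] fl.dv_zero_imp_profile[OF that b p]
        unfolding b_def[symmetric] q_def by blast
    qed
    have "v < 0 \<and> \<bar>v\<bar> \<ge> \<bar>fl.tau u\<bar> \<longleftrightarrow> v \<le> fl.tau u" using t by auto
    thus ?thesis unfolding s m using r by blast
  qed
  have k: "k \<le> fl.tau u \<and> ?D k = 0" unfolding k_def using fl.kappa[of b q u] b q by auto
  have "(THE up. up * u < 0 \<and> \<bar>up\<bar> \<ge> \<bar>tangent_fun f u\<bar> \<and> (\<exists>w. traveling_wave f \<alpha> p u up w)) = u * k"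
  proof (rule the_equality)
    show "u * k * u < 0 \<and> \<bar>u * k\<bar> \<ge> \<bar>tangent_fun f u\<bar> \<and> (\<exists>w. traveling_wave f \<alpha> p u (u * k) w)"
      unfolding iff by (rule k)
    fix v assume v: "v * u < 0 \<and> \<bar>v\<bar> \<ge> \<bar>tangent_fun f u\<bar> \<and> (\<exists>w. traveling_wave f \<alpha> p u v w)"
    have e: "v = u * (v / u)" using u by simp
    have "v / u \<le> fl.tau u \<and> ?D (v / u) = 0" using v iff[of "v / u"] unfolding e[symmetric] by blast
    hence "v / u = k" using k fl.kappa_ex1[of b q u] b q by (metis less_imp_le)
    thus "v = u * k" using e by simp
  qed
  thus ?thesis using u by (simp add: kinetic_fun_def k_def b_def q_def)
qed

lemma derivative_of_scaled:
  fixes F :: "real \<Rightarrow> real"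
  assumes "F 0 = 0" "\<And>u. u \<noteq> 0 \<Longrightarrow> F u = u * k u" "(k \<longlongrightarrow> d) (at 0)"
  shows "(F has_real_derivative d) (at 0)"
proof -
  have "((\<lambda>h. (F (0 + h) - F 0) / h) \<longlongrightarrow> d) (at 0)"
    by (rule Lim_transform_eventually[OF assms(3)]) (use assms in \<open>auto simp: eventually_at_filter\<close>)
  thus ?thesis by (simp add: DERIV_def)
qed

lemma kinetic_derivative:
  assumes "\<alpha> > 0" "p \<ge> 0" "((\<lambda>u. fl.kappa u (\<alpha> * \<bar>u\<bar> powr (2 * p - 1)) ((p + 1) / 2)) \<longlongrightarrow> d) (at 0)"
  shows "(kinetic_fun f \<alpha> p has_real_derivative d) (at 0)"
  by (rule derivative_of_scaled[OF _ kinetic_fun_eq[OF _ assms(1,2)] assms(3)]) (simp add: kinetic_fun_def)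

section \<open>The limit cubic\<close>

lemma gap_cubic: "v \<noteq> 1 \<Longrightarrow> gap (fam 0) v s = f3 0 / 6 * ((s - 1) * (s - v) * (s + 1 + v))"
proof -
  assume v: "v \<noteq> 1"
  have "fam 0 v - fam 0 1 = (v - 1) * (f3 0 / 6 * (v^2 + v + 1))"
    by (simp add: fam_def power2_eq_square power3_eq_cube algebra_simps)
  hence c: "chord (fam 0) v = f3 0 / 6 * (v^2 + v + 1)" using v by (simp add: chord_def)
  show ?thesis unfolding gap_def c by (simp add: fam_def power2_eq_square power3_eq_cube field_simps)
qed

text \<open>The roots \<open>1\<close>, \<open>v\<close> and \<open>- 1 - v\<close> of the cubic gap
  sum to zero; tangency at \<open>v\<close> makes the last two coincide.\<close>

lemma tau_cubic: "fl.tau 0 = - 1 / 2"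
  by (rule fl.tau_eqI) (simp_all add: fam_def fam1_def power2_eq_square power3_eq_cube)

text \<open>For \<open>v = - 1\<close> the gap is the odd cubic \<open>f3 0 / 6 * (s^3 - s)\<close>,
  so without diffusion its integral over \<open>[- 1, 1]\<close> vanishes and the solution returns
  to 0.\<close>

lemma shoots_cubic_0: "shoots (gap (fam 0) (- 1)) 0 q (- 1) (\<lambda>s. f3 0 / 12 * (s^2 - 1)^2)"
  unfolding shoots_def
proof (intro conjI ballI)
  fix s :: real
  have "((\<lambda>s. f3 0 / 12 * (s^2 - 1)^2) has_real_derivative f3 0 / 12 * (2 * (s^2 - 1) * (2 * s))) (at s within {- 1..1})"
    by (auto intro!: derivative_eq_intros)
  moreover have "f3 0 / 12 * (2 * (s^2 - 1) * (2 * s)) = 2 * gap (fam 0) (- 1) s + 2 * 0 * ppow q (f3 0 / 12 * (s^2 - 1)^2)"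
    by (simp add: gap_cubic power2_eq_square algebra_simps)
  ultimately show "((\<lambda>s. f3 0 / 12 * (s^2 - 1)^2) has_real_derivative 2 * gap (fam 0) (- 1) s + 2 * 0 * ppow q (f3 0 / 12 * (s^2 - 1)^2)) (at s within {- 1..1})"
    by simp
qed simp

lemma kappa_cubic_0: assumes q: "q > 0" shows "fl.kappa 0 0 q = - 1"
proof -
  have "endval (gap (fam 0) (- 1)) 0 q (- 1) = 0" using endval_eq[OF shoots_cubic_0[of q], of "- 1"] q by simp
  hence "- 1 \<le> fl.tau 0 \<and> endval (gap (fam 0) (- 1)) 0 q (- 1) = 0" by (simp add: tau_cubic)
  thus ?thesis unfolding fl.kappa_def using fl.kappa_ex1[OF order.refl q, of 0] by (intro the1_equality)
qed

text \<open>Subtracting the solution without diffusion leaves only the power term, so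
  \<open>y (- 1)\<close> is a nonpositive multiple of \<open>ppow q (y x)\<close> at some interior
  \<open>x\<close>. If it were not negative, then \<open>y x \<le> 0\<close>, and
  \<open>shoots_neg\<close> would make \<open>y (- 1)\<close> negative after all.\<close>

lemma kappa_cubic_gt: assumes q: "q > 0" and b: "b > 0" shows "fl.kappa 0 b q > - 1"
proof (rule fl.kappa_greater)
  obtain y where y: "shoots (gap (fam 0) (- 1)) b q (- 1) y" using fl.shoots_gap_exists[of "- 1" b q 0 "- 1"] q b by fastforce
  define y0 where "y0 s = f3 0 / 12 * (s^2 - 1)^2" for s :: real
  have y0: "shoots (gap (fam 0) (- 1)) 0 q (- 1) y0" unfolding y0_def by (rule shoots_cubic_0)
  have le: "- 1 \<le> fl.tau 0" "- 1 < fl.tau 0" by (auto simp: tau_cubic)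
  show "- 1 \<le> fl.tau 0" by (rule le)
  have "y (- 1) < 0"
  proof (rule ccontr)
    assume neg: "\<not> y (- 1) < 0"
    have "\<exists>x\<in>{- 1<..<1}. (y0 1 - y 1) - (y0 (- 1) - y (- 1)) = ((2 * gap (fam 0) (- 1) x + 2 * 0 * ppow q (y0 x)) - (2 * gap (fam 0) (- 1) x + 2 * b * ppow q (y x))) * (1 - (- 1))"
      by (rule mvt_within_Icc[where f="\<lambda>s. y0 s - y s"]) (simp, rule DERIV_diff[OF shoots_deriv[OF y0] shoots_deriv[OF y]])
    then obtain x where x: "x \<in> {- 1<..<1}" "y (- 1) = - 4 * (b * ppow q (y x))"
      using shoots_end[OF y] by (auto simp: y0_def)
    have "\<not> b * ppow q (y x) > 0" using x(2) neg by simp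
    hence "ppow q (y x) = 0" using b ppow_nonneg[of q "y x"] by (auto simp: zero_less_mult_iff)
    hence "max 0 (y x) powr q = 0" by (simp add: ppow_def)
    hence "y x \<le> 0" by (simp add: powr_eq_0_iff max_def split: if_splits)
    moreover obtain m where m: "- 1 \<le> m" "m \<le> 1" "\<And>s. s \<in> {- 1<..<m} \<Longrightarrow> gap (fam 0) (- 1) s > 0" "\<And>s. s \<in> {m<..<1} \<Longrightarrow> gap (fam 0) (- 1) s < 0"
      by (rule fl.gap_sign[OF le(1)]) blast
    ultimately have "y (- 1) < 0" using shoots_neg[OF y less_imp_le[OF b] m, of x] x(1) by auto
    thus False using neg by simp
  qed
  thus "endval (gap (fam 0) (- 1)) b q (- 1) < 0" using endval_eq[OF y, of "- 1"] b q by simp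
qed (use q b in auto)

text \<open>At the tangent point the shooting value is nonnegative; it cannot vanish, since for
  \<open>s \<le> 0\<close> the factor \<open>s - 1\<close> is at most -1 and the gap has the
  quadratic bound that \<open>shoots_three_quarters_not_zero\<close> needs.\<close>

lemma kappa_cubic_lt: assumes b: "b > 0" shows "fl.kappa 0 b (3/4) < - 1 / 2"
proof (rule fl.kappa_less)
  have t: "fl.tau 0 = - 1 / 2" by (rule tau_cubic)
  show "- 1 / 2 \<le> fl.tau 0" using t by simp
  obtain y where y: "shoots (gap (fam 0) (- 1 / 2)) b (3/4) (- 1 / 2) y"
    using fl.shoots_gap_exists[of "- 1 / 2" b "3/4" 0 "- 1 / 2"] b by fastforce
  have pos: "y s > 0" if "s \<in> {- 1 / 2<..<1}" for s
    by (rule shoots_pos[OF y order.refl _ that]) (use fl.gap_tau_neg[of _ 0] t in auto)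
  have "y (- 1 / 2) \<noteq> 0"
  proof (rule shoots_three_quarters_not_zero[OF y, of 0 "f3 0 / 6"])
    fix s :: real assume s: "s \<in> {- 1 / 2..0}"
    have "f3 0 / 6 * (s + 1 / 2)^2 * (s - 1) \<le> f3 0 / 6 * (s + 1 / 2)^2 * (- 1)"
      using s f3_0 by (intro mult_left_mono) auto
    moreover have "gap (fam 0) (- 1 / 2) s = f3 0 / 6 * ((s - 1) * (s - (- 1 / 2)) * (s + 1 + (- 1 / 2)))"
      by (rule gap_cubic) simp
    hence "gap (fam 0) (- 1 / 2) s = f3 0 / 6 * (s + 1 / 2)^2 * (s - 1)" by (simp add: power2_eq_square)
    ultimately show "gap (fam 0) (- 1 / 2) s \<le> - (f3 0 / 6) * (s - - 1 / 2)^2" by simp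
  qed (use b f3_0 pos in auto)
  hence "endval (gap (fam 0) (- 1 / 2)) b (3/4) (- 1 / 2) \<noteq> 0" using endval_eq[OF y, of "- 1 / 2"] b by simp
  moreover have "endval (gap (fam 0) (- 1 / 2)) b (3/4) (- 1 / 2) \<ge> 0"
    using fl.dv_tau_nonneg[of b "3/4" 0] b t by simp
  ultimately show "endval (gap (fam 0) (- 1 / 2)) b (3/4) (- 1 / 2) > 0" by simp
qed (use b in auto)

section \<open>Behaviour of the kinetic and threshold functions at the origin\<close>

lemma filterlim_abs_powr_neg:
  assumes c: "c > 0" shows "filterlim (\<lambda>u::real. \<bar>u\<bar> powr (- c)) at_top (at 0)"
  unfolding filterlim_at_top
proof
  fix Z :: real
  define Y where "Y = max Z 1"
  define d where "d = Y powr (- (1 / c))"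
  have Y: "Y \<ge> 1" "Y \<ge> Z" by (auto simp: Y_def)
  have d: "d > 0" "d powr (- c) = Y" using Y c by (auto simp: d_def powr_powr)
  have "Z \<le> \<bar>u\<bar> powr (- c)" if "u \<noteq> 0" "\<bar>u\<bar> < d" for u
  proof -
    have "d powr (- c) \<le> \<bar>u\<bar> powr (- c)" using that c by (intro powr_mono2') auto
    thus ?thesis using d Y by simp
  qed
  thus "\<forall>\<^sub>F u in at 0. Z \<le> \<bar>u\<bar> powr (- c)"
    unfolding eventually_at using d(1) by (intro exI[of _ d]) (auto simp: dist_real_def)
qed

lemma kinetic_derivative_lt_half:
  assumes \<alpha>: "\<alpha> > 0" and p: "0 \<le> p" "p < 1/2"
  shows "(kinetic_fun f \<alpha> p has_real_derivative - 1 / 2) (at 0)"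
proof (rule kinetic_derivative[OF \<alpha> p(1)])
  have "filterlim (\<lambda>u::real. \<bar>u\<bar> powr (- (1 - 2 * p))) at_top (at 0)" by (rule filterlim_abs_powr_neg) (use p in auto)
  hence "filterlim (\<lambda>u::real. \<bar>u\<bar> powr (2 * p - 1)) at_top (at 0)" by simp
  from filterlim_tendsto_pos_mult_at_top[OF tendsto_const \<alpha> this]
  have "filterlim (\<lambda>u::real. \<alpha> * \<bar>u\<bar> powr (2 * p - 1)) at_top (at 0)" .
  from kappa_tendsto_tau[OF tendsto_ident_at this, of "(p + 1) / 2"]
  show "((\<lambda>u. fl.kappa u (\<alpha> * \<bar>u\<bar> powr (2 * p - 1)) ((p + 1) / 2)) \<longlongrightarrow> - 1 / 2) (at 0)"
    using \<alpha> p tau_cubic by auto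
qed

lemma kinetic_derivative_half:
  assumes \<alpha>: "\<alpha> > 0"
  shows "(kinetic_fun f \<alpha> (1/2) has_real_derivative fl.kappa 0 \<alpha> (3/4)) (at 0)"
proof (rule kinetic_derivative[OF \<alpha>])
  have "((\<lambda>u. fl.kappa u \<alpha> (3/4)) \<longlongrightarrow> fl.kappa 0 \<alpha> (3/4)) (at 0)"
    by (rule kappa_tendsto[OF tendsto_ident_at tendsto_const]) (use \<alpha> in auto)
  thus "((\<lambda>u. fl.kappa u (\<alpha> * \<bar>u\<bar> powr (2 * (1/2) - 1)) ((1/2 + 1) / 2)) \<longlongrightarrow> fl.kappa 0 \<alpha> (3/4)) (at 0)"
    by (rule Lim_transform_eventually) (auto simp: eventually_at_filter)
qed auto

lemma kinetic_derivative_gt_half: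
  assumes \<alpha>: "\<alpha> > 0" and p: "p > 1/2"
  shows "(kinetic_fun f \<alpha> p has_real_derivative - 1) (at 0)"
proof (rule kinetic_derivative[OF \<alpha>])
  have "((\<lambda>u::real. \<bar>u\<bar>) \<longlongrightarrow> \<bar>0\<bar>) (at 0)" by (intro tendsto_intros)
  hence "((\<lambda>u::real. \<bar>u\<bar> powr (2 * p - 1)) \<longlongrightarrow> 0) (at 0)"
    using p by (intro tendsto_zero_powrI[OF _ tendsto_const]) auto
  hence "((\<lambda>u::real. \<alpha> * \<bar>u\<bar> powr (2 * p - 1)) \<longlongrightarrow> 0) (at 0)" by (rule tendsto_mult_right_zero)
  from kappa_tendsto[OF tendsto_ident_at this, of "(p + 1) / 2"]
  show "((\<lambda>u. fl.kappa u (\<alpha> * \<bar>u\<bar> powr (2 * p - 1)) ((p + 1) / 2)) \<longlongrightarrow> - 1) (at 0)"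
    using \<alpha> p kappa_cubic_0[of "(p + 1) / 2"] by auto
qed (use p in auto)

lemma tangent_derivative: "(tangent_fun f has_real_derivative - 1 / 2) (at 0)"
proof (rule derivative_of_scaled[OF _ tangent_fun_eq])
  show "(fl.tau \<longlongrightarrow> - 1 / 2) (at 0)"
    using tau_tendsto[OF tendsto_ident_at, of 0 UNIV] tau_cubic by simp
qed (simp add: tangent_fun_def)

lemma kinetic_derivative_half_limits:
  shows "((\<lambda>a. deriv (kinetic_fun f a (1/2)) 0) \<longlongrightarrow> - 1) (at_right 0)"
    and "((\<lambda>a. deriv (kinetic_fun f a (1/2)) 0) \<longlongrightarrow> - 1 / 2) at_top"
proof -
  \<comment> \<open>\<open>max a 0\<close> makes the viscosity nonnegative for every real
    \<open>a\<close>, as the limit lemmas demand, and agrees with \<open>a\<close> on the range that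
    matters.\<close>
  have d: "deriv (kinetic_fun f a (1/2)) 0 = fl.kappa 0 (max a 0) (3/4)" if "a > 0" for a
    using DERIV_imp_deriv[OF kinetic_derivative_half[OF that]] that by (simp add: max_def)
  have "((\<lambda>a::real. max a 0) \<longlongrightarrow> max 0 0) (at_right 0)" by (intro tendsto_intros)
  hence "((\<lambda>a. fl.kappa 0 (max a 0) (3/4)) \<longlongrightarrow> fl.kappa 0 0 (3/4)) (at_right 0)"
    by (intro kappa_tendsto[OF tendsto_const]) auto
  hence "((\<lambda>a. fl.kappa 0 (max a 0) (3/4)) \<longlongrightarrow> - 1) (at_right 0)" using kappa_cubic_0 by simp
  thus "((\<lambda>a. deriv (kinetic_fun f a (1/2)) 0) \<longlongrightarrow> - 1) (at_right 0)"
    by (rule Lim_transform_eventually) (use d in \<open>auto simp: eventually_at_filter\<close>)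
  have "filterlim (\<lambda>a::real. max a 0) at_top at_top"
    by (rule filterlim_at_top_mono[OF filterlim_ident]) auto
  hence "((\<lambda>a. fl.kappa 0 (max a 0) (3/4)) \<longlongrightarrow> fl.tau 0) at_top"
    by (intro kappa_tendsto_tau[OF tendsto_const]) auto
  hence "((\<lambda>a. fl.kappa 0 (max a 0) (3/4)) \<longlongrightarrow> - 1 / 2) at_top" by (simp only: tau_cubic)
  thus "((\<lambda>a. deriv (kinetic_fun f a (1/2)) 0) \<longlongrightarrow> - 1 / 2) at_top"
    by (rule Lim_transform_eventually) (rule eventually_mono[OF eventually_gt_at_top[of 0]], simp add: d)
qed

text \<open>The normalized condition
  \<open>thr \<le> \<alpha> * \<bar>u\<bar> powr (2 * p - 1)\<close> is solved for
  \<open>\<alpha>\<close>. Continuity, part of the defining description, comes from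
  \<open>thr_tendsto\<close>, and the value 0 at the origin from the vanishing power of
  \<open>\<bar>u\<bar>\<close>.\<close>

lemma threshold_fun_eq:
  assumes p: "0 \<le> p" "p \<le> 1/3"
  shows "threshold_fun f p = (\<lambda>u. \<bar>u\<bar> powr (1 - 2 * p) * fl.thr u ((p + 1) / 2))"
proof -
  define q where "q = (p + 1) / 2"
  have q: "0 < q" "q \<le> 2/3" using p by (auto simp: q_def)
  define A where "A u = \<bar>u\<bar> powr (1 - 2 * p) * fl.thr u q" for u
  have A0: "A u \<ge> 0" for u using fl.thr_pos[OF q, of u] by (simp add: A_def)
  have key: "kinetic_fun f \<alpha> p u = tangent_fun f u \<longleftrightarrow> \<alpha> \<ge> A u" if u: "u \<noteq> 0" and \<alpha>: "\<alpha> > 0" for u \<alpha>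
  proof -
    define b where "b = \<alpha> * \<bar>u\<bar> powr (2 * p - 1)"
    have b: "b \<ge> 0" using \<alpha> by (simp add: b_def)
    have "kinetic_fun f \<alpha> p u = tangent_fun f u \<longleftrightarrow> fl.kappa u b q = fl.tau u"
      unfolding kinetic_fun_eq[OF u \<alpha> p(1)] tangent_fun_eq[OF u] using u by (simp add: b_def q_def)
    also have "\<dots> \<longleftrightarrow> fl.thr u q \<le> b" by (rule fl.kappa_eq_tau_iff_thr[OF q b])
    also have "\<dots> \<longleftrightarrow> \<bar>u\<bar> powr (1 - 2 * p) * fl.thr u q \<le> \<bar>u\<bar> powr (1 - 2 * p) * b"
      using u by simp
    also have "\<bar>u\<bar> powr (1 - 2 * p) * b = \<alpha> * (\<bar>u\<bar> powr (1 - 2 * p) * \<bar>u\<bar> powr (2 * p - 1))" by (simp add: b_def)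
    also have "\<dots> = \<alpha>" using u by (simp add: powr_add[symmetric])
    finally show ?thesis by (simp add: A_def)
  qed
  have "continuous_on UNIV (\<lambda>u. fl.thr u q)"
    unfolding continuous_on_def using thr_tendsto[OF tendsto_ident_at q] by simp
  hence Ac: "continuous_on UNIV A"
    unfolding A_def[abs_def] using p by (intro continuous_intros continuous_on_powr') auto
  have "(THE A. continuous_on UNIV A \<and> (\<forall>u. A u \<ge> 0) \<and> A 0 = 0 \<and>
     (\<forall>u \<alpha>. u \<noteq> 0 \<longrightarrow> \<alpha> > 0 \<longrightarrow> (kinetic_fun f \<alpha> p u = tangent_fun f u \<longleftrightarrow> \<alpha> \<ge> A u))) = A"
  proof (rule the_equality)
    show "continuous_on UNIV A \<and> (\<forall>u. A u \<ge> 0) \<and> A 0 = 0 \<and>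
      (\<forall>u \<alpha>. u \<noteq> 0 \<longrightarrow> \<alpha> > 0 \<longrightarrow> (kinetic_fun f \<alpha> p u = tangent_fun f u \<longleftrightarrow> \<alpha> \<ge> A u))"
      using Ac A0 key by (simp add: A_def)
    fix B assume B: "continuous_on UNIV B \<and> (\<forall>u. B u \<ge> 0) \<and> B 0 = 0 \<and>
      (\<forall>u \<alpha>. u \<noteq> 0 \<longrightarrow> \<alpha> > 0 \<longrightarrow> (kinetic_fun f \<alpha> p u = tangent_fun f u \<longleftrightarrow> \<alpha> \<ge> B u))"
    show "B = A"
    proof
      fix u
      show "B u = A u"
      proof (cases "u = 0")
        case True thus ?thesis using B by (simp add: A_def)
      next
        case False
        have eq: "\<alpha> \<ge> A u \<longleftrightarrow> \<alpha> \<ge> B u" if "\<alpha> > 0" for \<alpha> using B key[OF False that] False that by blast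
        have "A u \<ge> 0" "B u \<ge> 0" using A0 B by auto
        show ?thesis
        proof (rule ccontr)
          assume "B u \<noteq> A u"
          \<comment> \<open>The midpoint is a positive viscosity separating two different
            candidates, so they would disagree on it.\<close>
          hence "(A u + B u) / 2 > 0" using \<open>A u \<ge> 0\<close> \<open>B u \<ge> 0\<close> by auto
          from eq[OF this] \<open>B u \<noteq> A u\<close> show False by auto
        qed
      qed
    qed
  qed
  thus ?thesis unfolding threshold_fun_def A_def[abs_def] q_def .
qed

lemma thr_tendsto_0:
  assumes "0 < q" "q \<le> 2/3" shows "((\<lambda>u. fl.thr u q) \<longlongrightarrow> fl.thr 0 q) (at 0 within S)"
  by (rule thr_tendsto[OF tendsto_ident_at assms])

text \<open>For p = 0 the prefactor is exactly \<open>\<bar>u\<bar>\<close>, so the one-sided slopes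
  are plus and minus the positive threshold of the limit cubic.\<close>

lemma threshold_derivative_linear:
  shows "\<exists>d. d \<noteq> 0 \<and> (threshold_fun f 0 has_real_derivative d) (at_right 0)"
    and "\<exists>d. d \<noteq> 0 \<and> (threshold_fun f 0 has_real_derivative d) (at_left 0)"
proof -
  have A: "threshold_fun f 0 = (\<lambda>u. \<bar>u\<bar> * fl.thr u (1/2))" using threshold_fun_eq[of 0] by (auto simp: fun_eq_iff)
  have t: "((\<lambda>u. fl.thr u (1/2)) \<longlongrightarrow> fl.thr 0 (1/2)) (at 0 within S)" for S by (rule thr_tendsto_0) auto
  have pos: "fl.thr 0 (1/2) > 0" by (rule fl.thr_pos) auto
  have "((\<lambda>u. (threshold_fun f 0 u - threshold_fun f 0 0) / (u - 0)) \<longlongrightarrow> fl.thr 0 (1/2)) (at_right 0)"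
    by (rule Lim_transform_eventually[OF t]) (auto simp: A eventually_at_filter)
  hence "(threshold_fun f 0 has_real_derivative fl.thr 0 (1/2)) (at_right 0)"
    by (simp only: has_field_derivative_iff)
  thus "\<exists>d. d \<noteq> 0 \<and> (threshold_fun f 0 has_real_derivative d) (at_right 0)" using pos by (intro exI[of _ "fl.thr 0 (1/2)"]) auto
  have "((\<lambda>u. (threshold_fun f 0 u - threshold_fun f 0 0) / (u - 0)) \<longlongrightarrow> - fl.thr 0 (1/2)) (at_left 0)"
    by (rule Lim_transform_eventually[OF tendsto_minus[OF t]]) (auto simp: A eventually_at_filter)
  hence "(threshold_fun f 0 has_real_derivative - fl.thr 0 (1/2)) (at_left 0)"
    by (simp only: has_field_derivative_iff)
  thus "\<exists>d. d \<noteq> 0 \<and> (threshold_fun f 0 has_real_derivative d) (at_left 0)" using pos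
    by (intro exI[of _ "- fl.thr 0 (1/2)"]) auto
qed

text \<open>The quotient is \<open>\<bar>u\<bar> powr (- (2 * p))\<close> times a factor with
  positive limit.\<close>

lemma threshold_superlinear:
  assumes p: "0 < p" "p \<le> 1/3"
  shows "filterlim (\<lambda>u. threshold_fun f p u / \<bar>u\<bar>) at_top (at 0)"
proof -
  define q where "q = (p + 1) / 2"
  have q: "0 < q" "q \<le> 2/3" using p by (auto simp: q_def)
  have "filterlim (\<lambda>u::real. \<bar>u\<bar> powr (- (2 * p))) at_top (at 0)" by (rule filterlim_abs_powr_neg) (use p in auto)
  from filterlim_tendsto_pos_mult_at_top[OF thr_tendsto_0[OF q] fl.thr_pos[OF q] this]
  have "filterlim (\<lambda>u. fl.thr u q * \<bar>u\<bar> powr (- (2 * p))) at_top (at 0)" .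
  moreover have "fl.thr u q * \<bar>u\<bar> powr (- (2 * p)) = threshold_fun f p u / \<bar>u\<bar>" if "u \<noteq> 0" for u
  proof -
    have "\<bar>u\<bar> powr (1 - 2 * p) = \<bar>u\<bar> powr (- (2 * p)) * \<bar>u\<bar>" using that by (simp add: powr_diff powr_minus field_simps)
    thus ?thesis using that p threshold_fun_eq[of p] by (simp add: q_def)
  qed
  hence "\<forall>\<^sub>F u in at 0. fl.thr u q * \<bar>u\<bar> powr (- (2 * p)) = threshold_fun f p u / \<bar>u\<bar>"
    by (simp add: eventually_at_filter)
  ultimately show ?thesis using filterlim_cong[OF refl refl] by fastforce
qed

end

lemma concave_convex_imp_flux:
  assumes "concave_convex f" shows "\<exists>f1 f2 f3. concave_convex_flux f f1 f2 f3"
proof -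
  obtain f1 f2 f3 where d: "\<And>u. (f has_real_derivative f1 u) (at u)" "\<And>u. (f1 has_real_derivative f2 u) (at u)"
    "\<And>u. (f2 has_real_derivative f3 u) (at u)" "continuous_on UNIV f3"
    using assms unfolding concave_convex_def C3_def by blast
  have e: "deriv f = f1" "deriv f1 = f2" "deriv f2 = f3" using DERIV_imp_deriv[OF d(1)] DERIV_imp_deriv[OF d(2)] DERIV_imp_deriv[OF d(3)] by auto
  have "concave_convex_flux f f1 f2 f3"
    using assms d unfolding concave_convex_def e by unfold_locales auto
  thus ?thesis by blast
qed

theorem mainTheorem12:
  fixes f :: "real \<Rightarrow> real" and \<alpha> p :: real
  assumes "concave_convex f" and "\<alpha> > 0" and "p \<ge> 0"
  shows "(\<exists>d. (kinetic_fun f \<alpha> p has_real_derivative d) (at 0)) \<and>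
    (p = 0 \<longrightarrow>
       (kinetic_fun f \<alpha> 0 has_real_derivative (-1/2)) (at 0) \<and>
       (tangent_fun f has_real_derivative (-1/2)) (at 0) \<and>
       (\<exists>d. d \<noteq> 0 \<and> (threshold_fun f 0 has_real_derivative d) (at_right 0)) \<and>
       (\<exists>d. d \<noteq> 0 \<and> (threshold_fun f 0 has_real_derivative d) (at_left 0))) \<and>
    (0 < p \<and> p \<le> 1/3 \<longrightarrow>
       (kinetic_fun f \<alpha> p has_real_derivative (-1/2)) (at 0) \<and>
       filterlim (\<lambda>u. threshold_fun f p u / \<bar>u\<bar>) at_top (at_right 0) \<and>
       filterlim (\<lambda>u. threshold_fun f p u / \<bar>u\<bar>) at_top (at_left 0)) \<and>
    (1/3 < p \<and> p < 1/2 \<longrightarrow>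
       (kinetic_fun f \<alpha> p has_real_derivative (-1/2)) (at 0)) \<and>
    (p = 1/2 \<longrightarrow>
       deriv (kinetic_fun f \<alpha> (1/2)) 0 \<in> {-1<..<-1/2} \<and>
       ((\<lambda>a. deriv (kinetic_fun f a (1/2)) 0) \<longlongrightarrow> -1) (at_right 0) \<and>
       ((\<lambda>a. deriv (kinetic_fun f a (1/2)) 0) \<longlongrightarrow> -1/2) at_top) \<and>
    (1/2 < p \<longrightarrow>
       (kinetic_fun f \<alpha> p has_real_derivative (-1)) (at 0))"
proof -
  obtain f1 f2 f3 where "concave_convex_flux f f1 f2 f3" using concave_convex_imp_flux[OF assms(1)] by blast
  then interpret concave_convex_flux f f1 f2 f3 .
  have lt: "(kinetic_fun f \<alpha> p has_real_derivative (-1/2)) (at 0)" if "p < 1/2"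
    by (rule kinetic_derivative_lt_half[OF assms(2,3) that])
  have half: "(kinetic_fun f \<alpha> (1/2) has_real_derivative fl.kappa 0 \<alpha> (3/4)) (at 0)"
    by (rule kinetic_derivative_half[OF assms(2)])
  have gt: "(kinetic_fun f \<alpha> p has_real_derivative (-1)) (at 0)" if "p > 1/2"
    by (rule kinetic_derivative_gt_half[OF assms(2) that])
  have ex: "\<exists>d. (kinetic_fun f \<alpha> p has_real_derivative d) (at 0)"
    using lt half gt by (cases p "1/2 :: real" rule: linorder_cases) blast+
  have interval: "deriv (kinetic_fun f \<alpha> (1/2)) 0 \<in> {-1<..<-1/2}"
    using DERIV_imp_deriv[OF half] kappa_cubic_gt[of "3/4" \<alpha>] kappa_cubic_lt[of \<alpha>] assms(2) by auto
  have sup: "filterlim (\<lambda>u. threshold_fun f p u / \<bar>u\<bar>) at_top (at_right 0) \<and>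
      filterlim (\<lambda>u. threshold_fun f p u / \<bar>u\<bar>) at_top (at_left 0)" if "0 < p" "p \<le> 1/3"
    using threshold_superlinear[OF that] by (simp add: filterlim_at_split)
  show ?thesis
    using ex lt gt interval sup tangent_derivative threshold_derivative_linear kinetic_derivative_half_limits by auto
qed

end
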